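(* Let $\mathbb K$ be an algebraically closed field of characteristic zero, let $A=(a,b)\in\mathbb K^2$ and $d\in\mathbb K\setminus\{0\}$, and let $\mathcal C\subset\mathbb K^2$ be an irreducible affine plane algebraic curve which is neither of the two lines $y_1\pm\sqrt{-1}\,y_2=0$, is not the circle $(y_1-a)^2+(y_2-b)^2=d^2$, and is not a line through $A$. Let $\mathfrak C(\mathcal C)$ be the conchoid of $\mathcal C$ from the focus $A$ and distance $d$. The following statements are equivalent: (1) $\mathcal C$ is rational and has an rdf parametrization. (2) $\mathfrak C(\mathcal C)$ has at least one rational simple component. (3) There exists a proper parametrization of $\mathcal C$ whose reparametrizing curve has at least one rational component. (4) The reparametrizing curve of every proper parametrization of $\mathcal C$ has at least one rational component. (5) All the components of $\mathfrak C(\mathcal C)$ are rational.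
   Context: Let $f$ be the irreducible defining polynomial of $\mathcal C$. For $P=(P_1,P_2)$ write $\|P\|^2=P_1^2+P_2^2$ (from the symmetric bilinear form $\mathfrak b((x_1,x_2),(y_1,y_2))=x_1y_1+x_2y_2$, no conjugation). Conchoid: let $\mathfrak B(\mathcal C)=\{(\bar x,\bar y,\lambda)\in\mathbb K^2\times\mathbb K^2\times\mathbb K:\ f(\bar y)=0,\ \|\bar x-\bar y\|^2=d^2,\ \bar x=A+\lambda(\bar y-A)\}$, with projections $\pi_1(\bar x,\bar y,\lambda)=\bar x$ and $\pi_2(\bar x,\bar y,\lambda)=\bar y$. The conchoid $\mathfrak C(\mathcal C)$ is the Zariski closure of $\pi_1(\mathfrak B(\mathcal C))$ in $\mathbb K^2$. An irreducible component $\mathcal M$ of $\mathfrak C(\mathcal C)$ is simple if there is a non-empty Zariski dense subset $\Omega\subset\mathcal M$ such that for every $Q\in\Omega$ the set $\pi_2(\pi_1^{-1}(Q))$ has exactly one element. A (rational) parametrization of an irreducible plane curve is a pair $\mathcal P(t)\in\mathbb K(t)^2$, not both entries constant, whose values are Zariski dense in the curve; it is proper if it is birational. A curve is rational if it is irreducible and has a parametrization. A parametrization $\mathcal P(t)$ of $\mathcal C$ is rdf (at rational distance to the focus $A$) if $\|\mathcal P(t)-A\|^2=m(t)^2$ for some $m(t)\in\mathbb K(t)$. Reparametrizing curve: for a parametrization $\mathcal P(t)=(P_1(t),P_2(t))$ of $\mathcal C$, the reparametrizing curve $\mathfrak G(\mathcal P)$ is the plane curve defined by the primitive part with respect to $x_2$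 of the numerator of $-2x_2(P_1(x_1)-a)+(x_2^2-1)(P_2(x_1)-b)$. Components of a plane curve are the curves defined by the non-constant irreducible factors over $\mathbb K$ of its defining polynomial.
   Formalization: Statement (4) is taken to include that C is rational: "C is rational and the reparametrizing curve of every proper parametrization of C has a rational component"; otherwise (4) would hold vacuously for a non-rational C while (1) and (3) fail. *)

theory Defs
  imports
    "HOL-Computational_Algebra.Computational_Algebra"
    "HOL-Library.Product_Plus"
begin

section \<open>Plane curves and the Zariski topology of the affine plane\<close>

text \<open>
  A bivariate polynomial is an element of K[x1][x2]: the outer variable is x2, the
  coefficients are polynomials in x1.
\<close>

type_synonym 'a bipoly = "'a poly poly"

definition bieval :: "'a::comm_ring_1 bipoly \<Rightarrow> 'a \<times> 'a \<Rightarrow> 'a" where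
  "bieval F p = poly (poly F [:snd p:]) (fst p)"

definition zero_locus :: "'a::comm_ring_1 bipoly \<Rightarrow> ('a \<times> 'a) set" where
  "zero_locus F = {p. bieval F p = 0}"

definition zariski_closed :: "('a::field \<times> 'a) set \<Rightarrow> bool" where
  "zariski_closed S \<longleftrightarrow> (\<exists>\<F>. S = {p. \<forall>F\<in>\<F>. bieval F p = 0})"

definition zariski_closure :: "('a::field \<times> 'a) set \<Rightarrow> ('a \<times> 'a) set" where
  "zariski_closure S = zariski_closed hull S"

definition zariski_irreducible :: "('a::field \<times> 'a) set \<Rightarrow> bool" where
  "zariski_irreducible S \<longleftrightarrow> S \<noteq> {} \<and>
     (\<forall>T U. zariski_closed T \<and> zariski_closed U \<and> S \<subseteq> T \<union> U \<longrightarrow> S \<subseteq> T \<or> S \<subseteq> U)"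

definition irreducible_components :: "('a::field \<times> 'a) set \<Rightarrow> ('a \<times> 'a) set set" where
  "irreducible_components S =
     {M. zariski_closed M \<and> zariski_irreducible M \<and> M \<subseteq> S \<and>
         (\<forall>N. zariski_closed N \<and> zariski_irreducible N \<and> M \<subseteq> N \<and> N \<subseteq> S \<longrightarrow> N = M)}"

text \<open>
  Units of K[x1][x2] are the non-zero constants, so an irreducible element is a
  non-constant irreducible polynomial.
\<close>

definition irreducible_curve :: "('a::field \<times> 'a) set \<Rightarrow> bool" where
  "irreducible_curve C \<longleftrightarrow> (\<exists>f. irreducible f \<and> C = zero_locus f)"

definition curve_components :: "'a::field bipoly \<Rightarrow> ('a \<times> 'a) set set" where
  "curve_components G = {zero_locus g | g. irreducible g \<and> g dvd G}"


section \<open>Rational parametrizations\<close>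

abbreviation const_ratfun :: "'a::field \<Rightarrow> 'a poly fract" where
  "const_ratfun c \<equiv> to_fract [:c:]"

text \<open>The rational function \<open>r\<close> is defined at \<open>t\<close>, with value \<open>v\<close>.\<close>

definition ratfun_value :: "'a::field poly fract \<Rightarrow> 'a \<Rightarrow> 'a \<Rightarrow> bool" where
  "ratfun_value r t v \<longleftrightarrow>
     (\<exists>p q. r = Fraction_Field.Fract p q \<and> poly q t \<noteq> 0 \<and> v = poly p t / poly q t)"

type_synonym 'a ratpair = "'a poly fract \<times> 'a poly fract"

definition ratpair_value :: "'a::field ratpair \<Rightarrow> 'a \<Rightarrow> 'a \<times> 'a \<Rightarrow> bool" where
  "ratpair_value P t Q \<longleftrightarrow> ratfun_value (fst P) t (fst Q) \<and> ratfun_value (snd P) t (snd Q)"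

definition parametrization :: "'a::field ratpair \<Rightarrow> ('a \<times> 'a) set \<Rightarrow> bool" where
  "parametrization P C \<longleftrightarrow>
     \<not> (fst P \<in> range const_ratfun \<and> snd P \<in> range const_ratfun) \<and>
     zariski_closure {Q. \<exists>t. ratpair_value P t Q} = C"

definition rational_curve :: "('a::field \<times> 'a) set \<Rightarrow> bool" where
  "rational_curve C \<longleftrightarrow> irreducible_curve C \<and> (\<exists>P. parametrization P C)"

text \<open>
  Birationality of \<open>P\<close> as a map from the affine line to \<open>C\<close>: there is a rational function
  \<open>N/D\<close> on the curve which is inverse to \<open>P\<close> on both sides generically. On the line and on
  an irreducible curve, ``generically'' means outside a finite set.
\<close>

definition proper_parametrization :: "'a::field ratpair \<Rightarrow> ('a \<times> 'a) set \<Rightarrow> bool" where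
  "proper_parametrization P C \<longleftrightarrow> parametrization P C \<and>
     (\<exists>N D. finite {t. \<not> (\<exists>Q. ratpair_value P t Q \<and> bieval D Q \<noteq> 0 \<and>
                                bieval N Q / bieval D Q = t)} \<and>
            finite {Q \<in> C. \<not> (bieval D Q \<noteq> 0 \<and>
                                ratpair_value P (bieval N Q / bieval D Q) Q)})"

definition rdf_parametrization ::
    "'a::field \<times> 'a \<Rightarrow> 'a ratpair \<Rightarrow> ('a \<times> 'a) set \<Rightarrow> bool" where
  "rdf_parametrization A P C \<longleftrightarrow> parametrization P C \<and>
     (\<exists>m. (fst P - const_ratfun (fst A))\<^sup>2 + (snd P - const_ratfun (snd A))\<^sup>2 = m\<^sup>2)"


section \<open>The conchoid\<close>

definition normsq :: "'a::field \<times> 'a \<Rightarrow> 'a" where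
  "normsq p = (fst p)\<^sup>2 + (snd p)\<^sup>2"

definition scale_pair :: "'a::field \<Rightarrow> 'a \<times> 'a \<Rightarrow> 'a \<times> 'a" where
  "scale_pair l p = (l * fst p, l * snd p)"

definition conchoid_incidence ::
    "('a::field \<times> 'a) set \<Rightarrow> 'a \<times> 'a \<Rightarrow> 'a \<Rightarrow> (('a \<times> 'a) \<times> ('a \<times> 'a) \<times> 'a) set" where
  "conchoid_incidence C A d =
     {(x, y, l). y \<in> C \<and> normsq (x - y) = d\<^sup>2 \<and> x = A + scale_pair l (y - A)}"

definition conchoid :: "('a::field \<times> 'a) set \<Rightarrow> 'a \<times> 'a \<Rightarrow> 'a \<Rightarrow> ('a \<times> 'a) set" where
  "conchoid C A d = zariski_closure ((\<lambda>(x, y, l). x) ` conchoid_incidence C A d)"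

definition simple_component ::
    "('a::field \<times> 'a) set \<Rightarrow> 'a \<times> 'a \<Rightarrow> 'a \<Rightarrow> ('a \<times> 'a) set \<Rightarrow> bool" where
  "simple_component C A d M \<longleftrightarrow> M \<in> irreducible_components (conchoid C A d) \<and>
     (\<exists>\<Omega>. \<Omega> \<noteq> {} \<and> \<Omega> \<subseteq> M \<and> zariski_closure \<Omega> = M \<and>
          (\<forall>Q\<in>\<Omega>. \<exists>!y. \<exists>l. (Q, y, l) \<in> conchoid_incidence C A d))"


section \<open>The reparametrizing curve\<close>

text \<open>
  The library's \<open>primitive_part\<close> needs a gcd class instance on the coefficient field, which
  an arbitrary field does not carry; numerator, content and primitive part are therefore
  described by divisibility. Each is unique up to a non-zero constant factor, so the set of
  components of the reparametrizing curve does not depend on the choices.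
\<close>

definition primitive_bipoly :: "'a::field bipoly \<Rightarrow> bool" where
  "primitive_bipoly G \<longleftrightarrow> (\<forall>c. (\<forall>i. c dvd coeff G i) \<longrightarrow> is_unit c)"

definition is_primitive_part :: "'a::field bipoly \<Rightarrow> 'a bipoly \<Rightarrow> bool" where
  "is_primitive_part H G \<longleftrightarrow> primitive_bipoly G \<and> (\<exists>c. H = smult c G)"

text \<open>
  \<open>E\<close> in K(x1)[x2] is written in lowest terms as \<open>H/q\<close>, with \<open>q\<close> in K[x1].
\<close>

definition is_numerator :: "'a::field poly fract poly \<Rightarrow> 'a bipoly \<Rightarrow> bool" where
  "is_numerator E H \<longleftrightarrow>
     (\<exists>q. q \<noteq> 0 \<and> map_poly to_fract H = smult (to_fract q) E \<and>
          (\<forall>c. c dvd q \<and> (\<forall>i. c dvd coeff H i) \<longrightarrow> is_unit c))"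

definition reparam_expr :: "'a::field \<times> 'a \<Rightarrow> 'a ratpair \<Rightarrow> 'a poly fract poly" where
  "reparam_expr A P =
     (let x2 = [:0, 1:] in
        - 2 * x2 * [:fst P - const_ratfun (fst A):]
        + (x2\<^sup>2 - 1) * [:snd P - const_ratfun (snd A):])"

definition reparam_components ::
    "'a::field \<times> 'a \<Rightarrow> 'a ratpair \<Rightarrow> ('a \<times> 'a) set set" where
  "reparam_components A P =
     {M. \<exists>H G. is_numerator (reparam_expr A P) H \<and> is_primitive_part H G \<and>
               M \<in> curve_components G}"

end

theory Submission
  imports Defs "Berlekamp_Zassenhaus.Unique_Factorization_Poly"
begin

text \<open>
  Write \<open>A\<close> for the focus and \<open>N(Q)\<close> for the squared norm of \<open>Q - A\<close>. Two points \<open>x\<close> and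
  \<open>y \<in> C\<close> are incident exactly when \<open>x = A + (1 + d/m) (y - A)\<close> for a square root \<open>m \<noteq> 0\<close> of
  \<open>N(y)\<close>; reading this backwards, \<open>y = A + (1 + d/n) (x - A)\<close> with the square root
  \<open>n = -(m + d)\<close> of \<open>N(x)\<close>, as long as \<open>N(x) \<noteq> 0\<close>. The whole theorem is about when these square
  roots are rational functions of a parameter.

  Suppose that \<open>P\<close> parametrizes \<open>C\<close> and \<open>N(P) = \<mu>\<^sup>2\<close>. Then the two pairs
  \<open>A + (1 \<plusminus> d/\<mu>) (P - A)\<close> together trace the conchoid, so each of its components is rational
  (\<open>rational_components_of_rdf\<close>).

  For the way back let \<open>f\<close> be the equation of \<open>C\<close>. Up to a power of \<open>n\<close> the expression
  \<open>f(A + (1 + d/n) (x - A))\<close> equals \<open>\<alpha>(x) + \<beta>(x) n\<close> for polynomials \<open>\<alpha>\<close> and \<open>\<beta>\<close>, because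
  \<open>n\<^sup>2 = N(x)\<close>. Its norm \<open>\<alpha>\<^sup>2 - N \<beta>\<^sup>2\<close> vanishes on the conchoid. Call a component degenerate if
  \<open>\<alpha>\<close> and \<open>\<beta>\<close> vanish at all its points with \<open>N \<noteq> 0, d\<^sup>2\<close>; at these points both candidates for \<open>y\<close>
  then lie on \<open>C\<close>. On a component that is not degenerate only one sign of \<open>n\<close> is possible at a general point, so the component is simple,
  and \<open>n = -\<alpha>/\<beta>\<close> is a rational function on it; a parametrization of the component is thereby
  turned into an rdf parametrization of \<open>C\<close> (\<open>rdf_of_not_degenerate\<close>). A simple component can be
  degenerate only if it lies on the circle of radius \<open>d\<close> about \<open>A\<close>, and there \<open>y = A + 2 (x - A)\<close>.
  Finally, some component is not degenerate: otherwise one could walk from a point of \<open>C\<close> along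
  the line to \<open>A\<close> in steps of signed length \<open>2 d\<close> without leaving \<open>C\<close>, and \<open>C\<close> would be that line
  (\<open>exists_component_not_degenerate\<close>).

  The equation of the reparametrizing curve is quadratic in \<open>x2\<close> with discriminant \<open>4 N(P(x1))\<close>.
  A rational component \<open>(r, w)\<close> of it therefore yields the rdf parametrization \<open>P(r)\<close>. Conversely,
  if \<open>P\<close> is proper, every parametrization of \<open>C\<close> is \<open>P(r)\<close> for some \<open>r\<close>, and if it is rdf the
  quadratic equation has a root \<open>w\<close> in \<open>K(t)\<close>. That a rational curve has a proper
  parametrization at all is Lueroth's theorem (\<open>lueroth\<close>).
\<close>

section \<open>Evaluation of polynomials and values of rational functions\<close>

lemma comm_ring_hom_poly_map_poly:
  assumes "comm_ring_hom h"
  shows "comm_ring_hom (\<lambda>p. poly (map_poly h p) x)"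
proof -
  interpret h: comm_ring_hom h by fact
  interpret m: map_poly_comm_ring_hom h by unfold_locales
  show ?thesis
    by unfold_locales (auto simp: m.hom_add m.hom_mult)
qed

lemma comm_ring_hom_const_ratfun: "comm_ring_hom (const_ratfun :: 'a::field \<Rightarrow> _)"
  by unfold_locales (auto simp flip: to_fract_add to_fract_mult simp: one_pCons[symmetric])

interpretation const_ratfun: comm_ring_hom "const_ratfun :: 'a::field \<Rightarrow> _"
  by (rule comm_ring_hom_const_ratfun)

definition ratcomp :: "'a::field poly \<Rightarrow> 'a poly fract \<Rightarrow> 'a poly fract" where
  "ratcomp p r = poly (map_poly const_ratfun p) r"

interpretation ratcomp: comm_ring_hom "\<lambda>p. ratcomp p r"
  unfolding ratcomp_def by (rule comm_ring_hom_poly_map_poly[OF comm_ring_hom_const_ratfun])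

definition bieval_ratpair :: "'a::field bipoly \<Rightarrow> 'a ratpair \<Rightarrow> 'a poly fract" where
  "bieval_ratpair F P = poly (map_poly (\<lambda>c. ratcomp c (fst P)) F) (snd P)"

interpretation bieval_ratpair: comm_ring_hom "\<lambda>F. bieval_ratpair F P"
  unfolding bieval_ratpair_def
  by (rule comm_ring_hom_poly_map_poly) unfold_locales

interpretation bieval: comm_ring_hom "\<lambda>F. bieval F (Q :: 'a::field \<times> 'a)"
  by unfold_locales (auto simp: bieval_def)

lemma bieval_pCons [simp]: "bieval (pCons c F) Q = poly c (fst Q) + snd Q * bieval F Q"
  by (simp add: bieval_def)

lemma bieval_smult [simp]: "bieval (smult c F) Q = poly c (fst Q) * bieval F Q"
  by (simp add: bieval_def)

lemma ratcomp_pCons [simp]: "ratcomp (pCons c p) r = const_ratfun c + r * ratcomp p r"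
  by (simp add: ratcomp_def const_ratfun.map_poly_pCons_hom)

lemma bieval_ratpair_pCons [simp]:
  "bieval_ratpair (pCons c F) P = ratcomp c (fst P) + snd P * bieval_ratpair F P"
  by (simp add: bieval_ratpair_def ratcomp.map_poly_pCons_hom)

lemma bieval_ratpair_smult [simp]:
  "bieval_ratpair (smult c F) P = ratcomp c (fst P) * bieval_ratpair F P"
  using bieval_ratpair.hom_mult[of "[:c:]" F P] by simp

lemma const_ratfun_simps:
  "const_ratfun 0 = 0" "const_ratfun 1 = 1"
  "const_ratfun (c + e) = const_ratfun c + const_ratfun e"
  "const_ratfun (c - e) = const_ratfun c - const_ratfun e"
  "const_ratfun (c * e) = const_ratfun c * const_ratfun e"
  "const_ratfun (- c) = - const_ratfun c"
  using comm_ring_hom_const_ratfun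
  by (auto simp: one_pCons[symmetric] simp flip: to_fract_add to_fract_mult to_fract_diff to_fract_uminus)

lemma const_ratfun_divide:
  "const_ratfun (c / e) = const_ratfun c / const_ratfun (e :: 'a::field)"
  by (cases "e = 0") (auto simp: field_simps simp flip: to_fract_mult)

lemma ratfun_value_unique:
  assumes "ratfun_value r t v" "ratfun_value r t w"
  shows "v = w"
proof -
  from assms obtain p q p' q' where
    *: "r = Fraction_Field.Fract p q" "poly q t \<noteq> 0" "v = poly p t / poly q t"
      "r = Fraction_Field.Fract p' q'" "poly q' t \<noteq> 0" "w = poly p' t / poly q' t"
    unfolding ratfun_value_def by blast
  then have "q \<noteq> 0" "q' \<noteq> 0" by auto
  with * have "p * q' = p' * q" by (metis eq_fract(1))
  then have "poly p t * poly q' t = poly p' t * poly q t" by (metis poly_mult)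
  with *(2,5) show ?thesis unfolding *(3,6) by (simp add: field_simps)
qed

lemma ratfun_value_to_fract: "ratfun_value (to_fract p) t (poly p t)"
  unfolding ratfun_value_def by (rule exI[of _ p], rule exI[of _ 1]) (simp add: to_fract_def)

lemma ratfun_value_const: "ratfun_value (const_ratfun c) t c"
  using ratfun_value_to_fract[of "[:c:]" t] by simp

lemma ratfun_value_add:
  assumes "ratfun_value r t v" "ratfun_value s t w"
  shows "ratfun_value (r + s) t (v + w)"
proof -
  from assms obtain p q p' q' where
    *: "r = Fraction_Field.Fract p q" "poly q t \<noteq> 0" "v = poly p t / poly q t"
      "s = Fraction_Field.Fract p' q'" "poly q' t \<noteq> 0" "w = poly p' t / poly q' t"
    unfolding ratfun_value_def by blast
  then have "q \<noteq> 0" "q' \<noteq> 0" by auto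
  with * have "r + s = Fraction_Field.Fract (p * q' + p' * q) (q * q')" by simp
  moreover have "v + w = poly (p * q' + p' * q) t / poly (q * q') t"
    unfolding *(3,6) using *(2,5) by (simp add: field_simps)
  moreover have "poly (q * q') t \<noteq> 0" using * by simp
  ultimately show ?thesis unfolding ratfun_value_def by blast
qed

lemma ratfun_value_mult:
  assumes "ratfun_value r t v" "ratfun_value s t w"
  shows "ratfun_value (r * s) t (v * w)"
proof -
  from assms obtain p q p' q' where
    *: "r = Fraction_Field.Fract p q" "poly q t \<noteq> 0" "v = poly p t / poly q t"
      "s = Fraction_Field.Fract p' q'" "poly q' t \<noteq> 0" "w = poly p' t / poly q' t"
    unfolding ratfun_value_def by blast
  then have "r * s = Fraction_Field.Fract (p * p') (q * q')" by simp
  moreover have "v * w = poly (p * p') t / poly (q * q') t"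
    unfolding *(3,6) using *(2,5) by (simp add: field_simps)
  moreover have "poly (q * q') t \<noteq> 0" using * by simp
  ultimately show ?thesis unfolding ratfun_value_def by blast
qed

lemma ratfun_value_diff:
  assumes "ratfun_value r t v" "ratfun_value s t w"
  shows "ratfun_value (r - s) t (v - w)"
  using ratfun_value_add[OF assms(1) ratfun_value_mult[OF ratfun_value_const[of "-1" t] assms(2)]]
  by (simp add: const_ratfun_simps)

lemma ratfun_value_power:
  assumes "ratfun_value r t v"
  shows "ratfun_value (r ^ n) t (v ^ n)"
proof (induction n)
  case 0
  show ?case using ratfun_value_const[of 1 t] by (simp add: const_ratfun_simps)
qed (use assms ratfun_value_mult in auto)

lemma ratfun_value_divide:
  assumes "ratfun_value r t v" "ratfun_value s t w" "w \<noteq> 0"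
  shows "ratfun_value (r / s) t (v / w)"
proof -
  from assms obtain p q p' q' where
    *: "r = Fraction_Field.Fract p q" "poly q t \<noteq> 0" "v = poly p t / poly q t"
      "s = Fraction_Field.Fract p' q'" "poly q' t \<noteq> 0" "w = poly p' t / poly q' t"
    unfolding ratfun_value_def by blast
  then have "r / s = Fraction_Field.Fract (p * q') (q * p')" by simp
  moreover have "v / w = poly (p * q') t / poly (q * p') t"
    unfolding *(3,6) using *(2,5) by (simp add: field_simps)
  moreover have "poly (q * p') t \<noteq> 0" using * assms by auto
  ultimately show ?thesis unfolding ratfun_value_def by blast
qed

lemma ratfun_value_0: "ratfun_value 0 t v \<longleftrightarrow> v = 0"
  using ratfun_value_const[of 0 t] ratfun_value_unique by (auto simp: const_ratfun_simps)

lemma cofinite_poly_nonzero: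
  "p \<noteq> 0 \<Longrightarrow> \<forall>\<^sub>\<infinity>t. poly (p :: 'a::idom poly) t \<noteq> 0"
  by (auto simp: eventually_cofinite poly_roots_finite)

text \<open>
  Identities in \<open>K(t)\<close> are tested at points. A rational function has a value at all but finitely
  many parameters, and a nonzero one vanishes at only finitely many, so the cofinite filter plays
  the role of the word ``general''; \<open>cofinite_ex\<close> extracts an actual parameter.
\<close>

lemma cofinite_ratfun_value: "\<forall>\<^sub>\<infinity>t. \<exists>v. ratfun_value r t v"
proof -
  obtain p q where r: "r = Fraction_Field.Fract p q" "q \<noteq> 0" by (cases r) auto
  show ?thesis
    using cofinite_poly_nonzero[OF r(2)] by eventually_elim (use r in \<open>auto simp: ratfun_value_def\<close>)
qed

lemma cofinite_ratfun_nonzero: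
  assumes "r \<noteq> 0"
  shows "\<forall>\<^sub>\<infinity>t. \<exists>v. ratfun_value r t v \<and> v \<noteq> 0"
proof -
  obtain p q where r: "r = Fraction_Field.Fract p q" "q \<noteq> 0" by (cases r) auto
  with assms have "p \<noteq> 0" by (auto simp: fract_collapse)
  from cofinite_poly_nonzero[OF this] cofinite_poly_nonzero[OF r(2)] show ?thesis
  proof eventually_elim
    case (elim t)
    have "ratfun_value r t (poly p t / poly q t)" unfolding ratfun_value_def using r elim by blast
    with elim show ?case by (metis divide_eq_0_iff)
  qed
qed

lemma cofinite_ratfun_avoids:
  assumes "r \<notin> range const_ratfun" "finite S"
  shows "\<forall>\<^sub>\<infinity>t. \<exists>v. ratfun_value r t v \<and> v \<notin> S"
proof -
  have "\<forall>\<^sub>\<infinity>t. \<forall>c\<in>S. \<exists>v. ratfun_value (r - const_ratfun c) t v \<and> v \<noteq> 0"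
    using assms by (intro eventually_ball_finite ballI cofinite_ratfun_nonzero) auto
  then show ?thesis using cofinite_ratfun_value[of r]
  proof eventually_elim
    case (elim t)
    then obtain v where v: "ratfun_value r t v" by blast
    have "v \<notin> S"
    proof
      assume "v \<in> S"
      with elim obtain u where "ratfun_value (r - const_ratfun v) t u" "u \<noteq> 0" by blast
      with ratfun_value_diff[OF v ratfun_value_const[of v t]] show False
        using ratfun_value_unique by fastforce
    qed
    with v show ?case by blast
  qed
qed

lemma cofinite_ex:
  assumes "\<forall>\<^sub>\<infinity>t :: 'a::field_char_0. R t"
  shows "\<exists>t. R t"
proof (rule ccontr)
  assume "\<nexists>t. R t"
  then have "{t. \<not> R t} = UNIV" by auto
  with assms infinite_UNIV_char_0[where 'a='a] show False by (simp add: eventually_cofinite)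
qed

lemma ratfun_eqI:
  fixes r s :: "'a::field_char_0 poly fract"
  assumes "\<forall>\<^sub>\<infinity>t. \<exists>v. ratfun_value r t v \<and> ratfun_value s t v"
  shows "r = s"
proof (rule ccontr)
  assume "r \<noteq> s"
  then have "\<forall>\<^sub>\<infinity>t. \<exists>v. ratfun_value (r - s) t v \<and> v \<noteq> 0" by (intro cofinite_ratfun_nonzero) auto
  from eventually_conj[OF assms this] obtain t where
    "(\<exists>v. ratfun_value r t v \<and> ratfun_value s t v) \<and> (\<exists>v. ratfun_value (r - s) t v \<and> v \<noteq> 0)"
    using cofinite_ex by blast
  then obtain v w where "ratfun_value r t v" "ratfun_value s t v" "ratfun_value (r - s) t w" "w \<noteq> 0"
    by blast
  with ratfun_value_diff[of r t v s v] ratfun_value_unique[of "r - s" t 0 w] show False by simp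
qed

lemma ratfun_value_ratcomp:
  assumes "ratfun_value r t v"
  shows "ratfun_value (ratcomp p r) t (poly p v)"
proof (induction p)
  case 0
  show ?case by (simp add: ratfun_value_0)
next
  case (pCons a p)
  show ?case
    using ratfun_value_add[OF ratfun_value_const ratfun_value_mult[OF assms pCons.IH]] by simp
qed

lemma ratfun_value_bieval_ratpair:
  assumes "ratpair_value P t Q"
  shows "ratfun_value (bieval_ratpair F P) t (bieval F Q)"
proof (induction F)
  case 0
  show ?case by (simp add: ratfun_value_0)
next
  case (pCons a F)
  show ?case
    using assms ratfun_value_add[OF ratfun_value_ratcomp ratfun_value_mult[OF _ pCons.IH]]
    by (auto simp: ratpair_value_def)
qed

lemma ratpair_value_unique: "ratpair_value P t Q \<Longrightarrow> ratpair_value P t Q' \<Longrightarrow> Q = Q'"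
  by (auto simp: ratpair_value_def prod_eq_iff intro: ratfun_value_unique)

lemma cofinite_ratpair_value: "\<forall>\<^sub>\<infinity>t. \<exists>Q. ratpair_value P t Q"
  using cofinite_ratfun_value[of "fst P"] cofinite_ratfun_value[of "snd P"]
  by eventually_elim (auto simp: ratpair_value_def)

lemma bieval_eq_0_of_ratpair:
  assumes "bieval_ratpair F P = 0" "ratpair_value P t Q"
  shows "bieval F Q = 0"
  using ratfun_value_bieval_ratpair[OF assms(2), of F] assms(1) by (simp add: ratfun_value_0)

lemma cofinite_bieval_nonzero:
  assumes "bieval_ratpair F P \<noteq> 0"
  shows "\<forall>\<^sub>\<infinity>t. \<exists>Q. ratpair_value P t Q \<and> bieval F Q \<noteq> 0"
  using cofinite_ratfun_nonzero[OF assms] cofinite_ratpair_value[of P]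
proof eventually_elim
  case (elim t)
  then show ?case using ratfun_value_unique ratfun_value_bieval_ratpair by blast
qed

lemma bieval_ratpair_eq_0I:
  fixes P :: "'a::field_char_0 ratpair"
  assumes "\<forall>\<^sub>\<infinity>t. \<exists>Q. ratpair_value P t Q \<and> bieval F Q = 0"
  shows "bieval_ratpair F P = 0"
proof (rule ratfun_eqI)
  show "\<forall>\<^sub>\<infinity>t. \<exists>v. ratfun_value (bieval_ratpair F P) t v \<and> ratfun_value 0 t v"
    using assms by eventually_elim (metis ratfun_value_bieval_ratpair ratfun_value_0)
qed

definition nonconstant :: "'a::field ratpair \<Rightarrow> bool" where
  "nonconstant P \<longleftrightarrow> \<not> (fst P \<in> range const_ratfun \<and> snd P \<in> range const_ratfun)"

lemma cofinite_ratpair_avoids: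
  assumes "nonconstant P" "finite S"
  shows "\<forall>\<^sub>\<infinity>t. \<exists>Q. ratpair_value P t Q \<and> Q \<notin> S"
proof (cases "fst P \<in> range const_ratfun")
  case True
  then have "snd P \<notin> range const_ratfun" using assms by (auto simp: nonconstant_def)
  from cofinite_ratfun_avoids[OF this finite_imageI[OF assms(2), of snd]] cofinite_ratfun_value[of "fst P"]
  show ?thesis by eventually_elim (force simp: ratpair_value_def)
next
  case False
  from cofinite_ratfun_avoids[OF this finite_imageI[OF assms(2), of fst]] cofinite_ratfun_value[of "snd P"]
  show ?thesis by eventually_elim (force simp: ratpair_value_def)
qed

section \<open>Zariski closures\<close>

lemma zariski_closed_Inter:
  assumes "\<And>S. S \<in> T \<Longrightarrow> zariski_closed S"
  shows "zariski_closed (\<Inter>T)"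
proof -
  have "\<Inter>T = {p. \<forall>F\<in>{F. \<Inter>T \<subseteq> zero_locus F}. bieval F p = 0}"
  proof (intro equalityI subsetI InterI)
    fix p S assume p: "p \<in> {p. \<forall>F\<in>{F. \<Inter>T \<subseteq> zero_locus F}. bieval F p = 0}" and S: "S \<in> T"
    from assms[OF S] obtain \<F> where \<F>: "S = {p. \<forall>F\<in>\<F>. bieval F p = 0}"
      unfolding zariski_closed_def by blast
    have "\<Inter>T \<subseteq> zero_locus F" if "F \<in> \<F>" for F
    proof -
      have "S \<subseteq> zero_locus F" using that \<F> by (auto simp: zero_locus_def)
      with S show ?thesis by (meson Inter_lower order_trans)
    qed
    with p \<F> show "p \<in> S" by simp
  qed (auto simp: zero_locus_def)
  then show ?thesis unfolding zariski_closed_def by (rule exI)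
qed

lemma zariski_closed_zariski_closure [simp]: "zariski_closed (zariski_closure S)"
  unfolding zariski_closure_def by (rule hull_in) (auto intro: zariski_closed_Inter)

lemma subset_zariski_closure: "S \<subseteq> zariski_closure S"
  unfolding zariski_closure_def by (rule hull_subset)

lemma zariski_closure_minimal: "S \<subseteq> T \<Longrightarrow> zariski_closed T \<Longrightarrow> zariski_closure S \<subseteq> T"
  unfolding zariski_closure_def by (rule hull_minimal)

lemma zariski_closure_closed: "zariski_closed S \<Longrightarrow> zariski_closure S = S"
  unfolding zariski_closure_def by (rule hull_same)

lemma zariski_closed_zero_locus: "zariski_closed (zero_locus F)"
  unfolding zariski_closed_def zero_locus_def by (rule exI[of _ "{F}"]) simp

lemma zariski_closed_separate:
  assumes "zariski_closed T" "Q \<notin> T"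
  obtains F where "T \<subseteq> zero_locus F" "bieval F Q \<noteq> 0"
  using assms unfolding zariski_closed_def zero_locus_def by blast

lemma zariski_closed_Un:
  assumes "zariski_closed T" "zariski_closed U"
  shows "zariski_closed (T \<union> U)"
proof -
  have "T \<union> U = {p. \<forall>F\<in>{F. T \<union> U \<subseteq> zero_locus F}. bieval F p = 0}"
  proof (intro equalityI subsetI)
    fix p assume p: "p \<in> {p. \<forall>F\<in>{F. T \<union> U \<subseteq> zero_locus F}. bieval F p = 0}"
    show "p \<in> T \<union> U"
    proof (rule ccontr)
      assume "p \<notin> T \<union> U"
      then have "p \<notin> T" "p \<notin> U" by auto
      obtain F where "T \<subseteq> zero_locus F" "bieval F p \<noteq> 0"
        using zariski_closed_separate[OF assms(1) \<open>p \<notin> T\<close>] by blast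
      moreover obtain G where "U \<subseteq> zero_locus G" "bieval G p \<noteq> 0"
        using zariski_closed_separate[OF assms(2) \<open>p \<notin> U\<close>] by blast
      ultimately have "T \<union> U \<subseteq> zero_locus (F * G)" "bieval (F * G) p \<noteq> 0"
        by (auto simp: zero_locus_def bieval.hom_mult)
      with p show False by blast
    qed
  qed (auto simp: zero_locus_def)
  then show ?thesis unfolding zariski_closed_def by (rule exI)
qed

definition param_closure :: "'a::field ratpair \<Rightarrow> ('a \<times> 'a) set" where
  "param_closure P = zariski_closure {Q. \<exists>t. ratpair_value P t Q}"

lemma parametrization_iff: "parametrization P C \<longleftrightarrow> nonconstant P \<and> param_closure P = C"
  by (simp add: parametrization_def nonconstant_def param_closure_def)

lemma ratpair_value_in_param_closure: "ratpair_value P t Q \<Longrightarrow> Q \<in> param_closure P"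
  unfolding param_closure_def by (rule subsetD[OF subset_zariski_closure]) auto

text \<open>
  A polynomial vanishes at all traced points as soon as its substitution is zero in \<open>K(t)\<close>, and a
  rational function with infinitely many zeros is zero. Questions about the closure of the traced
  points thus become identities in \<open>K(t)\<close>.
\<close>

lemma param_closure_subset_zero_locus:
  fixes P :: "'a::field_char_0 ratpair"
  shows "param_closure P \<subseteq> zero_locus F \<longleftrightarrow> bieval_ratpair F P = 0"
proof
  assume *: "param_closure P \<subseteq> zero_locus F"
  show "bieval_ratpair F P = 0"
  proof (rule bieval_ratpair_eq_0I)
    show "\<forall>\<^sub>\<infinity>t. \<exists>Q. ratpair_value P t Q \<and> bieval F Q = 0"
      using cofinite_ratpair_value[of P]
      by eventually_elim (use * ratpair_value_in_param_closure in \<open>fastforce simp: zero_locus_def\<close>)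
  qed
next
  assume *: "bieval_ratpair F P = 0"
  show "param_closure P \<subseteq> zero_locus F"
    unfolding param_closure_def
    by (rule zariski_closure_minimal[OF _ zariski_closed_zero_locus])
      (auto simp: zero_locus_def intro: bieval_eq_0_of_ratpair[OF *])
qed

lemma param_closure_eq:
  fixes P :: "'a::field_char_0 ratpair"
  shows "param_closure P = {Q. \<forall>F. bieval_ratpair F P = 0 \<longrightarrow> bieval F Q = 0}" (is "_ = ?R")
proof
  show "param_closure P \<subseteq> ?R"
  proof (intro subsetI CollectI allI impI)
    fix Q F assume "Q \<in> param_closure P" "bieval_ratpair F P = 0"
    with param_closure_subset_zero_locus[of P F] show "bieval F Q = 0" by (auto simp: zero_locus_def)
  qed
  show "?R \<subseteq> param_closure P"
  proof
    fix Q assume Q: "Q \<in> ?R"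
    show "Q \<in> param_closure P"
    proof (rule ccontr)
      assume "Q \<notin> param_closure P"
      with zariski_closed_separate[OF zariski_closed_zariski_closure] obtain F
        where "param_closure P \<subseteq> zero_locus F" "bieval F Q \<noteq> 0"
        unfolding param_closure_def by blast
      with Q show False using param_closure_subset_zero_locus by blast
    qed
  qed
qed

text \<open>
  The polynomials whose substitution is zero form a prime ideal, as \<open>K(t)\<close> is a field.
\<close>

lemma zariski_irreducible_param_closure:
  fixes P :: "'a::field_char_0 ratpair"
  shows "zariski_irreducible (param_closure P)"
  unfolding zariski_irreducible_def
proof (intro conjI allI impI)
  show "param_closure P \<noteq> {}"
  proof -
    from cofinite_ex[OF cofinite_ratpair_value[of P]] obtain t Q where "ratpair_value P t Q" by blast
    from ratpair_value_in_param_closure[OF this] show ?thesis by auto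
  qed
  fix T U :: "('a \<times> 'a) set" assume *: "zariski_closed T \<and> zariski_closed U \<and> param_closure P \<subseteq> T \<union> U"
  show "param_closure P \<subseteq> T \<or> param_closure P \<subseteq> U"
  proof (rule ccontr)
    assume "\<not> ?thesis"
    then obtain p q where pq: "p \<in> param_closure P" "p \<notin> T" "q \<in> param_closure P" "q \<notin> U" by blast
    from * pq(2) obtain F where F: "T \<subseteq> zero_locus F" "bieval F p \<noteq> 0"
      using zariski_closed_separate by blast
    from * pq(4) obtain G where G: "U \<subseteq> zero_locus G" "bieval G q \<noteq> 0"
      using zariski_closed_separate by blast
    from F G pq have FG: "T \<subseteq> zero_locus F" "\<not> param_closure P \<subseteq> zero_locus F"
      "U \<subseteq> zero_locus G" "\<not> param_closure P \<subseteq> zero_locus G"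
      by (auto simp: zero_locus_def)
    then have "bieval_ratpair (F * G) P \<noteq> 0"
      by (simp add: param_closure_subset_zero_locus bieval_ratpair.hom_mult)
    moreover have "param_closure P \<subseteq> zero_locus (F * G)"
    proof
      fix Q assume "Q \<in> param_closure P"
      with * consider "Q \<in> T" | "Q \<in> U" by blast
      then show "Q \<in> zero_locus (F * G)"
        by cases (use F(1) G(1) in \<open>auto simp: zero_locus_def bieval.hom_mult\<close>)
    qed
    ultimately show False by (simp add: param_closure_subset_zero_locus)
  qed
qed


section \<open>Irreducible plane curves\<close>

definition slice :: "'a::field \<Rightarrow> 'a bipoly \<Rightarrow> 'a poly" where
  "slice x F = map_poly (\<lambda>c. poly c x) F"

lemma bieval_slice: "bieval F (x, y) = poly (slice x F) y"
  by (induction F) (auto simp: slice_def poly_hom.map_poly_pCons_hom)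

lemma slice_eq_0_iff: "slice x F = 0 \<longleftrightarrow> [:[:-x, 1:]:] dvd F"
  by (simp add: const_poly_dvd_iff poly_eq_iff slice_def poly_eq_0_iff_dvd)

lemma irreducible_associated_vertical:
  fixes f :: "'a::field bipoly"
  assumes "irreducible f" "[:[:-x, 1:]:] dvd f"
  shows "f dvd [:[:-x, 1:]:]"
proof -
  have "\<not> [:[:-x, 1:]:] dvd 1"
    by (simp add: const_poly_dvd_iff)
  with assms show ?thesis using irreducibleD' by blast
qed

text \<open>
  A nonzero element \<open>h\<close> of least degree in the ideal generated by \<open>f\<close> and \<open>g\<close> divides every element
  of the ideal up to a factor from \<open>K[x1]\<close>. If \<open>h\<close> had positive degree, the prime \<open>f\<close> would divide
  \<open>h\<close> or the cofactor of \<open>h\<close> in a multiple of \<open>f\<close>: in the first case \<open>f\<close> divides \<open>g\<close>, in the second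
  \<open>h\<close> divides an element of \<open>K[x1]\<close>.
\<close>

lemma irreducible_eliminate:
  fixes f g :: "'a::field bipoly"
  assumes f: "irreducible f" "degree f > 0" and g: "\<not> f dvd g"
  obtains u v r where "r \<noteq> 0" "u * f + v * g = [:r:]"
proof -
  define J where "J = {u * f + v * g | u v. True}"
  have J_diff: "smult a x - h * q \<in> J" if "x \<in> J" "h \<in> J" for a x h q
  proof -
    from that obtain u v u' v' where "x = u * f + v * g" "h = u' * f + v' * g"
      unfolding J_def by blast
    then have "smult a x - h * q = (smult a u - u' * q) * f + (smult a v - v' * q) * g"
      by (simp add: algebra_simps smult_add_right)
    then show ?thesis unfolding J_def by blast
  qed
  have fJ: "f \<in> J" unfolding J_def by (rule CollectI, rule exI[of _ 1], rule exI[of _ 0]) simp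
  have gJ: "g \<in> J" unfolding J_def by (rule CollectI, rule exI[of _ 0], rule exI[of _ 1]) simp
  have "f \<noteq> 0" using f by auto
  with fJ obtain h where h: "h \<in> J" "h \<noteq> 0" and min: "\<And>h'. h' \<in> J \<Longrightarrow> h' \<noteq> 0 \<Longrightarrow> degree h \<le> degree h'"
    using ex_has_least_nat[of "\<lambda>h. h \<in> J \<and> h \<noteq> 0" f degree] by blast
  have divides: "\<exists>a q. a \<noteq> 0 \<and> smult a x = h * q" if "x \<in> J" for x
  proof -
    obtain a q where aq: "a \<noteq> 0" "smult a x = h * q + pseudo_mod x h"
      using pseudo_mod(1)[OF h(2)] by blast
    have "pseudo_mod x h \<in> J" using J_diff[OF that h(1), of a q] aq by simp
    with min pseudo_mod(2)[OF h(2), of x] have "pseudo_mod x h = 0" by fastforce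
    with aq show ?thesis by auto
  qed
  show thesis
  proof (cases "degree h = 0")
    case True
    then obtain r where r: "h = [:r:]" by (auto elim: degree_eq_zeroE)
    from h(1) obtain u v where "h = u * f + v * g" unfolding J_def by blast
    with r h(2) that show ?thesis by auto
  next
    case False
    obtain a q where a: "a \<noteq> 0" "smult a f = h * q" using divides[OF fJ] by blast
    obtain a' q' where a': "a' \<noteq> 0" "smult a' g = h * q'" using divides[OF gJ] by blast
    have pf: "prime_elem f" using f by simp
    have "f dvd h * q" unfolding a(2)[symmetric] by (rule dvd_smult) simp
    with pf have "f dvd h \<or> f dvd q" by (simp add: prime_elem_dvd_mult_iff)
    then show ?thesis
    proof
      assume "f dvd h"
      with a' have "f dvd [:a':] * g" by simp
      from prime_elem_dvd_multD[OF pf this] have "f dvd [:a':] \<or> f dvd g" .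
      with g have "f dvd [:a':]" by simp
      with a'(1) f(2) have False using dvd_imp_degree_le[of f "[:a':]"] by simp
      then show ?thesis ..
    next
      assume "f dvd q"
      then obtain k where k: "q = f * k" ..
      with a(2) have "f * [:a:] = f * (h * k)" by (simp add: ac_simps)
      with \<open>f \<noteq> 0\<close> have *: "[:a:] = h * k" using mult_left_cancel by blast
      with a(1) have "degree h + degree k = 0" by (metis degree_mult_eq degree_pCons_0 mult_eq_0_iff pCons_eq_0_iff)
      with False show ?thesis by simp
    qed
  qed
qed

text \<open>
  A weak form of Bezout's theorem. Elimination leaves finitely many abscissas; on each of these
  vertical lines \<open>f\<close> or \<open>g\<close> has only finitely many zeros, since a vertical line on which \<open>f\<close> vanishes
  is all of the curve.
\<close>

lemma finite_zero_locus_Int: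
  fixes f g :: "'a::field bipoly"
  assumes f: "irreducible f" and g: "\<not> f dvd g"
  shows "finite (zero_locus f \<inter> zero_locus g)"
proof -
  have *: "zero_locus f \<inter> zero_locus g \<subseteq> Sigma X (\<lambda>x. {y. poly (slice x f) y = 0 \<and> poly (slice x g) y = 0})"
    if "\<And>x y. bieval f (x, y) = 0 \<Longrightarrow> bieval g (x, y) = 0 \<Longrightarrow> x \<in> X" for X
    using that by (auto simp: zero_locus_def bieval_slice)
  have fin: "finite {y. poly (slice x f) y = 0 \<and> poly (slice x g) y = 0}" for x
  proof (cases "slice x f = 0")
    case True
    then have "f dvd [:[:-x, 1:]:]" using irreducible_associated_vertical[OF f] slice_eq_0_iff by blast
    with g have "slice x g \<noteq> 0" using slice_eq_0_iff dvd_trans by blast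
    then have "finite {y. poly (slice x g) y = 0}" by (rule poly_roots_finite)
    then show ?thesis by (rule rev_finite_subset) auto
  next
    case False
    then have "finite {y. poly (slice x f) y = 0}" by (rule poly_roots_finite)
    then show ?thesis by (rule rev_finite_subset) auto
  qed
  obtain r where r: "r \<noteq> 0" "\<And>Q. bieval f Q = 0 \<Longrightarrow> bieval g Q = 0 \<Longrightarrow> poly r (fst Q) = 0"
  proof (cases "degree f = 0")
    case True
    then obtain c where c: "f = [:c:]" by (auto elim: degree_eq_zeroE)
    moreover have "c \<noteq> 0" using f c by auto
    ultimately show ?thesis using that[of c] by simp
  next
    case False
    then obtain u v r where *: "r \<noteq> 0" "u * f + v * g = [:r:]"
      by (auto intro: irreducible_eliminate[OF f _ g])
    have "poly r (fst Q) = 0" if "bieval f Q = 0" "bieval g Q = 0" for Q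
      using arg_cong[OF *(2), of "\<lambda>F. bieval F Q"] that by (simp add: bieval.hom_add bieval.hom_mult)
    then show ?thesis by (rule that[OF *(1)])
  qed
  have "finite (Sigma {x. poly r x = 0} (\<lambda>x. {y. poly (slice x f) y = 0 \<and> poly (slice x g) y = 0}))"
    using poly_roots_finite[OF r(1)] fin by auto
  then show ?thesis by (rule finite_subset[rotated]) (rule *, use r(2) in fastforce)
qed

lemma infinite_zero_locus:
  fixes f :: "'a::{alg_closed_field, field_char_0} bipoly"
  assumes "irreducible f"
  shows "infinite (zero_locus f)"
proof (cases "degree f = 0")
  case True
  then obtain c where c: "f = [:c:]" by (auto elim: degree_eq_zeroE)
  have "degree c \<noteq> 0"
  proof
    assume "degree c = 0"
    then obtain e where "c = [:e:]" by (auto elim: degree_eq_zeroE)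
    with assms c have "e \<noteq> 0" by auto
    have "f * [:[:1/e:]:] = 1" unfolding c \<open>c = [:e:]\<close> using \<open>e \<noteq> 0\<close> by (simp flip: one_pCons)
    then have "f dvd 1" by (rule dvdI[OF sym])
    with assms show False using irreducible_not_unit by blast
  qed
  then obtain x where "poly c x = 0" using alg_closed_imp_poly_has_root by blast
  then have "range (Pair x) \<subseteq> zero_locus f" using c by (auto simp: zero_locus_def)
  moreover have "infinite (range (Pair x :: 'a \<Rightarrow> _))"
    using infinite_UNIV_char_0 by (auto simp: finite_image_iff inj_on_def)
  ultimately show ?thesis using finite_subset by blast
next
  case False
  have "f \<noteq> 0" using assms by auto
  then have lc: "lead_coeff f \<noteq> 0" by simp
  have "- {x. poly (lead_coeff f) x = 0} \<subseteq> fst ` zero_locus f"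
  proof
    fix x assume "x \<in> - {x. poly (lead_coeff f) x = 0}"
    then have "coeff (slice x f) (degree f) \<noteq> 0" by (simp add: slice_def)
    then have "degree (slice x f) \<noteq> 0" using False le_degree by fastforce
    then obtain y where "poly (slice x f) y = 0" using alg_closed_imp_poly_has_root by blast
    then have "(x, y) \<in> zero_locus f" by (simp add: zero_locus_def bieval_slice)
    then show "x \<in> fst ` zero_locus f" by force
  qed
  moreover have "infinite (- {x. poly (lead_coeff f) x = 0})"
    using poly_roots_finite[OF lc] infinite_UNIV_char_0 finite_compl by blast
  ultimately show ?thesis using finite_subset by blast
qed

text \<open>
  The Nullstellensatz for a plane curve: the curve is infinite, so two coprime polynomials cannot
  both vanish on it.
\<close>

lemma irreducible_dvd_iff_zero_locus:
  fixes f :: "'a::{alg_closed_field, field_char_0} bipoly"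
  assumes "irreducible f"
  shows "f dvd g \<longleftrightarrow> zero_locus f \<subseteq> zero_locus g"
proof
  assume "f dvd g"
  then show "zero_locus f \<subseteq> zero_locus g" by (auto simp: zero_locus_def bieval.hom_mult elim!: dvdE)
next
  assume "zero_locus f \<subseteq> zero_locus g"
  then have "zero_locus f \<inter> zero_locus g = zero_locus f" by blast
  then show "f dvd g" using infinite_zero_locus[OF assms] finite_zero_locus_Int[OF assms] by metis
qed

lemma irreducible_curve_subset_eq:
  fixes C D :: "('a::{alg_closed_field, field_char_0} \<times> 'a) set"
  assumes "irreducible_curve C" "irreducible_curve D" "C \<subseteq> D"
  shows "C = D"
proof -
  from assms obtain f g where f: "irreducible f" "C = zero_locus f" and g: "irreducible g" "D = zero_locus g"
    unfolding irreducible_curve_def by blast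
  with assms(3) have "f dvd g" by (simp add: irreducible_dvd_iff_zero_locus)
  with f g have "g dvd f" using irreducibleD' irreducible_not_unit by blast
  with g have "zero_locus g \<subseteq> zero_locus f" by (simp add: irreducible_dvd_iff_zero_locus)
  with f g assms(3) show ?thesis by blast
qed

section \<open>The curve traced by a pair of rational functions\<close>

text \<open>
  Gaussian elimination: a polynomial with nonzero coefficient at the top exponent serves to remove
  this coefficient from all the others.
\<close>

lemma polys_linearly_dependent:
  fixes v :: "'i \<Rightarrow> 'a::field poly"
  assumes "finite I" "card I > n" "\<And>i k. i \<in> I \<Longrightarrow> k \<ge> n \<Longrightarrow> coeff (v i) k = 0"
  shows "\<exists>c. (\<exists>i\<in>I. c i \<noteq> 0) \<and> (\<Sum>i\<in>I. smult (c i) (v i)) = 0"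
  using assms
proof (induction n arbitrary: I v)
  case 0
  then have "v i = 0" if "i \<in> I" for i using that by (simp add: poly_eq_iff)
  moreover have "I \<noteq> {}" using 0 by auto
  ultimately show ?case by (intro exI[of _ "\<lambda>_. 1"]) auto
next
  case (Suc n)
  show ?case
  proof (cases "\<forall>i\<in>I. coeff (v i) n = 0")
    case True
    have "coeff (v i) k = 0" if "i \<in> I" "k \<ge> n" for i k
      using that True Suc.prems(3)[of i k] by (cases "k = n") auto
    with Suc.IH[of I v] Suc.prems show ?thesis by auto
  next
    case False
    then obtain j where j: "j \<in> I" "coeff (v j) n \<noteq> 0" by blast
    define \<rho> where "\<rho> i = coeff (v i) n / coeff (v j) n" for i
    define w where "w i = v i - smult (\<rho> i) (v j)" for i
    have "coeff (w i) k = 0" if "i \<in> I - {j}" "k \<ge> n" for i k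
    proof (cases "k = n")
      case True
      then show ?thesis using j by (simp add: w_def \<rho>_def)
    next
      case False
      then show ?thesis using that j Suc.prems(3)[of i k] Suc.prems(3)[of j k] by (simp add: w_def)
    qed
    moreover have "card (I - {j}) > n" using Suc.prems j by simp
    ultimately obtain c where c: "\<exists>i\<in>I - {j}. c i \<noteq> 0" "(\<Sum>i\<in>I - {j}. smult (c i) (w i)) = 0"
      using Suc.IH[of "I - {j}" w] Suc.prems(1) by auto
    define c' where "c' i = (if i = j then - (\<Sum>i\<in>I - {j}. c i * \<rho> i) else c i)" for i
    have "(\<Sum>i\<in>I. smult (c' i) (v i)) = smult (c' j) (v j) + (\<Sum>i\<in>I - {j}. smult (c' i) (v i))"
      using Suc.prems(1) j(1) by (rule sum.remove)
    also have "(\<Sum>i\<in>I - {j}. smult (c' i) (v i)) = (\<Sum>i\<in>I - {j}. smult (c i) (v i))"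
      by (rule sum.cong) (auto simp: c'_def)
    also have "smult (c' j) (v j) = - (\<Sum>i\<in>I - {j}. smult (c i * \<rho> i) (v j))"
      by (simp add: c'_def smult_sum)
    also have "- (\<Sum>i\<in>I - {j}. smult (c i * \<rho> i) (v j)) + (\<Sum>i\<in>I - {j}. smult (c i) (v i))
        = (\<Sum>i\<in>I - {j}. smult (c i) (w i))"
      by (simp add: w_def smult_diff_right sum_subtractf)
    finally have "(\<Sum>i\<in>I. smult (c' i) (v i)) = 0" using c(2) by simp
    moreover have "\<exists>i\<in>I. c' i \<noteq> 0" using c(1) by (auto simp: c'_def)
    ultimately show ?thesis by blast
  qed
qed

lemma ratcomp_monom: "ratcomp (monom c i) r = const_ratfun c * r ^ i"
  by (induction i) (auto simp: monom_0 monom_Suc ac_simps)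

lemma bieval_ratpair_monom: "bieval_ratpair (monom c j) P = ratcomp c (fst P) * snd P ^ j"
  by (induction j) (auto simp: monom_0 monom_Suc ac_simps)

text \<open>
  After multiplication by \<open>(q1 q2)\<^sup>m\<close> the \<open>(m + 1)\<^sup>2\<close> monomials of degree at most \<open>m\<close> in each
  coordinate become polynomials of degree at most \<open>2 m d\<close>, where \<open>d\<close> bounds the degrees of the
  numerators and denominators. The number of monomials grows quadratically in \<open>m\<close>, the dimension
  linearly.
\<close>

lemma ratfuns_algebraically_dependent: "\<exists>F \<noteq> 0. bieval_ratpair F (P :: 'a::field ratpair) = 0"
proof -
  obtain p1 q1 where P1: "fst P = Fraction_Field.Fract p1 q1" "q1 \<noteq> 0" by (cases "fst P") auto
  obtain p2 q2 where P2: "snd P = Fraction_Field.Fract p2 q2" "q2 \<noteq> 0" by (cases "snd P") auto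
  define d where "d = Max {degree p1, degree q1, degree p2, degree q2}"
  have d: "degree p1 \<le> d" "degree q1 \<le> d" "degree p2 \<le> d" "degree q2 \<le> d"
    unfolding d_def by auto
  \<comment> \<open>This makes \<open>(m + 1)\<^sup>2\<close> exceed the dimension \<open>2 m d + 1\<close>, also for \<open>d = 0\<close>.\<close>
  define m where "m = 2 * d + 1"
  define I where "I = {..m} \<times> {..m}"
  define v where "v = (\<lambda>(i, j). p1 ^ i * q1 ^ (m - i) * (p2 ^ j * q2 ^ (m - j)))"
  have pw: "degree (p ^ i * q ^ (m - i)) \<le> m * d" if "degree p \<le> d" "degree q \<le> d" "i \<le> m"
    for p q :: "'a poly" and i
  proof -
    have "degree (p ^ i * q ^ (m - i)) \<le> degree (p ^ i) + degree (q ^ (m - i))"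
      by (rule degree_mult_le)
    also have "\<dots> \<le> degree p * i + degree q * (m - i)"
      by (intro add_mono degree_power_le)
    also have "\<dots> \<le> d * i + d * (m - i)" by (intro add_mono mult_right_mono that) auto
    also have "\<dots> = d * m" using that(3) by (simp flip: distrib_left)
    finally show ?thesis by (simp add: ac_simps)
  qed
  have deg: "degree (v ij) \<le> 2 * m * d" if "ij \<in> I" for ij
  proof -
    obtain i j where ij: "ij = (i, j)" "i \<le> m" "j \<le> m" using \<open>ij \<in> I\<close> by (auto simp: I_def)
    have "degree (v ij) \<le> degree (p1 ^ i * q1 ^ (m - i)) + degree (p2 ^ j * q2 ^ (m - j))"
      unfolding v_def ij by simp (rule degree_mult_le)
    also have "\<dots> \<le> m * d + m * d" by (intro add_mono pw d ij)
    finally show ?thesis by simp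
  qed
  have "coeff (v ij) k = 0" if "ij \<in> I" "k \<ge> 2 * m * d + 1" for ij k
    using deg[OF that(1)] that(2) by (intro coeff_eq_0) simp
  moreover have "card I > 2 * m * d + 1" by (simp add: I_def m_def algebra_simps)
  ultimately obtain c where c: "\<exists>ij\<in>I. c ij \<noteq> 0" "(\<Sum>ij\<in>I. smult (c ij) (v ij)) = 0"
    using polys_linearly_dependent[of I "2 * m * d + 1" v] by (auto simp: I_def)
  define F where "F = (\<Sum>(i, j)\<in>I. monom (monom (c (i, j)) i) j)"
  have "coeff (coeff F j) i = c (i, j)" if "(i, j) \<in> I" for i j
  proof -
    have "coeff (coeff F j) i = (\<Sum>ij\<in>I. if ij = (i, j) then c ij else 0)"
      unfolding F_def coeff_sum by (intro sum.cong) (auto simp: case_prod_unfold)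
    also have "\<dots> = c (i, j)" using that by (simp add: I_def)
    finally show ?thesis .
  qed
  with c(1) have "F \<noteq> 0" by fastforce
  define \<kappa> where "\<kappa> = to_fract (q1 * q2) ^ m"
  have \<kappa>: "\<kappa> \<noteq> 0" using P1 P2 by (simp add: \<kappa>_def)
  have step: "const_ratfun e * fst P ^ i * snd P ^ j * \<kappa> = to_fract (smult e (v (i, j)))"
    if "i \<le> m" "j \<le> m" for e i j
  proof -
    have *: "(to_fract p / to_fract q) ^ i * to_fract q ^ m = to_fract (p ^ i * q ^ (m - i))"
      if "q \<noteq> 0" "i \<le> m" for p q :: "'a poly" and i
    proof -
      have pow: "to_fract x ^ n = to_fract (x ^ n)" for x :: "'a poly" and n by (induction n) auto
      have "to_fract q ^ m = to_fract q ^ i * to_fract q ^ (m - i)" using that(2) by (simp flip: power_add)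
      then show ?thesis using that(1) by (simp add: power_divide pow[symmetric])
    qed
    have "const_ratfun e * fst P ^ i * snd P ^ j * \<kappa> =
        const_ratfun e * (fst P ^ i * to_fract q1 ^ m) * (snd P ^ j * to_fract q2 ^ m)"
      by (simp add: \<kappa>_def power_mult_distrib ac_simps)
    also have "\<dots> = const_ratfun e * to_fract (p1 ^ i * q1 ^ (m - i)) * to_fract (p2 ^ j * q2 ^ (m - j))"
      using *[OF P1(2) that(1), of p1] *[OF P2(2) that(2), of p2] by (simp add: P1 P2 Fract_conv_to_fract)
    also have "\<dots> = to_fract (smult e (v (i, j)))"
      by (simp add: v_def flip: to_fract_mult)
    finally show ?thesis .
  qed
  have "bieval_ratpair F P * \<kappa> = (\<Sum>(i, j)\<in>I. const_ratfun (c (i, j)) * fst P ^ i * snd P ^ j * \<kappa>)"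
    unfolding F_def bieval_ratpair.hom_sum sum_distrib_right
    by (intro sum.cong) (auto simp: bieval_ratpair_monom ratcomp_monom)
  also have "\<dots> = (\<Sum>ij\<in>I. to_fract (smult (c ij) (v ij)))"
    by (intro sum.cong refl) (auto simp: step I_def)
  also have "\<dots> = 0" using c(2) by (simp flip: to_fract_sum)
  finally have "bieval_ratpair F P = 0" using \<kappa> by simp
  with \<open>F \<noteq> 0\<close> show ?thesis by blast
qed

lemma irreducible_factor_vanishing:
  assumes "F \<noteq> 0" "bieval_ratpair F (P :: 'a::field ratpair) = 0"
  obtains f where "irreducible f" "f dvd F" "bieval_ratpair f P = 0"
proof -
  have "\<not> F dvd 1"
  proof
    assume "F dvd 1"
    then obtain G where "1 = F * G" ..
    have "bieval_ratpair (F * G) P = 0" using assms(2) by (simp add: bieval_ratpair.hom_mult)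
    with \<open>1 = F * G\<close> show False by (metis bieval_ratpair.hom_one one_neq_zero)
  qed
  with assms(1) obtain A where A: "mset_factors A F" using mset_factors_exist by blast
  have "\<exists>f\<in>#B. bieval_ratpair f P = 0" if "bieval_ratpair (prod_mset B) P = 0" for B
    using that by (induction B) (auto simp: bieval_ratpair.hom_mult)
  moreover have "prod_mset A = F" using A by auto
  ultimately obtain f where "f \<in># A" "bieval_ratpair f P = 0" using assms(2) by blast
  moreover have "irreducible f" using A \<open>f \<in># A\<close> by auto
  moreover have "f dvd F" using A \<open>f \<in># A\<close> by (rule mset_factors_imp_dvd)
  ultimately show thesis using that by blast
qed

text \<open>
  A polynomial prime to \<open>f\<close> has only finitely many zeros on the curve, but a nonconstant pair passes
  through infinitely many points.
\<close>

lemma vanishing_ideal_ratpair: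
  fixes P :: "'a::field_char_0 ratpair"
  assumes "nonconstant P" "irreducible f" "bieval_ratpair f P = 0"
  shows "bieval_ratpair F P = 0 \<longleftrightarrow> f dvd F"
proof
  assume "f dvd F"
  with assms(3) show "bieval_ratpair F P = 0" by (auto simp: bieval_ratpair.hom_mult)
next
  assume F: "bieval_ratpair F P = 0"
  show "f dvd F"
  proof (rule ccontr)
    assume "\<not> f dvd F"
    then have "finite (zero_locus f \<inter> zero_locus F)" by (rule finite_zero_locus_Int[OF assms(2)])
    from cofinite_ex[OF cofinite_ratpair_avoids[OF assms(1) this]] obtain t Q where Q: "ratpair_value P t Q" "Q \<notin> zero_locus f \<inter> zero_locus F" by blast
    with bieval_eq_0_of_ratpair[OF F Q(1)] bieval_eq_0_of_ratpair[OF assms(3) Q(1)] show False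
      by (auto simp: zero_locus_def)
  qed
qed

lemma param_closure_zero_locus:
  fixes P :: "'a::field_char_0 ratpair"
  assumes "nonconstant P" "irreducible f" "bieval_ratpair f P = 0"
  shows "param_closure P = zero_locus f"
proof
  show "param_closure P \<subseteq> zero_locus f" using assms by (simp add: param_closure_subset_zero_locus)
  show "zero_locus f \<subseteq> param_closure P"
    unfolding param_closure_eq vanishing_ideal_ratpair[OF assms]
    by (auto simp: zero_locus_def bieval.hom_mult elim!: dvdE)
qed

lemma irreducible_curve_param_closure:
  fixes P :: "'a::field_char_0 ratpair"
  assumes "nonconstant P"
  shows "irreducible_curve (param_closure P)"
proof -
  obtain F where "F \<noteq> 0" "bieval_ratpair F P = 0" using ratfuns_algebraically_dependent by blast
  then obtain f where "irreducible f" "bieval_ratpair f P = 0" using irreducible_factor_vanishing by blast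
  with param_closure_zero_locus[OF assms] show ?thesis unfolding irreducible_curve_def by blast
qed

lemma rational_curve_param_closure:
  fixes P :: "'a::field_char_0 ratpair"
  assumes "nonconstant P"
  shows "rational_curve (param_closure P)"
  unfolding rational_curve_def parametrization_iff
  using irreducible_curve_param_closure[OF assms] assms by blast

lemma parametrizationI:
  fixes P :: "'a::{alg_closed_field, field_char_0} ratpair"
  assumes "irreducible_curve C" "nonconstant P" "\<forall>\<^sub>\<infinity>t. \<exists>Q. ratpair_value P t Q \<and> Q \<in> C"
  shows "parametrization P C"
proof -
  from assms(1) obtain f where f: "irreducible f" "C = zero_locus f" unfolding irreducible_curve_def by blast
  have "bieval_ratpair f P = 0"
    by (rule bieval_ratpair_eq_0I) (use assms(3) f(2) in \<open>simp add: zero_locus_def\<close>)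
  with param_closure_zero_locus[OF assms(2) f(1)] f(2) assms(2) show ?thesis
    by (simp add: parametrization_iff)
qed

section \<open>Irreducible components\<close>

lemma zariski_irreducible_closure:
  assumes "zariski_irreducible S"
  shows "zariski_irreducible (zariski_closure S)"
  unfolding zariski_irreducible_def
proof (intro conjI allI impI)
  show "zariski_closure S \<noteq> {}"
    using assms subset_zariski_closure[of S] unfolding zariski_irreducible_def by blast
  fix T U assume *: "zariski_closed T \<and> zariski_closed U \<and> zariski_closure S \<subseteq> T \<union> U"
  then have "S \<subseteq> T \<or> S \<subseteq> U"
    using assms subset_zariski_closure[of S] unfolding zariski_irreducible_def
    by (metis order_trans)
  with * show "zariski_closure S \<subseteq> T \<or> zariski_closure S \<subseteq> U"
    using zariski_closure_minimal by metis
qed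

text \<open>
  Zorn's lemma applies because the closure of the union of a chain of irreducible sets is
  irreducible: two sets of the chain witnessing that the union is in neither of two closed sets are
  both contained in the larger one.
\<close>

lemma in_irreducible_component:
  assumes "zariski_closed S" "Q \<in> S"
  obtains M where "M \<in> irreducible_components S" "Q \<in> M"
proof -
  define \<N> where "\<N> = {N. zariski_closed N \<and> zariski_irreducible N \<and> N \<subseteq> S \<and> Q \<in> N}"
  have "\<exists>M\<in>\<N>. \<forall>N\<in>\<N>. M \<subseteq> N \<longrightarrow> N = M"
  proof (rule subset_Zorn)
    fix \<C> assume "subset.chain \<N> \<C>"
    then have ch: "\<C> \<subseteq> \<N>" "\<And>M N. M \<in> \<C> \<Longrightarrow> N \<in> \<C> \<Longrightarrow> M \<subseteq> N \<or> N \<subseteq> M"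
      unfolding subset.chain_def by auto
    show "\<exists>U\<in>\<N>. \<forall>X\<in>\<C>. X \<subseteq> U"
    proof (cases "\<C> = {}")
      case True
      have "zariski_irreducible {Q}" unfolding zariski_irreducible_def by auto
      then have "zariski_irreducible (zariski_closure {Q})" by (rule zariski_irreducible_closure)
      moreover have "Q \<in> zariski_closure {Q}" using subset_zariski_closure[of "{Q}"] by simp
      moreover have "zariski_closure {Q} \<subseteq> S" using assms by (intro zariski_closure_minimal) auto
      ultimately have "zariski_closure {Q} \<in> \<N>" unfolding \<N>_def by simp
      with True show ?thesis by blast
    next
      case False
      have "zariski_irreducible (\<Union>\<C>)"
        unfolding zariski_irreducible_def
      proof (intro conjI allI impI)
        show "\<Union>\<C> \<noteq> {}" using False ch(1) unfolding \<N>_def by blast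
        fix T U assume *: "zariski_closed T \<and> zariski_closed U \<and> \<Union>\<C> \<subseteq> T \<union> U"
        show "\<Union>\<C> \<subseteq> T \<or> \<Union>\<C> \<subseteq> U"
        proof (rule ccontr)
          assume "\<not> ?thesis"
          then obtain M N where MN: "M \<in> \<C>" "\<not> M \<subseteq> T" "N \<in> \<C>" "\<not> N \<subseteq> U" by blast
          then obtain L where L: "L \<in> \<C>" "\<not> L \<subseteq> T" "\<not> L \<subseteq> U" using ch(2)[OF MN(1,3)] by blast
          moreover have "zariski_irreducible L" "L \<subseteq> T \<union> U" using L(1) ch(1) * unfolding \<N>_def by auto
          ultimately show False using * unfolding zariski_irreducible_def by blast
        qed
      qed
      then have "zariski_irreducible (zariski_closure (\<Union>\<C>))" by (rule zariski_irreducible_closure)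
      moreover have "zariski_closure (\<Union>\<C>) \<subseteq> S"
        using ch(1) assms(1) by (intro zariski_closure_minimal) (auto simp: \<N>_def)
      moreover have "Q \<in> zariski_closure (\<Union>\<C>)"
        using subset_zariski_closure[of "\<Union>\<C>"] False ch(1) unfolding \<N>_def by blast
      ultimately have "zariski_closure (\<Union>\<C>) \<in> \<N>" unfolding \<N>_def by simp
      moreover have "\<forall>X\<in>\<C>. X \<subseteq> zariski_closure (\<Union>\<C>)"
        using subset_zariski_closure[of "\<Union>\<C>"] by blast
      ultimately show ?thesis by blast
    qed
  qed
  then obtain M where M: "M \<in> \<N>" "\<And>N. N \<in> \<N> \<Longrightarrow> M \<subseteq> N \<Longrightarrow> N = M" by blast
  have "N = M" if "zariski_closed N" "zariski_irreducible N" "M \<subseteq> N" "N \<subseteq> S" for N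
    using M(1) that by (intro M(2)) (auto simp: \<N>_def)
  then have "M \<in> irreducible_components S"
    using M(1) unfolding irreducible_components_def \<N>_def by simp
  moreover have "Q \<in> M" using M(1) unfolding \<N>_def by blast
  ultimately show thesis by (rule that)
qed

lemma zariski_dense_nonvanishing:
  assumes "zariski_closed M" "zariski_irreducible M" "\<not> M \<subseteq> zero_locus F"
  shows "zariski_closure {Q \<in> M. bieval F Q \<noteq> 0} = M"
proof
  show "zariski_closure {Q \<in> M. bieval F Q \<noteq> 0} \<subseteq> M"
    using assms(1) by (intro zariski_closure_minimal) auto
  have "M \<subseteq> zero_locus F \<union> zariski_closure {Q \<in> M. bieval F Q \<noteq> 0}"
    using subset_zariski_closure[of "{Q \<in> M. bieval F Q \<noteq> 0}"] by (auto simp: zero_locus_def)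
  moreover have "zariski_closed (zero_locus F)" by (rule zariski_closed_zero_locus)
  moreover have "zariski_closed (zariski_closure {Q \<in> M. bieval F Q \<noteq> 0})" by simp
  ultimately show "M \<subseteq> zariski_closure {Q \<in> M. bieval F Q \<noteq> 0}"
    using assms(2,3) unfolding zariski_irreducible_def by blast
qed


section \<open>Lueroth's theorem\<close>

definition ratfun_subfield :: "'a::field poly fract set \<Rightarrow> bool" where
  "ratfun_subfield L \<longleftrightarrow> range const_ratfun \<subseteq> L \<and>
     (\<forall>x\<in>L. \<forall>y\<in>L. x + y \<in> L \<and> x - y \<in> L \<and> x * y \<in> L \<and> x / y \<in> L)"

definition quotients :: "('b \<Rightarrow> 'c::field) \<Rightarrow> 'c set" where
  "quotients h = {h a / h b | a b. h b \<noteq> 0}"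

lemma ratfun_subfieldD:
  assumes "ratfun_subfield L"
  shows "const_ratfun c \<in> L" "0 \<in> L" "1 \<in> L"
    "x \<in> L \<Longrightarrow> y \<in> L \<Longrightarrow> x + y \<in> L" "x \<in> L \<Longrightarrow> y \<in> L \<Longrightarrow> x - y \<in> L"
    "x \<in> L \<Longrightarrow> y \<in> L \<Longrightarrow> x * y \<in> L" "x \<in> L \<Longrightarrow> y \<in> L \<Longrightarrow> x / y \<in> L"
proof -
  show c: "const_ratfun c \<in> L" for c using assms by (auto simp: ratfun_subfield_def)
  from c[of 0] c[of 1] show "0 \<in> L" "1 \<in> L" by (simp_all add: const_ratfun_simps)
qed (use assms in \<open>auto simp: ratfun_subfield_def\<close>)

lemma ratfun_subfield_quotients:
  assumes "comm_ring_hom h" "\<And>c. const_ratfun c \<in> range h"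
  shows "ratfun_subfield (quotients h)"
proof -
  interpret h: comm_ring_hom h by fact
  have const: "const_ratfun c \<in> quotients h" for c
  proof -
    obtain a where "const_ratfun c = h a" using assms(2)[of c] by blast
    then show ?thesis
      unfolding quotients_def by (intro CollectI exI[of _ a] exI[of _ 1]) simp
  qed
  have *: "x + y \<in> quotients h \<and> x - y \<in> quotients h \<and> x * y \<in> quotients h \<and> x / y \<in> quotients h"
    if xy: "x \<in> quotients h" "y \<in> quotients h" for x y
  proof -
    from xy obtain a b c e where x: "x = h a / h b" "h b \<noteq> 0" and y: "y = h c / h e" "h e \<noteq> 0"
      unfolding quotients_def by blast
    have I: "h a / h b \<in> quotients h" if "h b \<noteq> 0" for a b using that unfolding quotients_def by blast
    have "x + y = h (a * e + c * b) / h (b * e)" "x - y = h (a * e - c * b) / h (b * e)"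
      "x * y = h (a * c) / h (b * e)" "h (b * e) \<noteq> 0"
      using x(2) y(2) unfolding x(1) y(1) h.hom_add h.hom_minus h.hom_mult
      by (simp_all add: add_frac_eq diff_frac_eq)
    moreover have "x / y \<in> quotients h"
    proof (cases "y = 0")
      case True
      then show ?thesis using const[of 0] by (simp add: const_ratfun_simps)
    next
      case False
      then have "x / y = h (a * e) / h (b * c)" "h (b * c) \<noteq> 0"
        using x(2) y(2) unfolding x(1) y(1) h.hom_mult by simp_all
      then show ?thesis using I by metis
    qed
    ultimately show ?thesis using I by metis
  qed
  show ?thesis unfolding ratfun_subfield_def using const * by blast
qed

lemma ratfun_subfield_ratcomp: "ratfun_subfield (quotients (\<lambda>p. ratcomp p s))"
proof (rule ratfun_subfield_quotients)
  show "const_ratfun c \<in> range (\<lambda>p. ratcomp p s)" for c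
    by (rule range_eqI[of _ _ "[:c:]"]) simp
qed unfold_locales

lemma ratfun_subfield_bieval_ratpair: "ratfun_subfield (quotients (\<lambda>F. bieval_ratpair F P))"
proof (rule ratfun_subfield_quotients)
  show "const_ratfun c \<in> range (\<lambda>F. bieval_ratpair F P)" for c
    by (rule range_eqI[of _ _ "[:[:c:]:]"]) simp
qed unfold_locales

interpretation slice: comm_ring_hom "slice x"
proof -
  interpret m: map_poly_comm_ring_hom "\<lambda>p :: 'a poly. poly p x" by unfold_locales
  show "comm_ring_hom (slice x)"
    unfolding slice_def by unfold_locales (auto simp: m.hom_add m.hom_mult)
qed

definition lift_const :: "'a::field poly \<Rightarrow> 'a bipoly" where
  "lift_const p = map_poly (\<lambda>c. [:c:]) p"

lemma coeff_lift_const [simp]: "coeff (lift_const p) i = [:coeff p i:]"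
  by (simp add: lift_const_def coeff_map_poly)

interpretation lift_const: comm_ring_hom "lift_const"
proof -
  interpret m: map_poly_comm_ring_hom "\<lambda>c. [:c :: 'a:]" by unfold_locales (auto simp: one_pCons)
  show "comm_ring_hom (lift_const :: 'a poly \<Rightarrow> _)"
    unfolding lift_const_def by unfold_locales (auto simp: m.hom_add m.hom_mult)
qed

lemma lift_const_pCons: "lift_const (pCons a p) = pCons [:a:] (lift_const p)"
  by (rule poly_eqI) (simp add: coeff_pCons split: nat.split)

lemma poly_lift_const: "poly (lift_const p) [:0, 1:] = p"
  by (induction p) (auto simp: lift_const_pCons)

lemma poly_lift_const_const: "poly (lift_const p) [:y:] = [:poly p y:]"
  by (induction p) (auto simp: lift_const_pCons)

lemma degree_lift_const [simp]: "degree (lift_const p) = degree p"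
  unfolding lift_const_def by (rule degree_map_poly) auto

lemma lift_const_eq_0_iff [simp]: "lift_const p = 0 \<longleftrightarrow> p = 0"
  by (simp add: poly_eq_iff[of "lift_const p"] poly_eq_iff[of p])

lemma to_fract_power: "to_fract (x ^ n) = to_fract x ^ n"
  by (induction n) auto

text \<open>
  Polynomials in a new variable \<open>T\<close> over a field \<open>L\<close> between \<open>K\<close> and \<open>K(t)\<close> are represented, up to a
  factor from \<open>K(t)\<close>, by elements of \<open>K[t][T]\<close>, where one can speak of primitive polynomials and of
  degrees in \<open>t\<close>. In the type of bivariate polynomials \<open>t\<close> is the inner and \<open>T\<close> the outer variable,
  so that evaluating the outer variable at \<open>[:0, 1:]\<close> is the substitution \<open>T = t\<close>.
\<close>

definition proportional_over :: "'a::field poly fract set \<Rightarrow> 'a bipoly \<Rightarrow> bool" where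
  "proportional_over L H \<longleftrightarrow> (\<exists>\<gamma>. \<gamma> \<noteq> 0 \<and> (\<forall>i. \<gamma> * to_fract (coeff H i) \<in> L))"

text \<open>
  Division with remainder in \<open>L[T]\<close> by a relation for \<open>t\<close> of least degree: the remainder is again a
  relation, hence zero.
\<close>

lemma minimal_relation_pseudo_divides:
  fixes L :: "'a::field poly fract set"
  assumes L: "ratfun_subfield L"
    and M: "M \<noteq> 0" "proportional_over L M" "poly M [:0, 1:] = 0"
    and min: "\<And>G. G \<noteq> 0 \<Longrightarrow> proportional_over L G \<Longrightarrow> poly G [:0, 1:] = 0 \<Longrightarrow> degree M \<le> degree G"
    and H: "proportional_over L H" "poly H [:0, 1:] = 0"
  shows "\<exists>c Q. c \<noteq> 0 \<and> smult c H = Q * M"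
  using H
proof (induction "degree H" arbitrary: H rule: less_induct)
  case less
  show ?case
  proof (cases "H = 0")
    case True
    then show ?thesis by (intro exI[of _ 1] exI[of _ 0]) simp
  next
    case False
    with min less.prems have deg: "degree M \<le> degree H" by blast
    have "degree M \<noteq> 0"
    proof
      assume "degree M = 0"
      then obtain m where "M = [:m:]" by (auto elim: degree_eq_zeroE)
      with M show False by simp
    qed
    define j where "j = degree H - degree M"
    define H' where "H' = smult (lead_coeff M) H - smult (lead_coeff H) (monom 1 j * M)"
    have "degree (monom 1 j * M) = degree H" using deg M(1) by (simp add: j_def degree_mult_eq degree_monom_eq)
    then have "degree H' \<le> degree H"
      unfolding H'_def by (intro degree_diff_le order.trans[OF degree_smult_le]) auto
    moreover have "coeff H' (degree H) = 0"
      using deg by (simp add: H'_def coeff_monom_mult j_def)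
    ultimately have H'_deg: "H' = 0 \<or> degree H' < degree H" by (rule eq_zero_or_degree_less)
    have coeff_H': "coeff H' i = lead_coeff M * coeff H i - lead_coeff H * (if i < j then 0 else coeff M (i - j))" for i
      unfolding H'_def coeff_diff coeff_smult coeff_monom_mult by simp
    have "proportional_over L H'"
    proof -
      from M(2) obtain \<mu> where \<mu>: "\<mu> \<noteq> 0" "\<And>i. \<mu> * to_fract (coeff M i) \<in> L"
        unfolding proportional_over_def by blast
      from less.prems(1) obtain \<eta> where \<eta>: "\<eta> \<noteq> 0" "\<And>i. \<eta> * to_fract (coeff H i) \<in> L"
        unfolding proportional_over_def by blast
      have "(\<mu> * \<eta>) * to_fract (coeff H' i) \<in> L" for i
      proof -
        have "(\<mu> * \<eta>) * to_fract (coeff H' i) =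
            (\<mu> * to_fract (lead_coeff M)) * (\<eta> * to_fract (coeff H i)) -
            (\<eta> * to_fract (lead_coeff H)) * (if i < j then 0 else \<mu> * to_fract (coeff M (i - j)))"
          unfolding coeff_H' by (cases "i < j") (simp_all add: algebra_simps)
        also have "\<dots> \<in> L"
          by (cases "i < j")
            (simp_all only: if_True if_False mult_zero_right simp_thms,
              intro ratfun_subfieldD(5,6)[OF L] \<mu>(2) \<eta>(2) ratfun_subfieldD(2)[OF L],
              intro ratfun_subfieldD(5,6)[OF L] \<mu>(2) \<eta>(2))
        finally show ?thesis .
      qed
      moreover have "\<mu> * \<eta> \<noteq> 0" using \<mu> \<eta> by simp
      ultimately show ?thesis unfolding proportional_over_def by blast
    qed
    moreover have "poly H' [:0, 1:] = 0" using M(3) less.prems(2) by (simp add: H'_def)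
    moreover have "\<exists>c Q. c \<noteq> 0 \<and> smult c H' = Q * M" if "H' = 0"
      using that by (intro exI[of _ 1] exI[of _ 0]) simp
    ultimately obtain c Q where c: "c \<noteq> 0" "smult c H' = Q * M"
      using less.hyps[of H'] H'_deg by blast
    have "smult (c * lead_coeff M) H = (Q + smult (c * lead_coeff H) (monom 1 j)) * M"
    proof -
      have "smult (c * lead_coeff M) H = smult c H' + smult (c * lead_coeff H) (monom 1 j * M)"
        by (simp add: H'_def smult_diff_right)
      then show ?thesis using c(2) by (simp add: algebra_simps)
    qed
    moreover have "c * lead_coeff M \<noteq> 0" using c(1) M(1) by simp
    ultimately show ?thesis by blast
  qed
qed

text \<open>
  Gauss's lemma. Since \<open>K\<close> is algebraically closed, \<open>c\<close> is a product of linear factors, and they can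
  be cancelled one by one: \<open>M\<close> is primitive if it does not vanish identically for any value of
  \<open>t\<close>.
\<close>

lemma primitive_divides:
  fixes M :: "'a::alg_closed_field bipoly"
  assumes M: "\<And>x. slice x M \<noteq> 0"
  shows "c \<noteq> 0 \<Longrightarrow> smult c H = Q * M \<Longrightarrow> M dvd H"
proof (induction "degree c" arbitrary: c Q)
  case 0
  then obtain e where e: "c = [:e:]" by (auto elim: degree_eq_zeroE)
  with 0 have "e \<noteq> 0" by auto
  then have "H = smult [:1/e:] (smult c H)" using e by (simp flip: one_pCons)
  also have "\<dots> = smult [:1/e:] Q * M" unfolding 0(3) by simp
  finally show ?case by (simp only: dvd_triv_right)
next
  case (Suc n)
  then have "degree c > 0" by simp
  then obtain x where "poly c x = 0" using alg_closed_imp_poly_has_root by blast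
  from this obtain c' where c': "c = [:-x, 1:] * c'" unfolding poly_eq_0_iff_dvd by (elim dvdE)
  have "slice x (smult c H) = 0"
    using \<open>poly c x = 0\<close> unfolding slice_eq_0_iff const_poly_dvd_iff coeff_smult poly_eq_0_iff_dvd
    by (blast intro: dvd_mult2)
  then have "slice x Q * slice x M = 0" using Suc.prems(2) by (simp add: slice.hom_mult)
  with M have "slice x Q = 0" by simp
  then obtain Q' where Q': "Q = [:[:-x, 1:]:] * Q'" by (auto simp: slice_eq_0_iff)
  have "smult [:-x, 1:] (smult c' H) = smult [:-x, 1:] (Q' * M)"
    using Suc.prems(2) unfolding c' Q' by simp
  then have "smult c' H = Q' * M" by (metis one_neq_zero pCons_eq_0_iff smult_cancel)
  moreover have "c' \<noteq> 0" using Suc.prems(1) c' by auto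
  moreover have "degree c = Suc (degree c')" unfolding c' using \<open>c' \<noteq> 0\<close> by (subst degree_mult_eq) auto
  ultimately show ?case using Suc.hyps(1)[of c' Q'] Suc.hyps(2) by simp
qed

lemma coeff_poly_const: "coeff (poly G [:y:]) e = poly (map_poly (\<lambda>c. coeff c e) G) y"
proof (induction G)
  case (pCons a G)
  have "map_poly (\<lambda>c. coeff c e) (pCons a G) = pCons (coeff a e) (map_poly (\<lambda>c. coeff c e) G)"
    by (rule poly_eqI) (simp add: coeff_map_poly coeff_pCons split: nat.split)
  with pCons show ?case by simp
qed simp

text \<open>
  Degrees with respect to the inner variable are read off after specializing the outer one. This
  replaces exchanging the two variables.
\<close>

lemma cofinite_degree_poly_const:
  fixes G :: "'a::field bipoly"
  assumes "coeff G j \<noteq> 0"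
  shows "\<forall>\<^sub>\<infinity>y. poly G [:y:] \<noteq> 0 \<and> degree (coeff G j) \<le> degree (poly G [:y:])"
proof -
  let ?e = "degree (coeff G j)"
  have "coeff (map_poly (\<lambda>c. coeff c ?e) G) j \<noteq> 0" using assms by (simp add: coeff_map_poly)
  then have "map_poly (\<lambda>c. coeff c ?e) G \<noteq> 0" by auto
  from cofinite_poly_nonzero[OF this] show ?thesis
  proof eventually_elim
    case (elim y)
    then have "coeff (poly G [:y:]) ?e \<noteq> 0" by (simp add: coeff_poly_const)
    then show ?case using le_degree by fastforce
  qed
qed

lemma ratfun_lowest_terms:
  fixes s :: "'a::field poly fract"
  shows "\<exists>u v. v \<noteq> 0 \<and> s = to_fract u / to_fract v \<and>
    (\<forall>p q. q \<noteq> 0 \<longrightarrow> s = to_fract p / to_fract q \<longrightarrow> (\<exists>g. p = g * u \<and> q = g * v))"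
proof -
  define R where "R v \<longleftrightarrow> v \<noteq> 0 \<and> (\<exists>u. s = to_fract u / to_fract v)" for v
  obtain p0 q0 where "s = Fraction_Field.Fract p0 q0" "q0 \<noteq> 0" by (cases s) auto
  then have "R q0" unfolding R_def by (auto simp: Fract_conv_to_fract)
  then obtain v where v: "R v" "\<And>w. R w \<Longrightarrow> degree v \<le> degree w"
    using ex_has_least_nat[of R q0 degree] by blast
  from v(1) obtain u where u: "v \<noteq> 0" "s = to_fract u / to_fract v" unfolding R_def by blast
  have "\<exists>g. p = g * u \<and> q = g * v" if q: "q \<noteq> 0" "s = to_fract p / to_fract q" for p q
  proof -
    define g where "g = q div v"
    have "to_fract (p * v) = to_fract (u * q)"
      using q u by (simp add: field_simps)
    then have pv: "p * v = u * q" by (simp only: to_fract_eq_iff)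
    have qr: "q = g * v + q mod v" by (simp add: g_def)
    have eq: "(p - g * u) * v = u * (q mod v)"
    proof -
      have "(p - g * u) * v = u * q - g * u * v" by (simp add: algebra_simps pv)
      also have "\<dots> = u * (q mod v)" by (subst qr) (simp add: algebra_simps)
      finally show ?thesis .
    qed
    have "q mod v = 0"
    proof (rule ccontr)
      assume r: "q mod v \<noteq> 0"
      have "to_fract (p - g * u) * to_fract v = to_fract u * to_fract (q mod v)"
        by (simp only: eq flip: to_fract_mult)
      also have "to_fract u = s * to_fract v" using u by simp
      finally have "to_fract (p - g * u) = s * to_fract (q mod v)"
        using u(1) by (simp add: ac_simps del: to_fract_diff)
      with r have "s = to_fract (p - g * u) / to_fract (q mod v)" by (simp del: to_fract_diff)
      with r have "R (q mod v)" unfolding R_def by blast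
      with v(2) have "degree v \<le> degree (q mod v)" by blast
      with degree_mod_less[OF u(1), of q] r show False by simp
    qed
    with eq u(1) qr have "p = g * u" "q = g * v" by auto
    then show ?thesis by blast
  qed
  with u show ?thesis by blast
qed

lemma common_denominator:
  fixes f :: "nat \<Rightarrow> 'a::idom fract"
  shows "\<exists>e g. e \<noteq> 0 \<and> (\<forall>i<k. f i * to_fract e = to_fract (g i))"
proof (induction k)
  case 0
  show ?case by (intro exI[of _ 1]) simp
next
  case (Suc k)
  then obtain e g where eg: "e \<noteq> 0" "\<And>i. i < k \<Longrightarrow> f i * to_fract e = to_fract (g i)" by blast
  obtain p q where pq: "f k = Fraction_Field.Fract p q" "q \<noteq> 0" by (cases "f k") auto
  define g' where "g' i = (if i < k then g i * q else p * e)" for i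
  have "f i * to_fract (e * q) = to_fract (g' i)" if "i < Suc k" for i
  proof (cases "i < k")
    case True
    with eg(2)[OF True] show ?thesis by (simp add: g'_def mult.assoc[symmetric])
  next
    case False
    with that have "i = k" by simp
    with pq show ?thesis by (simp add: g'_def Fract_conv_to_fract)
  qed
  moreover have "e * q \<noteq> 0" using eg pq by simp
  ultimately show ?case by blast
qed

text \<open>
  Let \<open>M\<close> be a primitive multiple of the minimal polynomial of \<open>t\<close> over \<open>L\<close>. As \<open>t\<close> is
  transcendental over \<open>K\<close>, some quotient \<open>s = u/v\<close> of two coefficients of \<open>M\<close> is not constant; then
  both \<open>u\<close> and \<open>v\<close> divide coefficients of \<open>M\<close>, so the degree of \<open>M\<close> in \<open>t\<close> is at least
  \<open>k = max (deg u) (deg v)\<close>. The polynomial \<open>H = u(T) v(t) - v(T) u(t)\<close> also is a relation for \<open>t\<close>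
  over \<open>L\<close>, hence a multiple of \<open>M\<close>, and has degree \<open>k\<close> in both variables. Comparing degrees in \<open>t\<close>,
  the cofactor depends on \<open>T\<close> only, so it divides both \<open>u(T)\<close> and \<open>v(T)\<close> and is constant. Hence
  \<open>t\<close> has degree \<open>k\<close> over \<open>L\<close>. It satisfies an equation of degree \<open>k\<close> over the smaller field
  \<open>K(s)\<close>, so every polynomial in \<open>t\<close> is a combination of \<open>1, t, ..., t^(k - 1)\<close> over \<open>K(s)\<close>; as
  these powers are independent over \<open>L\<close>, comparing coefficients in \<open>w q(t) = p(t)\<close> for an element
  \<open>w = p/q\<close> of \<open>L\<close> exhibits \<open>w\<close> as an element of \<open>K(s)\<close>.
\<close>

theorem lueroth:
  fixes L :: "'a::{alg_closed_field, field_char_0} poly fract set"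
  assumes L: "ratfun_subfield L" and w: "w \<in> L" "w \<notin> range const_ratfun"
  obtains s where "s \<in> L" "s \<notin> range const_ratfun" "L \<subseteq> quotients (\<lambda>p. ratcomp p s)"
proof -
  note LD = ratfun_subfieldD[OF L]
  let ?X = "[:0, 1 :: 'a:]"
  define S where "S H \<longleftrightarrow> H \<noteq> 0 \<and> proportional_over L H \<and> poly H ?X = 0" for H
  define rel where "rel u v = smult v (lift_const u) - smult u (lift_const v)" for u v :: "'a poly"
  have coeff_rel: "coeff (rel u v) i = smult (coeff u i) v - smult (coeff v i) u" for u v i
    by (simp add: rel_def)
  have S_rel: "S (rel u v)" and rel_indep: "\<And>c e. smult c v - smult e u = 0 \<Longrightarrow> c = 0 \<and> e = 0"
    if uv: "v \<noteq> 0" "to_fract u / to_fract v \<in> L" "to_fract u / to_fract v \<notin> range const_ratfun" for u v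
  proof -
    show indep: "c = 0 \<and> e = 0" if "smult c v - smult e u = 0" for c e
    proof (rule ccontr)
      assume ne: "\<not> ?thesis"
      have "e \<noteq> 0"
      proof
        assume "e = 0"
        with that uv(1) ne show False by simp
      qed
      from that have "to_fract ([:c:] * v) = to_fract ([:e:] * u)" by simp
      then have "const_ratfun c * to_fract v = const_ratfun e * to_fract u" by (simp only: to_fract_mult)
      with \<open>e \<noteq> 0\<close> uv(1) have "to_fract u / to_fract v = const_ratfun (c / e)"
        by (simp add: const_ratfun_divide field_simps)
      with uv(3) show False by blast
    qed
    obtain i where "coeff v i \<noteq> 0" using uv(1) by (auto simp: poly_eq_iff)
    then have "coeff (rel u v) i \<noteq> 0" unfolding coeff_rel using indep by blast
    then have "rel u v \<noteq> 0" by auto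
    moreover have "proportional_over L (rel u v)"
    proof -
      have "1 / to_fract v * to_fract (coeff (rel u v) i) \<in> L" for i
      proof -
        have "to_fract (coeff (rel u v) i) = to_fract ([:coeff u i:] * v - [:coeff v i:] * u)"
          by (simp add: coeff_rel)
        also have "\<dots> = const_ratfun (coeff u i) * to_fract v - const_ratfun (coeff v i) * to_fract u"
          by (simp only: to_fract_mult to_fract_diff)
        finally have "1 / to_fract v * to_fract (coeff (rel u v) i) =
            const_ratfun (coeff u i) - const_ratfun (coeff v i) * (to_fract u / to_fract v)"
          using uv(1) by (simp add: field_simps)
        also have "\<dots> \<in> L" by (intro LD(5) LD(6) LD(1) uv(2))
        finally show ?thesis .
      qed
      moreover have "1 / to_fract v \<noteq> 0" using uv(1) by simp
      ultimately show ?thesis unfolding proportional_over_def by blast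
    qed
    moreover have "poly (rel u v) ?X = 0" unfolding rel_def poly_diff poly_smult poly_lift_const by simp
    ultimately show "S (rel u v)" unfolding S_def by blast
  qed

  obtain p q where pq: "w = to_fract p / to_fract q" "q \<noteq> 0"
    by (cases w) (auto simp: Fract_conv_to_fract)
  with w S_rel[of q p] have "\<exists>H. S H" by auto
  then obtain M0 where M0: "S M0" "\<And>G. S G \<Longrightarrow> degree M0 \<le> degree G"
    using ex_has_least_nat[of S _ degree] by blast
  \<comment> \<open>Among the relations of least degree in \<open>T\<close>, one whose leading coefficient has least degree is primitive.\<close>
  define T where "T H \<longleftrightarrow> S H \<and> degree H = degree M0" for H
  have "T M0" unfolding T_def using M0(1) by simp
  then obtain M where M: "T M" "\<And>G. T G \<Longrightarrow> degree (lead_coeff M) \<le> degree (lead_coeff G)"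
    using ex_has_least_nat[of T M0 "\<lambda>H. degree (lead_coeff H)"] by blast
  then have SM: "S M" and minM: "\<And>G. S G \<Longrightarrow> degree M \<le> degree G"
    using M0 unfolding T_def by auto
  have "M \<noteq> 0" using SM unfolding S_def by blast
  have prim: "slice x M \<noteq> 0" for x
  proof
    assume "slice x M = 0"
    then obtain M' where M': "M = [:[:-x, 1:]:] * M'" unfolding slice_eq_0_iff by (elim dvdE)
    then have M'': "M = smult [:-x, 1:] M'" by simp
    then have "M' \<noteq> 0" using \<open>M \<noteq> 0\<close> by auto
    have deg: "degree M' = degree M" unfolding M'' by (simp only: degree_smult_eq) simp
    have "proportional_over L M'"
    proof -
      obtain \<mu> where \<mu>: "\<mu> \<noteq> 0" "\<And>i. \<mu> * to_fract (coeff M i) \<in> L"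
        using SM unfolding S_def proportional_over_def by blast
      have "\<mu> * to_fract [:-x, 1:] * to_fract (coeff M' i) \<in> L" for i
      proof -
        have "to_fract (coeff M i) = to_fract [:-x, 1:] * to_fract (coeff M' i)"
          unfolding M'' coeff_smult by (simp only: to_fract_mult)
        with \<mu>(2)[of i] show ?thesis by (simp only: mult.assoc)
      qed
      moreover have "\<mu> * to_fract [:-x, 1:] \<noteq> 0" using \<mu>(1) by simp
      ultimately show ?thesis unfolding proportional_over_def by blast
    qed
    moreover have "poly M' ?X = 0"
    proof -
      have "[:-x, 1:] * poly M' ?X = 0" using SM unfolding S_def M'' by (simp only: poly_smult)
      then show ?thesis by (metis mult_eq_0_iff one_neq_zero pCons_eq_0_iff)
    qed
    ultimately have "T M'" using \<open>M' \<noteq> 0\<close> deg M(1) unfolding T_def S_def by simp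
    with M(2) have "degree (lead_coeff M) \<le> degree (lead_coeff M')" by blast
    moreover have "lead_coeff M = [:-x, 1:] * lead_coeff M'"
      using deg unfolding M'' by (metis coeff_smult)
    then have "degree (lead_coeff M) = degree [:-x, 1:] + degree (lead_coeff M')"
      using \<open>M' \<noteq> 0\<close> by (simp only:) (rule degree_mult_eq, auto)
    ultimately show False by simp
  qed

  obtain \<mu> where \<mu>: "\<mu> \<noteq> 0" "\<And>i. \<mu> * to_fract (coeff M i) \<in> L"
    using SM unfolding S_def proportional_over_def by blast
  define a where "a = lead_coeff M"
  have "a \<noteq> 0" using \<open>M \<noteq> 0\<close> by (simp add: a_def)
  have "\<exists>i. to_fract (coeff M i) / to_fract a \<notin> range const_ratfun"
  proof (rule ccontr)
    assume "\<not> ?thesis"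
    then have "\<forall>i. \<exists>e. to_fract (coeff M i) / to_fract a = const_ratfun e" by blast
    then obtain e where e: "\<And>i. to_fract (coeff M i) / to_fract a = const_ratfun (e i)" by metis
    have ae: "coeff M i = a * [:e i:]" for i
    proof -
      have "to_fract (coeff M i) = to_fract (a * [:e i:])"
        unfolding to_fract_mult using e[of i] \<open>a \<noteq> 0\<close> by (simp add: field_simps)
      then show ?thesis by (simp only: to_fract_eq_iff)
    qed
    define g where "g = (\<Sum>i\<le>degree M. monom (e i) i)"
    have cg: "coeff g i = e i" if "i \<le> degree M" for i using that by (simp add: g_def coeff_sum)
    have "M = smult a (lift_const g)"
    proof (rule poly_eqI)
      fix i show "coeff M i = coeff (smult a (lift_const g)) i"
      proof (cases "i \<le> degree M")
        case True
        then show ?thesis using ae[of i] cg by simp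
      next
        case False
        then have "coeff M i = 0" "coeff g i = 0" by (auto simp: coeff_eq_0 g_def coeff_sum)
        then show ?thesis by simp
      qed
    qed
    moreover have "poly M ?X = 0" using SM unfolding S_def by blast
    ultimately have "a * g = 0" by (simp only: poly_smult poly_lift_const)
    with \<open>a \<noteq> 0\<close> have "g = 0" by simp
    with cg[of "degree M"] have "e (degree M) = 0" by simp
    with ae[of "degree M"] \<open>a \<noteq> 0\<close> show False by (simp add: a_def)
  qed
  then obtain l where l: "to_fract (coeff M l) / to_fract a \<notin> range const_ratfun" by blast
  define s where "s = to_fract (coeff M l) / to_fract a"
  have s_const: "s \<notin> range const_ratfun" using l by (simp add: s_def)
  have "s = (\<mu> * to_fract (coeff M l)) / (\<mu> * to_fract a)" using \<mu>(1) by (simp add: s_def)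
  also have "\<dots> \<in> L" unfolding a_def by (intro LD(7) \<mu>(2))
  finally have "s \<in> L" .
  obtain u v where v0: "v \<noteq> 0" and s_uv: "s = to_fract u / to_fract v"
    and lowest: "\<And>p q. q \<noteq> 0 \<Longrightarrow> s = to_fract p / to_fract q \<Longrightarrow> \<exists>g. p = g * u \<and> q = g * v"
    using ratfun_lowest_terms[of s] by blast
  have u0: "u \<noteq> 0"
  proof
    assume "u = 0"
    then have "s = const_ratfun 0" using s_uv by (simp add: const_ratfun_simps)
    with s_const show False by blast
  qed
  define k where "k = max (degree u) (degree v)"
  define H where "H = rel u v"
  have uv: "to_fract u / to_fract v \<in> L" "to_fract u / to_fract v \<notin> range const_ratfun"
    using s_uv \<open>s \<in> L\<close> s_const by auto
  have SH: "S H" unfolding H_def by (rule S_rel[OF v0 uv])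
  note indep = rel_indep[OF v0 uv]
  have "coeff u k \<noteq> 0 \<or> coeff v k \<noteq> 0" using u0 v0 by (auto simp: k_def max_def)
  then have Hk: "coeff H k \<noteq> 0" unfolding H_def coeff_rel using indep by blast
  have Hi: "\<forall>i>k. coeff H i = 0" by (simp add: H_def coeff_rel k_def coeff_eq_0)
  have degH: "degree H = k" using degree_le[OF Hi] le_degree[OF Hk] by simp
  obtain c Q where "c \<noteq> 0" "smult c H = Q * M"
    using minimal_relation_pseudo_divides[OF L \<open>M \<noteq> 0\<close>, of H] SM SH minM unfolding S_def by blast
  with primitive_divides[OF prim] have "M dvd H" by blast
  then obtain Q where "H = M * Q" ..
  then have Q: "H = Q * M" by (simp only: mult.commute)
  have Q0: "Q \<noteq> 0" using SH unfolding S_def Q by auto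
  \<comment> \<open>Both \<open>u\<close> and \<open>v\<close> divide coefficients of \<open>M\<close>, and one of them has degree \<open>k\<close>.\<close>
  obtain j where j: "coeff M j \<noteq> 0" "k \<le> degree (coeff M j)"
  proof -
    obtain g where g: "coeff M l = g * u" "a = g * v" using lowest[OF \<open>a \<noteq> 0\<close>] s_def by blast
    with \<open>a \<noteq> 0\<close> have g0: "g \<noteq> 0" by auto
    show thesis
    proof (cases "degree u \<ge> degree v")
      case True
      then show thesis using that[of l] g g0 u0 by (simp add: k_def degree_mult_eq)
    next
      case False
      then show thesis using that[of "degree M"] g g0 v0 unfolding a_def by (simp add: k_def degree_mult_eq)
    qed
  qed
  have Q_const: "degree (coeff Q i) = 0" for i
  proof (rule ccontr)
    assume d: "degree (coeff Q i) \<noteq> 0"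
    then have "coeff Q i \<noteq> 0" by auto
    from cofinite_ex[OF eventually_conj[OF cofinite_degree_poly_const[OF this] cofinite_degree_poly_const[OF j(1)]]]
    obtain y where y: "poly Q [:y:] \<noteq> 0" "degree (coeff Q i) \<le> degree (poly Q [:y:])"
      "poly M [:y:] \<noteq> 0" "degree (coeff M j) \<le> degree (poly M [:y:])" by blast
    have "degree (poly H [:y:]) \<le> k"
      unfolding H_def rel_def k_def
      by (auto simp: poly_lift_const_const intro!: degree_diff_le order.trans[OF degree_mult_le] order.trans[OF degree_smult_le])
    moreover have "degree (poly H [:y:]) = degree (poly Q [:y:]) + degree (poly M [:y:])"
      unfolding Q poly_mult using y by (intro degree_mult_eq) auto
    ultimately show False using y j d by linarith
  qed
  define Q' where "Q' = map_poly (\<lambda>c. coeff c 0) Q"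
  have QQ': "Q = lift_const Q'"
  proof (rule poly_eqI)
    fix i
    obtain e where "coeff Q i = [:e:]" using Q_const[of i] by (auto elim: degree_eq_zeroE)
    then show "coeff Q i = coeff (lift_const Q') i" by (simp add: Q'_def coeff_map_poly)
  qed
  have Q'0: "Q' \<noteq> 0" using Q0 QQ' by auto
  \<comment> \<open>Reducing \<open>u(T)\<close> and \<open>v(T)\<close> modulo the cofactor, the remainders \<open>r1\<close> and \<open>r2\<close> satisfy
    \<open>v(t) r1(T) = u(t) r2(T)\<close>; as \<open>u\<close> and \<open>v\<close> are independent over \<open>K\<close>, both are zero.\<close>
  have "degree Q' = 0"
  proof -
    define r1 r2 where "r1 = u mod Q'" and "r2 = v mod Q'"
    define D where "D = M - smult v (lift_const (u div Q')) + smult u (lift_const (v div Q'))"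
    have lu: "lift_const u = lift_const Q' * lift_const (u div Q') + lift_const r1"
      and lv: "lift_const v = lift_const Q' * lift_const (v div Q') + lift_const r2"
      by (simp_all add: r1_def r2_def flip: lift_const.hom_mult lift_const.hom_add)
    have eq: "smult v (lift_const r1) - smult u (lift_const r2) = Q * D"
      using Q unfolding D_def H_def rel_def QQ' lu lv
      by (simp add: algebra_simps smult_add_right smult_diff_right)
    have "D = 0"
    proof (rule ccontr)
      assume "D \<noteq> 0"
      have "degree (Q * D) \<ge> degree Q'" using \<open>D \<noteq> 0\<close> Q0 QQ' by (simp add: degree_mult_eq)
      moreover have "coeff (smult v (lift_const r1) - smult u (lift_const r2)) i = 0" if "i \<ge> degree Q'" for i
      proof -
        have "coeff r1 i = 0" "coeff r2 i = 0"
          using that degree_mod_less[OF Q'0, of u] degree_mod_less[OF Q'0, of v]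
          by (auto simp: r1_def r2_def coeff_eq_0)
        then show ?thesis by simp
      qed
      ultimately have "lead_coeff (Q * D) = 0" unfolding eq[symmetric] by blast
      then show False using Q0 \<open>D \<noteq> 0\<close> by simp
    qed
    have "coeff r1 i = 0 \<and> coeff r2 i = 0" for i
    proof (rule indep)
      have "coeff (smult v (lift_const r1) - smult u (lift_const r2)) i = 0" using eq \<open>D = 0\<close> by simp
      then show "smult (coeff r1 i) v - smult (coeff r2 i) u = 0" by simp
    qed
    then have "r1 = 0" "r2 = 0" by (auto simp: poly_eq_iff)
    then have u': "u = Q' * (u div Q')" and v': "v = Q' * (v div Q')" by (auto simp: r1_def r2_def)
    define b where "b = v div Q'"
    have b: "v = Q' * b" "b \<noteq> 0" using v' v0 by (auto simp: b_def)
    have "s = to_fract (u div Q') / to_fract b"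
      using s_uv Q'0 b by (subst (asm) u', subst (asm) b(1)) simp
    from lowest[OF b(2) this] obtain g where "b = g * v" by blast
    then have "b * 1 = b * (g * Q')" using b(1) by (simp add: ac_simps)
    with b(2) have "1 = g * Q'" by (metis mult_left_cancel)
    then have "degree g + degree Q' = 0" by (metis degree_1 degree_mult_eq mult_eq_0_iff zero_neq_one)
    then show ?thesis by simp
  qed
  then have degM: "degree M = k" using degH Q0 \<open>M \<noteq> 0\<close> unfolding Q QQ' by (simp add: degree_mult_eq)

  \<comment> \<open>From here on, \<open>N\<close> is the field \<open>K(s)\<close>, to be compared with \<open>L\<close>.\<close>
  define N where "N = quotients (\<lambda>p. ratcomp p s)"
  have N: "ratfun_subfield N" unfolding N_def by (rule ratfun_subfield_ratcomp)
  note ND = ratfun_subfieldD[OF N]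
  have "ratcomp p s \<in> L" for p by (induction p) (simp_all add: LD(1,2,4,6) \<open>s \<in> L\<close>)
  then have NL: "N \<subseteq> L" unfolding N_def quotients_def by (auto intro: LD(7))
  have "s \<in> N" unfolding N_def quotients_def
    by (rule CollectI, rule exI[of _ "[:0, 1:]"], rule exI[of _ 1]) (simp add: const_ratfun_simps)
  let ?\<tau> = "to_fract ?X"
  have independent: "f i = 0" if f: "\<And>i. i < k \<Longrightarrow> f i \<in> L" "(\<Sum>i<k. f i * ?\<tau> ^ i) = 0" "i < k" for f i
  proof -
    obtain e g where eg: "e \<noteq> 0" "\<And>i. i < k \<Longrightarrow> f i * to_fract e = to_fract (g i)"
      using common_denominator[of k f] by blast
    define G where "G = (\<Sum>i<k. monom (g i) i)"
    have cG: "coeff G i = (if i < k then g i else 0)" for i by (simp add: G_def coeff_sum)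
    have "to_fract (poly G ?X) = (\<Sum>i<k. to_fract (g i) * ?\<tau> ^ i)"
      by (simp add: G_def poly_sum poly_monom to_fract_power)
    also have "\<dots> = (\<Sum>i<k. f i * ?\<tau> ^ i) * to_fract e"
      unfolding sum_distrib_right by (intro sum.cong) (auto simp: eg(2)[symmetric])
    also have "\<dots> = 0" using f(2) by simp
    finally have "poly G ?X = 0" by simp
    moreover have "proportional_over L G"
    proof -
      have "1 / to_fract e * to_fract (coeff G i) \<in> L" for i
        using f(1)[of i] eg LD(2) by (simp add: cG eg(2)[symmetric])
      moreover have "1 / to_fract e \<noteq> 0" using eg by simp
      ultimately show ?thesis unfolding proportional_over_def by blast
    qed
    moreover have "G = 0 \<or> degree G < k"
      using cG[of "degree G"] by (auto split: if_splits)
    ultimately have "G = 0" using minM[of G] degM unfolding S_def by (cases "G = 0") auto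
    then have "g i = 0" using cG[of i] f(3) by simp
    with eg f(3) show ?thesis by (metis mult_eq_0_iff to_fract_eq_0_iff)
  qed
  define h where "h i = const_ratfun (coeff u i) - s * const_ratfun (coeff v i)" for i
  have hN: "h i \<in> N" for i unfolding h_def by (intro ND(5) ND(6) ND(1) \<open>s \<in> N\<close>)
  have hk: "h k \<noteq> 0"
  proof
    assume "h k = 0"
    then have "const_ratfun (coeff u k) * to_fract v = const_ratfun (coeff v k) * to_fract u"
      using v0 unfolding h_def s_uv by (simp add: field_simps)
    then have "to_fract ([:coeff u k:] * v) = to_fract ([:coeff v k:] * u)" by (simp only: to_fract_mult)
    then have "[:coeff u k:] * v = [:coeff v k:] * u" by (simp only: to_fract_eq_iff)
    then have "coeff H k = 0" by (simp add: H_def coeff_rel)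
    with Hk show False by simp
  qed
  have expand: "to_fract r = (\<Sum>i\<le>n. const_ratfun (coeff r i) * ?\<tau> ^ i)" if "degree r \<le> n" for r :: "'a poly" and n
  proof -
    have "r = (\<Sum>i\<le>n. monom (coeff r i) i)" using that by (simp add: poly_as_sum_of_monoms')
    also have "\<dots> = (\<Sum>i\<le>n. [:coeff r i:] * ?X ^ i)" by (simp add: monom_altdef)
    finally have "to_fract r = to_fract (\<Sum>i\<le>n. [:coeff r i:] * ?X ^ i)" by (rule arg_cong)
    then show ?thesis by (simp only: to_fract_sum to_fract_mult to_fract_power)
  qed
  have "(\<Sum>i\<le>k. h i * ?\<tau> ^ i) = to_fract u - s * to_fract v"
    unfolding h_def expand[of u k, unfolded k_def, OF max.cobounded1, folded k_def]
      expand[of v k, unfolded k_def, OF max.cobounded2, folded k_def]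
    by (simp add: algebra_simps sum_distrib_left sum_subtractf)
  also have "\<dots> = 0" using s_uv v0 by simp
  finally have h_rel: "(\<Sum>i\<le>k. h i * ?\<tau> ^ i) = 0" .
  have "k \<noteq> 0"
  proof
    assume "k = 0"
    with h_rel hk show False by simp
  qed
  then obtain m where m: "k = Suc m" by (cases k) auto
  define e where "e i = - (h i / h k)" for i
  have eN: "e i \<in> N" for i unfolding e_def using ND(5)[OF ND(2) ND(7)[OF hN[of i] hN[of k]]] by simp
  have top: "?\<tau> ^ k = (\<Sum>i<k. e i * ?\<tau> ^ i)"
  proof -
    have "h k * ?\<tau> ^ k = - (\<Sum>i<k. h i * ?\<tau> ^ i)"
      using h_rel by (simp add: lessThan_Suc_atMost[symmetric] eq_neg_iff_add_eq_0 add.commute)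
    also have "\<dots> = h k * (\<Sum>i<k. e i * ?\<tau> ^ i)"
      using hk by (simp add: e_def sum_distrib_left sum_negf)
    finally show ?thesis using hk by simp
  qed
  have span: "\<exists>b. (\<forall>i. b i \<in> N) \<and> to_fract r = (\<Sum>i<k. b i * ?\<tau> ^ i)" for r :: "'a poly"
  proof (induction r)
    case 0
    show ?case by (rule exI[of _ "\<lambda>_. 0"]) (use ND(2) in simp)
  next
    case (pCons c r)
    then obtain b where b: "\<And>i. b i \<in> N" "to_fract r = (\<Sum>i<k. b i * ?\<tau> ^ i)" by blast
    define b' where "b' i = (case i of 0 \<Rightarrow> const_ratfun c | Suc i' \<Rightarrow> b i') + b m * e i" for i
    have "b' i \<in> N" for i
      unfolding b'_def by (intro ND(4) ND(6) b(1) eN) (simp split: nat.split add: ND(1) b(1))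
    moreover have "to_fract (pCons c r) = (\<Sum>i<k. b' i * ?\<tau> ^ i)"
    proof -
      have "pCons c r = [:c:] + ?X * r" by simp
      then have "to_fract (pCons c r) = const_ratfun c + ?\<tau> * to_fract r" by (simp only: to_fract_add to_fract_mult)
      also have "?\<tau> * to_fract r = (\<Sum>i<m. b i * ?\<tau> ^ Suc i) + b m * ?\<tau> ^ k"
        unfolding b(2) m by (simp add: sum_distrib_left algebra_simps)
      also have "b m * ?\<tau> ^ k = (\<Sum>i<k. b m * e i * ?\<tau> ^ i)"
        unfolding top by (simp add: sum_distrib_left mult.assoc)
      also have "const_ratfun c + ((\<Sum>i<m. b i * ?\<tau> ^ Suc i) + (\<Sum>i<k. b m * e i * ?\<tau> ^ i)) =
          (\<Sum>i<k. (case i of 0 \<Rightarrow> const_ratfun c | Suc i' \<Rightarrow> b i') * ?\<tau> ^ i) + (\<Sum>i<k. b m * e i * ?\<tau> ^ i)"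
        unfolding m by (subst (2) sum.lessThan_Suc_shift) (simp add: add.assoc)
      also have "\<dots> = (\<Sum>i<k. b' i * ?\<tau> ^ i)"
        by (simp add: b'_def distrib_right sum.distrib)
      finally show ?thesis .
    qed
    ultimately show ?case by blast
  qed
  have "L \<subseteq> N"
  proof
    fix w assume "w \<in> L"
    obtain p q where pq: "w = to_fract p / to_fract q" "q \<noteq> 0"
      by (cases w) (auto simp: Fract_conv_to_fract)
    obtain b where b: "\<And>i. b i \<in> N" "to_fract q = (\<Sum>i<k. b i * ?\<tau> ^ i)" using span[of q] by blast
    obtain c where c: "\<And>i. c i \<in> N" "to_fract p = (\<Sum>i<k. c i * ?\<tau> ^ i)" using span[of p] by blast
    have "(\<Sum>i<k. (c i - w * b i) * ?\<tau> ^ i) = to_fract p - w * to_fract q"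
      unfolding b(2) c(2) by (simp add: algebra_simps sum_subtractf sum_distrib_left)
    also have "\<dots> = 0" using pq by simp
    finally have z: "(\<Sum>i<k. (c i - w * b i) * ?\<tau> ^ i) = 0" .
    have "c i - w * b i \<in> L" for i
      by (intro LD(5) LD(6) subsetD[OF NL] b(1) c(1) \<open>w \<in> L\<close>)
    from independent[OF this z] have eq: "c i = w * b i" if "i < k" for i using that by fastforce
    obtain i where "i < k" "b i \<noteq> 0"
    proof (rule ccontr)
      assume "\<not> thesis"
      with that have "\<forall>i<k. b i = 0" by blast
      with b(2) pq(2) show False by simp
    qed
    then have "w = c i / b i" using eq by simp
    then show "w \<in> N" using ND(7)[OF c(1) b(1)] by metis
  qed
  with \<open>s \<in> L\<close> s_const show thesis using that unfolding N_def by blast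
qed


section \<open>Composition and proper parametrizations\<close>

lemma cofinite_compose:
  assumes "\<forall>\<^sub>\<infinity>v. R v" "s \<notin> range const_ratfun"
  shows "\<forall>\<^sub>\<infinity>t. \<exists>v. ratfun_value s t v \<and> R v"
  using cofinite_ratfun_avoids[OF assms(2), of "{v. \<not> R v}"] assms(1)
  by (simp add: eventually_cofinite)

lemma ratcomp_nonzero:
  fixes s :: "'a::field_char_0 poly fract"
  assumes "s \<notin> range const_ratfun" "p \<noteq> 0"
  shows "ratcomp p s \<noteq> 0"
proof
  assume 0: "ratcomp p s = 0"
  from cofinite_ex[OF cofinite_compose[OF cofinite_poly_nonzero[OF assms(2)] assms(1)]]
  obtain t v where "ratfun_value s t v" "poly p v \<noteq> 0" by blast
  with ratfun_value_ratcomp[of s t v p] 0 show False by (simp add: ratfun_value_0)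
qed

lemma ratfun_compose:
  fixes s :: "'a::field_char_0 poly fract"
  assumes "s \<notin> range const_ratfun"
  shows "\<exists>r'. \<forall>t v w. ratfun_value s t v \<longrightarrow> ratfun_value r v w \<longrightarrow> ratfun_value r' t w"
proof -
  obtain p q where r: "r = Fraction_Field.Fract p q" "q \<noteq> 0" by (cases r) auto
  have "ratfun_value (ratcomp p s / ratcomp q s) t w" if v: "ratfun_value s t v" and w: "ratfun_value r v w" for t v w
  proof -
    from w obtain p' q' where r': "r = Fraction_Field.Fract p' q'" "poly q' v \<noteq> 0" "w = poly p' v / poly q' v"
      unfolding ratfun_value_def by blast
    then have "q' \<noteq> 0" by auto
    with r r' have "p * q' = p' * q" by (metis eq_fract(1))
    then have "ratcomp p s * ratcomp q' s = ratcomp p' s * ratcomp q s" by (simp flip: ratcomp.hom_mult)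
    then have "ratcomp p s / ratcomp q s = ratcomp p' s / ratcomp q' s"
      using ratcomp_nonzero[OF assms r(2)] ratcomp_nonzero[OF assms \<open>q' \<noteq> 0\<close>] by (simp add: frac_eq_eq)
    moreover have "ratfun_value (ratcomp p' s / ratcomp q' s) t w"
      unfolding r'(3) by (intro ratfun_value_divide ratfun_value_ratcomp v r'(2))
    ultimately show ?thesis by simp
  qed
  then show ?thesis by blast
qed

lemma nonconstantI:
  assumes "\<And>Q. \<exists>t. \<not> ratpair_value P t Q"
  shows "nonconstant P"
proof (rule ccontr)
  assume "\<not> nonconstant P"
  then obtain c e where "fst P = const_ratfun c" "snd P = const_ratfun e"
    unfolding nonconstant_def by blast
  then have "ratpair_value P t (c, e)" for t by (simp add: ratpair_value_def ratfun_value_const)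
  with assms show False by blast
qed

lemma parametrization_compose:
  fixes P :: "'a::{alg_closed_field, field_char_0} ratpair"
  assumes "irreducible_curve C" "parametrization P C" "s \<notin> range const_ratfun"
  obtains P' where "parametrization P' C"
    "\<And>t v Q. ratfun_value s t v \<Longrightarrow> ratpair_value P v Q \<Longrightarrow> ratpair_value P' t Q"
proof -
  obtain r1 r2 where r1: "\<forall>t v w. ratfun_value s t v \<longrightarrow> ratfun_value (fst P) v w \<longrightarrow> ratfun_value r1 t w"
    and r2: "\<forall>t v w. ratfun_value s t v \<longrightarrow> ratfun_value (snd P) v w \<longrightarrow> ratfun_value r2 t w"
    using ratfun_compose[OF assms(3)] by metis
  define P' where "P' = (r1, r2)"
  have val: "ratpair_value P' t Q" if "ratfun_value s t v" "ratpair_value P v Q" for t v Q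
    using that r1 r2 unfolding ratpair_value_def P'_def by simp
  have "nonconstant P'"
  proof (rule nonconstantI)
    fix Q
    have "nonconstant P" using assms(2) by (simp add: parametrization_iff)
    from cofinite_ex[OF cofinite_compose[OF cofinite_ratpair_avoids[OF this, of "{Q}"] assms(3)]]
    obtain t v Q' where "ratfun_value s t v" "ratpair_value P v Q'" "Q' \<noteq> Q" by auto
    with val have "\<not> ratpair_value P' t Q" using ratpair_value_unique by blast
    then show "\<exists>t. \<not> ratpair_value P' t Q" by blast
  qed
  moreover have "\<forall>\<^sub>\<infinity>t. \<exists>Q. ratpair_value P' t Q \<and> Q \<in> C"
    using cofinite_compose[OF cofinite_ratpair_value[of P] assms(3)]
  proof eventually_elim
    case (elim t)
    then obtain v Q where vQ: "ratfun_value s t v" "ratpair_value P v Q" by blast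
    have "Q \<in> C" using ratpair_value_in_param_closure[OF vQ(2)] assms(2) by (simp add: parametrization_iff)
    with val[OF vQ] show ?case by blast
  qed
  ultimately have "parametrization P' C" using parametrizationI[OF assms(1)] by blast
  with val show thesis using that by blast
qed

text \<open>
  Homogenization: a polynomial in \<open>N/D\<close> becomes a polynomial in the coordinates after
  multiplication by a power of \<open>D\<close>.
\<close>

lemma clear_denominator:
  "\<exists>G k. \<forall>Q. bieval D Q \<noteq> 0 \<longrightarrow> bieval G Q = bieval D Q ^ k * poly p (bieval N Q / bieval D (Q :: 'a::field \<times> 'a))"
proof (induction p)
  case 0
  show ?case by (intro exI[of _ 0]) simp
next
  case (pCons a p)
  then obtain G k where Gk: "\<And>Q. bieval D Q \<noteq> 0 \<Longrightarrow> bieval G Q = bieval D Q ^ k * poly p (bieval N Q / bieval D Q)" by blast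
  show ?case
    by (intro exI[of _ "[:[:a:]:] * D ^ Suc k + N * G"] exI[of _ "Suc k"])
      (simp add: bieval.hom_add bieval.hom_mult bieval.hom_power Gk algebra_simps)
qed

lemma ratfun_value_FractI:
  "poly q t \<noteq> 0 \<Longrightarrow> ratfun_value (Fraction_Field.Fract p q) t (poly p t / poly q t)"
  unfolding ratfun_value_def by blast

lemma ratpair_value_FractD:
  assumes "ratpair_value (Fraction_Field.Fract p1 q1, Fraction_Field.Fract p2 q2) t Q"
    "poly q1 t \<noteq> 0" "poly q2 t \<noteq> 0"
  shows "poly p1 t = fst Q * poly q1 t" "poly p2 t = snd Q * poly q2 t"
proof -
  have "ratfun_value (Fraction_Field.Fract p1 q1) t (poly p1 t / poly q1 t)"
    "ratfun_value (Fraction_Field.Fract p2 q2) t (poly p2 t / poly q2 t)"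
    using assms unfolding ratfun_value_def by blast+
  with assms(1) have "fst Q = poly p1 t / poly q1 t" "snd Q = poly p2 t / poly q2 t"
    unfolding ratpair_value_def fst_conv snd_conv using ratfun_value_unique by blast+
  with assms(2,3) show "poly p1 t = fst Q * poly q1 t" "poly p2 t = snd Q * poly q2 t" by simp_all
qed

text \<open>
  Lueroth's theorem for the field generated by the coordinates of a parametrization \<open>P\<close> writes
  \<open>P = R(s)\<close> with \<open>s = N(P)/D(P)\<close>. Both identities say that \<open>N/D\<close> inverts \<open>R\<close>: they hold after the
  substitution of \<open>s(t)\<close>, respectively of \<open>P(t)\<close>, hence identically on the line and on the curve.
  The exceptional points of the curve are zeros of a product of denominators.
\<close>

theorem rational_curve_proper_parametrization:
  fixes C :: "('a::{alg_closed_field, field_char_0} \<times> 'a) set"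
  assumes "rational_curve C"
  obtains R where "proper_parametrization R C"
proof -
  from assms obtain f P where f: "irreducible f" "C = zero_locus f" and "parametrization P C"
    unfolding rational_curve_def irreducible_curve_def by blast
  then have P: "nonconstant P" "param_closure P = C" by (simp_all add: parametrization_iff)
  define L where "L = quotients (\<lambda>F. bieval_ratpair F P)"
  have L: "ratfun_subfield L" unfolding L_def by (rule ratfun_subfield_bieval_ratpair)
  have fstL: "fst P \<in> L" unfolding L_def quotients_def
    by (rule CollectI, rule exI[of _ "[:[:0, 1:]:]"], rule exI[of _ 1]) (simp add: const_ratfun_simps)
  have sndL: "snd P \<in> L" unfolding L_def quotients_def
    by (rule CollectI, rule exI[of _ "[:0, 1:]"], rule exI[of _ 1]) (simp add: const_ratfun_simps)
  obtain w where "w \<in> L" "w \<notin> range const_ratfun"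
    using P(1) fstL sndL unfolding nonconstant_def by blast
  then obtain s where s: "s \<in> L" "s \<notin> range const_ratfun" "L \<subseteq> quotients (\<lambda>p. ratcomp p s)"
    using lueroth[OF L] by metis
  from s(1) obtain N D where ND: "s = bieval_ratpair N P / bieval_ratpair D P" "bieval_ratpair D P \<noteq> 0"
    unfolding L_def quotients_def by blast
  from fstL s(3) obtain p1 q1 where 1: "fst P = ratcomp p1 s / ratcomp q1 s" "ratcomp q1 s \<noteq> 0"
    unfolding quotients_def by blast
  from sndL s(3) obtain p2 q2 where 2: "snd P = ratcomp p2 s / ratcomp q2 s" "ratcomp q2 s \<noteq> 0"
    unfolding quotients_def by blast
  have q0: "q1 \<noteq> 0" "q2 \<noteq> 0" using 1(2) 2(2) by auto
  define R where "R = (Fraction_Field.Fract p1 q1, Fraction_Field.Fract p2 q2)"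
  \<comment> \<open>A parameter \<open>t\<close> is good if \<open>v = s(t)\<close> and \<open>Q = P(t) = R(v)\<close> exist and no denominator vanishes.\<close>
  define key where "key t v Q \<longleftrightarrow> ratfun_value s t v \<and> ratpair_value P t Q \<and> ratpair_value R v Q \<and>
    bieval D Q \<noteq> 0 \<and> bieval N Q / bieval D Q = v \<and> poly q1 v \<noteq> 0 \<and> poly q2 v \<noteq> 0" for t v Q
  have key: "\<forall>\<^sub>\<infinity>t. \<exists>v Q. key t v Q"
    using cofinite_compose[OF eventually_conj[OF cofinite_poly_nonzero[OF q0(1)] cofinite_poly_nonzero[OF q0(2)]] s(2)]
      cofinite_bieval_nonzero[OF ND(2)]
  proof eventually_elim
    case (elim t)
    then obtain v Q where v: "ratfun_value s t v" "poly q1 v \<noteq> 0" "poly q2 v \<noteq> 0"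
      and Q: "ratpair_value P t Q" "bieval D Q \<noteq> 0" by blast
    have "ratfun_value s t (bieval N Q / bieval D Q)"
      unfolding ND(1) by (intro ratfun_value_divide ratfun_value_bieval_ratpair Q)
    with v(1) have NDv: "bieval N Q / bieval D Q = v" using ratfun_value_unique by blast
    have "ratfun_value (fst P) t (poly p1 v / poly q1 v)" "ratfun_value (snd P) t (poly p2 v / poly q2 v)"
      unfolding 1(1) 2(1) by (intro ratfun_value_divide ratfun_value_ratcomp v)+
    with Q(1) have "fst Q = poly p1 v / poly q1 v" "snd Q = poly p2 v / poly q2 v"
      unfolding ratpair_value_def using ratfun_value_unique by blast+
    then have "ratpair_value R v Q"
      unfolding ratpair_value_def R_def fst_conv snd_conv using v(2,3) by (simp add: ratfun_value_FractI)
    with v Q NDv have "key t v Q" unfolding key_def by blast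
    then show ?case by blast
  qed
  have key_ex: "\<exists>t v Q. key t v Q \<and> S v" if "\<forall>\<^sub>\<infinity>v. S v" for S
  proof -
    from cofinite_ex[OF eventually_conj[OF key cofinite_compose[OF that s(2)]]]
    obtain t v v' Q where "key t v Q" "ratfun_value s t v'" "S v'" by blast
    moreover from this have "v = v'" unfolding key_def using ratfun_value_unique by blast
    ultimately show ?thesis by blast
  qed
  have "nonconstant R"
  proof (rule nonconstantI)
    fix Q
    from cofinite_ex[OF eventually_conj[OF key cofinite_ratpair_avoids[OF P(1), of "{Q}"]]]
    obtain t v Q' Q'' where k: "key t v Q'" "ratpair_value P t Q''" "Q'' \<noteq> Q" by auto
    then have "Q' = Q''" unfolding key_def using ratpair_value_unique by blast
    with k have "\<not> ratpair_value R v Q" unfolding key_def using ratpair_value_unique by blast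
    then show "\<exists>t. \<not> ratpair_value R t Q" by blast
  qed
  have key_C: "Q \<in> C" if "key t v Q" for t v Q
    using that P(2) ratpair_value_in_param_closure unfolding key_def by blast
  have "bieval_ratpair f R = 0"
  proof (rule ccontr)
    assume "bieval_ratpair f R \<noteq> 0"
    from key_ex[OF cofinite_bieval_nonzero[OF this]] obtain t v Q Q'
      where k: "key t v Q" "ratpair_value R v Q'" "bieval f Q' \<noteq> 0" by blast
    then have "Q = Q'" unfolding key_def using ratpair_value_unique by blast
    with k key_C[OF k(1)] f(2) show False by (simp add: zero_locus_def)
  qed
  with \<open>nonconstant R\<close> have paramR: "parametrization R C"
    using param_closure_zero_locus[OF _ f(1)] f(2) by (simp add: parametrization_iff)
  have DR: "bieval_ratpair D R \<noteq> 0"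
  proof
    assume 0: "bieval_ratpair D R = 0"
    from key_ex[of "\<lambda>_. True"] obtain t v Q where "key t v Q" by auto
    with bieval_eq_0_of_ratpair[OF 0] show False unfolding key_def by blast
  qed
  define W where "W = bieval_ratpair N R - to_fract [:0, 1:] * bieval_ratpair D R"
  have W: "ratfun_value W v (bieval N Q - v * bieval D Q)" if "ratpair_value R v Q" for v Q
    unfolding W_def
    using ratfun_value_diff[OF ratfun_value_bieval_ratpair[OF that]
        ratfun_value_mult[OF ratfun_value_to_fract[of "[:0, 1:]"] ratfun_value_bieval_ratpair[OF that]]] by simp
  have "W = 0"
  proof (rule ccontr)
    assume "W \<noteq> 0"
    from key_ex[OF cofinite_ratfun_nonzero[OF this]] obtain t v Q u
      where k: "key t v Q" "ratfun_value W v u" "u \<noteq> 0" by blast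
    then have "u = bieval N Q - v * bieval D Q" using W unfolding key_def by (blast intro: ratfun_value_unique)
    moreover have "v * bieval D Q = bieval N Q" using k(1) unfolding key_def by auto
    ultimately show False using k(3) by simp
  qed
  have "\<forall>\<^sub>\<infinity>v. \<exists>Q. ratpair_value R v Q \<and> bieval D Q \<noteq> 0 \<and> bieval N Q / bieval D Q = v"
    using cofinite_bieval_nonzero[OF DR]
  proof eventually_elim
    case (elim v)
    then obtain Q where Q: "ratpair_value R v Q" "bieval D Q \<noteq> 0" by blast
    with W[OF Q(1)] \<open>W = 0\<close> have "bieval N Q = v * bieval D Q" by (simp add: ratfun_value_0)
    with Q show ?case by (intro exI[of _ Q]) simp
  qed
  then have fin1: "finite {t. \<not> (\<exists>Q. ratpair_value R t Q \<and> bieval D Q \<noteq> 0 \<and> bieval N Q / bieval D Q = t)}"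
    by (simp add: eventually_cofinite)

  have hom: "\<exists>G k. \<forall>Q. bieval D Q \<noteq> 0 \<longrightarrow> bieval G Q = bieval D Q ^ k * poly p (bieval N Q / bieval D Q)" for p
    by (rule clear_denominator)
  from hom[of p1] obtain A1 i1 where A1: "\<And>Q. bieval D Q \<noteq> 0 \<Longrightarrow> bieval A1 Q = bieval D Q ^ i1 * poly p1 (bieval N Q / bieval D Q)" by blast
  from hom[of p2] obtain A2 i2 where A2: "\<And>Q. bieval D Q \<noteq> 0 \<Longrightarrow> bieval A2 Q = bieval D Q ^ i2 * poly p2 (bieval N Q / bieval D Q)" by blast
  from hom[of q1] obtain B1 j1 where B1: "\<And>Q. bieval D Q \<noteq> 0 \<Longrightarrow> bieval B1 Q = bieval D Q ^ j1 * poly q1 (bieval N Q / bieval D Q)" by blast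
  from hom[of q2] obtain B2 j2 where B2: "\<And>Q. bieval D Q \<noteq> 0 \<Longrightarrow> bieval B2 Q = bieval D Q ^ j2 * poly q2 (bieval N Q / bieval D Q)" by blast
  \<comment> \<open>The equations \<open>R(N/D) = Q\<close> with denominators cleared; they hold at \<open>P(t)\<close>, hence on \<open>C\<close>.\<close>
  define E1 where "E1 = D ^ j1 * A1 - D ^ i1 * [:[:0, 1:]:] * B1"
  define E2 where "E2 = D ^ j2 * A2 - D ^ i2 * [:0, 1:] * B2"
  have E1: "bieval E1 Q = bieval D Q ^ (i1 + j1) * (poly p1 (bieval N Q / bieval D Q) - fst Q * poly q1 (bieval N Q / bieval D Q))"
    and E2: "bieval E2 Q = bieval D Q ^ (i2 + j2) * (poly p2 (bieval N Q / bieval D Q) - snd Q * poly q2 (bieval N Q / bieval D Q))"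
    if "bieval D Q \<noteq> 0" for Q
    using A1[OF that] A2[OF that] B1[OF that] B2[OF that] unfolding E1_def E2_def
    by (simp_all add: bieval.hom_minus bieval.hom_mult bieval.hom_power power_add algebra_simps)
  have key_E: "bieval E1 Q = 0 \<and> bieval E2 Q = 0" if "key t v Q" for t v Q
    using that ratpair_value_FractD[of p1 q1 p2 q2 v Q] E1[of Q] E2[of Q] unfolding key_def R_def by auto
  have EPv: "\<forall>\<^sub>\<infinity>t. \<exists>Q. ratpair_value P t Q \<and> bieval E1 Q = 0 \<and> bieval E2 Q = 0"
    using key
  proof eventually_elim
    case (elim t)
    then obtain v Q where k: "key t v Q" by blast
    then have "ratpair_value P t Q" by (simp add: key_def)
    with key_E[OF k] show ?case by blast
  qed
  have EP: "bieval_ratpair E1 P = 0" "bieval_ratpair E2 P = 0"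
    by (rule bieval_ratpair_eq_0I, use EPv in eventually_elim, blast)+
  define B where "B = D * B1 * B2"
  have "\<not> f dvd B"
  proof
    assume "f dvd B"
    obtain t v Q where k: "key t v Q" using cofinite_ex[OF key] by blast
    have "bieval f Q = 0" using key_C[OF k] f(2) by (simp add: zero_locus_def)
    with \<open>f dvd B\<close> have "bieval B Q = 0" by (auto simp: bieval.hom_mult elim!: dvdE)
    with k B1[of Q] B2[of Q] show False unfolding key_def B_def by (auto simp: bieval.hom_mult)
  qed
  then have finB: "finite (zero_locus f \<inter> zero_locus B)" by (rule finite_zero_locus_Int[OF f(1)])
  have good: "bieval D Q \<noteq> 0 \<and> ratpair_value R (bieval N Q / bieval D Q) Q" if "Q \<in> C" "bieval B Q \<noteq> 0" for Q
  proof
    show D: "bieval D Q \<noteq> 0" using that(2) by (auto simp: B_def bieval.hom_mult)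
    define v where "v = bieval N Q / bieval D Q"
    have q: "poly q1 v \<noteq> 0" "poly q2 v \<noteq> 0"
      using that(2) B1[OF D] B2[OF D] by (auto simp: B_def bieval.hom_mult v_def)
    have "bieval E1 Q = 0" "bieval E2 Q = 0"
      using that(1) EP P(2) param_closure_subset_zero_locus[of P] by (auto simp: zero_locus_def)
    with E1[OF D] E2[OF D] D have "poly p1 v = fst Q * poly q1 v" "poly p2 v = snd Q * poly q2 v"
      by (auto simp: v_def)
    with q have "fst Q = poly p1 v / poly q1 v" "snd Q = poly p2 v / poly q2 v" by auto
    with q show "ratpair_value R (bieval N Q / bieval D Q) Q"
      unfolding ratpair_value_def R_def fst_conv snd_conv v_def[symmetric] by (simp add: ratfun_value_FractI)
  qed
  have "{Q \<in> C. \<not> (bieval D Q \<noteq> 0 \<and> ratpair_value R (bieval N Q / bieval D Q) Q)} \<subseteq> zero_locus f \<inter> zero_locus B"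
    using good f(2) by (auto simp: zero_locus_def)
  then have fin2: "finite {Q \<in> C. \<not> (bieval D Q \<noteq> 0 \<and> ratpair_value R (bieval N Q / bieval D Q) Q)}"
    using finB by (rule finite_subset)
  have "proper_parametrization R C"
    unfolding proper_parametrization_def using paramR fin1 fin2 by blast
  then show thesis by (rule that)
qed

text \<open>
  The inverse of \<open>P\<close> is defined at all but finitely many points of \<open>C\<close>, and \<open>Y\<close> passes through each of
  the exceptional points only finitely often.
\<close>

lemma proper_parametrization_lift:
  fixes P :: "'a::field_char_0 ratpair"
  assumes "proper_parametrization P C" "parametrization Y C"
  obtains r where "r \<notin> range const_ratfun"
    "\<forall>\<^sub>\<infinity>t. \<exists>v Q. ratfun_value r t v \<and> ratpair_value Y t Q \<and> ratpair_value P v Q"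
proof -
  from assms(1) obtain N D where
    fin: "finite {Q \<in> C. \<not> (bieval D Q \<noteq> 0 \<and> ratpair_value P (bieval N Q / bieval D Q) Q)}" (is "finite ?E")
    unfolding proper_parametrization_def by blast
  have Y: "nonconstant Y" "param_closure Y = C" using assms(2) by (simp_all add: parametrization_iff)
  define r where "r = bieval_ratpair N Y / bieval_ratpair D Y"
  have val: "\<forall>\<^sub>\<infinity>t. \<exists>v Q. ratfun_value r t v \<and> ratpair_value Y t Q \<and> ratpair_value P v Q"
    using cofinite_ratpair_avoids[OF Y(1) fin]
  proof eventually_elim
    case (elim t)
    then obtain Q where Q: "ratpair_value Y t Q" "Q \<notin> ?E" by blast
    have "Q \<in> C" using ratpair_value_in_param_closure[OF Q(1)] Y(2) by simp
    with Q(2) have D: "bieval D Q \<noteq> 0" and PQ: "ratpair_value P (bieval N Q / bieval D Q) Q" by auto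
    have "ratfun_value r t (bieval N Q / bieval D Q)"
      unfolding r_def by (intro ratfun_value_divide ratfun_value_bieval_ratpair Q D)
    with Q(1) PQ show ?case by blast
  qed
  moreover have "r \<notin> range const_ratfun"
  proof
    assume "r \<in> range const_ratfun"
    then obtain c where c: "r = const_ratfun c" by blast
    have P: "ratpair_value P c Q" if "ratfun_value r t v" "ratpair_value P v Q" for t v Q
    proof -
      have "c = v" using ratfun_value_const[of c t] that(1) unfolding c by (rule ratfun_value_unique)
      with that(2) show ?thesis by simp
    qed
    from cofinite_ex[OF val] obtain t0 v0 Q0 where "ratfun_value r t0 v0" "ratpair_value P v0 Q0" by blast
    then have "ratpair_value P c Q0" by (rule P)
    from cofinite_ex[OF eventually_conj[OF val cofinite_ratpair_avoids[OF Y(1), of "{Q0}"]]]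
    obtain t v Q Q' where "ratfun_value r t v" "ratpair_value Y t Q" "ratpair_value P v Q"
      "ratpair_value Y t Q'" "Q' \<noteq> Q0" by auto
    with P \<open>ratpair_value P c Q0\<close> show False using ratpair_value_unique by metis
  qed
  ultimately show thesis using that by blast
qed


section \<open>Dilations from the focus\<close>

definition dilate :: "'a::field \<times> 'a \<Rightarrow> 'a \<Rightarrow> 'a \<times> 'a \<Rightarrow> 'a \<times> 'a" where
  "dilate A c Q = A + scale_pair c (Q - A)"

lemma dilate_simps [simp]:
  "fst (dilate A c Q) = fst A + c * (fst Q - fst A)"
  "snd (dilate A c Q) = snd A + c * (snd Q - snd A)"
  by (simp_all add: dilate_def scale_pair_def)

lemma dilate_dilate: "dilate A c (dilate A e Q) = dilate A (c * e) Q"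
  by (simp add: prod_eq_iff)

lemma dilate_1 [simp]: "dilate A 1 Q = Q"
  by (simp add: prod_eq_iff)

lemma dilate_0 [simp]: "dilate A 0 Q = A"
  by (simp add: prod_eq_iff)

lemma normsq_dilate: "normsq (dilate A c Q - A) = c\<^sup>2 * normsq (Q - A)"
  by (simp add: normsq_def power_mult_distrib distrib_left)

lemma dilate_eq_iff: "Q \<noteq> A \<Longrightarrow> dilate A c Q = dilate A e Q \<longleftrightarrow> c = e"
  by (auto simp: prod_eq_iff)

lemma normsq_0 [simp]: "normsq 0 = 0"
  by (simp add: normsq_def)

lemma one_plus_divide: "m \<noteq> 0 \<Longrightarrow> 1 + d / m = (m + d) / (m :: 'a::field)"
  by (simp add: add_divide_distrib)

definition normsq_poly :: "'a::field \<times> 'a \<Rightarrow> 'a bipoly" where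
  "normsq_poly A = ([:[:0, 1:]:] - [:[:fst A:]:])\<^sup>2 + ([:0, 1:] - [:[:snd A:]:])\<^sup>2"

lemma bieval_normsq_poly [simp]: "bieval (normsq_poly A) Q = normsq (Q - A)"
  by (simp add: normsq_poly_def normsq_def bieval.hom_add bieval.hom_minus bieval.hom_power del: diff_pCons)

definition ratnormsq :: "'a::field \<times> 'a \<Rightarrow> 'a ratpair \<Rightarrow> 'a poly fract" where
  "ratnormsq A P = (fst P - const_ratfun (fst A))\<^sup>2 + (snd P - const_ratfun (snd A))\<^sup>2"

lemma bieval_ratpair_normsq_poly: "bieval_ratpair (normsq_poly A) P = ratnormsq A P"
  by (simp add: normsq_poly_def ratnormsq_def bieval_ratpair.hom_add bieval_ratpair.hom_minus
      bieval_ratpair.hom_power const_ratfun_simps del: diff_pCons)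

lemma ratfun_value_ratnormsq:
  "ratpair_value P t Q \<Longrightarrow> ratfun_value (ratnormsq A P) t (normsq (Q - A))"
  using ratfun_value_bieval_ratpair[of P t Q "normsq_poly A"] by (simp add: bieval_ratpair_normsq_poly)

definition ratdilate :: "'a::field \<times> 'a \<Rightarrow> 'a poly fract \<Rightarrow> 'a ratpair \<Rightarrow> 'a ratpair" where
  "ratdilate A \<rho> P = (const_ratfun (fst A) + \<rho> * (fst P - const_ratfun (fst A)),
                     const_ratfun (snd A) + \<rho> * (snd P - const_ratfun (snd A)))"

lemma ratpair_value_ratdilate:
  assumes "ratfun_value \<rho> t c" "ratpair_value P t Q"
  shows "ratpair_value (ratdilate A \<rho> P) t (dilate A c Q)"
  using assms unfolding ratpair_value_def ratdilate_def fst_conv snd_conv dilate_simps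
  by (intro conjI ratfun_value_add ratfun_value_mult ratfun_value_diff ratfun_value_const) auto

lemma ratnormsq_ratdilate: "ratnormsq A (ratdilate A \<rho> P) = \<rho>\<^sup>2 * ratnormsq A P"
  by (simp add: ratnormsq_def ratdilate_def power_mult_distrib distrib_left)

text \<open>
  For a square root \<open>n\<close> of \<open>N(Q)\<close> every polynomial in the coordinates of \<open>Q\<close>, in \<open>n\<close> and in \<open>1/n\<close> can
  be written as \<open>\<alpha>(Q) + \<beta>(Q) n\<close> up to an even power of \<open>n\<close>. The two square roots are conjugate
  over \<open>K(Q)\<close>, and \<open>\<alpha>\<close> and \<open>\<beta>\<close> do not depend on the choice between them.
\<close>

definition conj_form :: "'a::field \<times> 'a \<Rightarrow> ('a \<times> 'a \<Rightarrow> 'a \<Rightarrow> 'a) \<Rightarrow> bool" where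
  "conj_form A g \<longleftrightarrow> (\<exists>k \<alpha> \<beta>. \<forall>Q n. n\<^sup>2 = normsq (Q - A) \<longrightarrow> n \<noteq> 0 \<longrightarrow>
     n ^ (2 * k) * g Q n = bieval \<alpha> Q + bieval \<beta> Q * n)"

lemma conj_form_poly: "conj_form A (\<lambda>Q n. bieval F Q)"
  unfolding conj_form_def by (intro exI[of _ 0] exI[of _ F]) simp

lemma conj_form_add:
  assumes "conj_form A g" "conj_form A h"
  shows "conj_form A (\<lambda>Q n. g Q n + h Q n)"
proof -
  from assms(1) obtain k \<alpha> \<beta> where g: "\<And>Q n. n\<^sup>2 = normsq (Q - A) \<Longrightarrow> n \<noteq> 0 \<Longrightarrow>
     n ^ (2 * k) * g Q n = bieval \<alpha> Q + bieval \<beta> Q * n" unfolding conj_form_def by blast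
  from assms(2) obtain k' \<alpha>' \<beta>' where h: "\<And>Q n. n\<^sup>2 = normsq (Q - A) \<Longrightarrow> n \<noteq> 0 \<Longrightarrow>
     n ^ (2 * k') * h Q n = bieval \<alpha>' Q + bieval \<beta>' Q * n" unfolding conj_form_def by blast
  let ?N = "normsq_poly A"
  have "n ^ (2 * (k + k')) * (g Q n + h Q n) =
      bieval (?N ^ k' * \<alpha> + ?N ^ k * \<alpha>') Q + bieval (?N ^ k' * \<beta> + ?N ^ k * \<beta>') Q * n"
    if n: "n\<^sup>2 = normsq (Q - A)" "n \<noteq> 0" for Q n
  proof -
    have "n ^ (2 * (k + k')) * (g Q n + h Q n) =
        n ^ (2 * k') * (n ^ (2 * k) * g Q n) + n ^ (2 * k) * (n ^ (2 * k') * h Q n)"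
      by (simp add: algebra_simps power_add)
    also have "\<dots> = (n\<^sup>2) ^ k' * (bieval \<alpha> Q + bieval \<beta> Q * n) + (n\<^sup>2) ^ k * (bieval \<alpha>' Q + bieval \<beta>' Q * n)"
      unfolding g[OF n] h[OF n] by (simp only: power_mult)
    finally show ?thesis unfolding n(1) by (simp add: bieval.hom_add bieval.hom_mult bieval.hom_power algebra_simps)
  qed
  then show ?thesis unfolding conj_form_def by blast
qed

lemma conj_form_mult:
  assumes "conj_form A g" "conj_form A h"
  shows "conj_form A (\<lambda>Q n. g Q n * h Q n)"
proof -
  from assms(1) obtain k \<alpha> \<beta> where g: "\<And>Q n. n\<^sup>2 = normsq (Q - A) \<Longrightarrow> n \<noteq> 0 \<Longrightarrow>
     n ^ (2 * k) * g Q n = bieval \<alpha> Q + bieval \<beta> Q * n" unfolding conj_form_def by blast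
  from assms(2) obtain k' \<alpha>' \<beta>' where h: "\<And>Q n. n\<^sup>2 = normsq (Q - A) \<Longrightarrow> n \<noteq> 0 \<Longrightarrow>
     n ^ (2 * k') * h Q n = bieval \<alpha>' Q + bieval \<beta>' Q * n" unfolding conj_form_def by blast
  let ?N = "normsq_poly A"
  have "n ^ (2 * (k + k')) * (g Q n * h Q n) =
      bieval (\<alpha> * \<alpha>' + ?N * \<beta> * \<beta>') Q + bieval (\<alpha> * \<beta>' + \<beta> * \<alpha>') Q * n"
    if n: "n\<^sup>2 = normsq (Q - A)" "n \<noteq> 0" for Q n
  proof -
    have "n ^ (2 * (k + k')) * (g Q n * h Q n) = (n ^ (2 * k) * g Q n) * (n ^ (2 * k') * h Q n)"
      by (simp add: algebra_simps power_add)
    also have "\<dots> = (bieval \<alpha> Q + bieval \<beta> Q * n) * (bieval \<alpha>' Q + bieval \<beta>' Q * n)"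
      unfolding g[OF n] h[OF n] ..
    also have "\<dots> = bieval \<alpha> Q * bieval \<alpha>' Q + n\<^sup>2 * bieval \<beta> Q * bieval \<beta>' Q +
        (bieval \<alpha> Q * bieval \<beta>' Q + bieval \<beta> Q * bieval \<alpha>' Q) * n"
      by (simp add: algebra_simps power2_eq_square)
    finally show ?thesis unfolding n(1) by (simp add: bieval.hom_add bieval.hom_mult)
  qed
  then show ?thesis unfolding conj_form_def by blast
qed

lemma conj_form_dilate: "conj_form A (\<lambda>Q n. bieval F (dilate A (1 + d / n) Q))"
proof -
  let ?N = "normsq_poly A"
  have coord: "conj_form A (\<lambda>Q n. e + (1 + d / n) * (bieval X Q - e))" for e X
  proof -
    let ?\<alpha> = "?N * X" and ?\<beta> = "[:[:d:]:] * (X - [:[:e:]:])"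
    have "n ^ (2 * 1) * (e + (1 + d / n) * (bieval X Q - e)) = bieval ?\<alpha> Q + bieval ?\<beta> Q * n"
      if n: "n\<^sup>2 = normsq (Q - A)" "n \<noteq> 0" for Q n
    proof -
      have "n ^ (2 * 1) * (e + (1 + d / n) * (bieval X Q - e)) = n\<^sup>2 * bieval X Q + d * (bieval X Q - e) * n"
        using n(2) by (simp add: field_simps power2_eq_square)
      then show ?thesis unfolding n(1)
        by (simp add: bieval.hom_add bieval.hom_mult bieval.hom_minus)
    qed
    then show ?thesis unfolding conj_form_def by blast
  qed
  have x: "conj_form A (\<lambda>Q n. fst (dilate A (1 + d / n) Q))"
    using coord[of "fst A" "[:[:0, 1:]:]"] by simp
  have y: "conj_form A (\<lambda>Q n. snd (dilate A (1 + d / n) Q))"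
    using coord[of "snd A" "[:0, 1:]"] by simp
  have const: "conj_form A (\<lambda>Q n. c)" for c using conj_form_poly[of A "[:[:c:]:]"] by simp
  have p: "conj_form A (\<lambda>Q n. poly p (fst (dilate A (1 + d / n) Q)))" for p
  proof (induction p)
    case 0
    show ?case using const[of 0] by simp
  next
    case (pCons c p)
    show ?case unfolding poly_pCons by (intro conj_form_add conj_form_mult const x pCons.IH)
  qed
  show ?thesis
  proof (induction F)
    case 0
    show ?case using const[of 0] by simp
  next
    case (pCons c F)
    show ?case unfolding bieval_pCons by (intro conj_form_add conj_form_mult p y pCons.IH)
  qed
qed

section \<open>Lines and circles\<close>

lemma irreducible_curve_infinite_Int_eq:
  fixes C D :: "('a::{alg_closed_field, field_char_0} \<times> 'a) set"
  assumes "irreducible_curve C" "irreducible_curve D" "infinite (C \<inter> D)"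
  shows "C = D"
proof -
  from assms obtain f g where fg: "irreducible f" "C = zero_locus f" "D = zero_locus g"
    unfolding irreducible_curve_def by blast
  then have "f dvd g" using finite_zero_locus_Int[OF fg(1)] assms(3) by blast
  with fg have "C \<subseteq> D" by (simp add: irreducible_dvd_iff_zero_locus)
  with assms show ?thesis by (simp add: irreducible_curve_subset_eq)
qed

lemma param_closure_subset:
  fixes X :: "'a::field_char_0 ratpair"
  assumes "zariski_closed S" "\<forall>\<^sub>\<infinity>t. \<exists>Q. ratpair_value X t Q \<and> Q \<in> S"
  shows "param_closure X \<subseteq> S"
proof
  fix Q assume Q: "Q \<in> param_closure X"
  show "Q \<in> S"
  proof (rule ccontr)
    assume "Q \<notin> S"
    with zariski_closed_separate[OF assms(1)] obtain F where F: "S \<subseteq> zero_locus F" "bieval F Q \<noteq> 0" by blast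
    have "bieval_ratpair F X = 0"
      by (rule bieval_ratpair_eq_0I, use assms(2) in eventually_elim) (use F(1) in \<open>auto simp: zero_locus_def\<close>)
    with Q F(2) show False unfolding param_closure_eq by blast
  qed
qed

lemma irreducible_curve_param_image:
  fixes X :: "'a::field_char_0 ratpair"
  assumes "nonconstant X" "S = {Q. \<exists>t. ratpair_value X t Q}" "S = zero_locus F"
  shows "irreducible_curve S"
proof -
  have "param_closure X = S"
    unfolding param_closure_def assms(2)[symmetric] unfolding assms(3)
    by (rule zariski_closure_closed[OF zariski_closed_zero_locus])
  with irreducible_curve_param_closure[OF assms(1)] show ?thesis by simp
qed

lemma irreducible_curve_line:
  fixes u v a b :: "'a::field_char_0"
  assumes "(u, v) \<noteq> (0, 0)"
  shows "irreducible_curve {(y1, y2). u * (y1 - a) + v * (y2 - b) = 0}" (is "irreducible_curve ?S")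
proof (rule irreducible_curve_param_image)
  let ?X = "(to_fract [:a, v:], to_fract [:b, - u:])"
  have val: "ratpair_value ?X t Q \<longleftrightarrow> Q = (a + t * v, b - t * u)" for t Q
  proof -
    have "ratpair_value ?X t (a + t * v, b - t * u)"
      using ratfun_value_to_fract[of "[:a, v:]" t] ratfun_value_to_fract[of "[:b, -u:]" t]
      by (simp add: ratpair_value_def)
    then show ?thesis using ratpair_value_unique by blast
  qed
  show "nonconstant ?X"
  proof (rule nonconstantI)
    fix Q
    have "(a + 0 * v, b - 0 * u) \<noteq> (a + 1 * v, b - 1 * u)" using assms by auto
    then show "\<exists>t. \<not> ratpair_value ?X t Q" using val by metis
  qed
  show "?S = zero_locus [:[:- (u * a) - v * b, u:], [:v:]:]"
    by (auto simp: zero_locus_def algebra_simps)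
  show "?S = {Q. \<exists>t. ratpair_value ?X t Q}"
  proof (intro equalityI subsetI)
    fix Q assume "Q \<in> ?S"
    then obtain y1 y2 where Q: "Q = (y1, y2)" "u * (y1 - a) + v * (y2 - b) = 0" by auto
    have "\<exists>t. Q = (a + t * v, b - t * u)"
    proof (cases "v = 0")
      case True
      with assms Q have "u \<noteq> 0" "y1 = a" by auto
      with Q True show ?thesis by (intro exI[of _ "(b - y2) / u"]) simp
    next
      case False
      with Q(2) have "y2 - b = - (u * (y1 - a)) / v" by (simp add: field_simps add_eq_0_iff)
      with Q False show ?thesis
        by (intro exI[of _ "(y1 - a) / v"]) (simp add: field_simps)
    qed
    then show "Q \<in> {Q. \<exists>t. ratpair_value ?X t Q}" by (simp add: val)
  qed (auto simp: val algebra_simps)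
qed

lemma obtain_imaginary_unit:
  obtains i :: "'a::alg_closed_field" where "i\<^sup>2 = - 1"
  using nth_root_exists[of 2 "- 1 :: 'a"] by auto

text \<open>
  In the coordinates \<open>t = (y1 - a) + i (y2 - b)\<close> and \<open>t' = (y1 - a) - i (y2 - b)\<close> the circle is
  \<open>t t' = d\<^sup>2\<close>, so that \<open>t \<noteq> 0\<close> parametrizes all of it.
\<close>

lemma irreducible_curve_circle:
  fixes d :: "'a::{alg_closed_field, field_char_0}"
  assumes "d \<noteq> 0"
  shows "irreducible_curve {(y1, y2). (y1 - a)\<^sup>2 + (y2 - b)\<^sup>2 = d\<^sup>2}" (is "irreducible_curve ?S")
proof -
  obtain i :: 'a where i: "i\<^sup>2 = - 1" by (rule obtain_imaginary_unit)
  have i0: "i \<noteq> 0" using i by auto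
  let ?\<tau> = "to_fract [:0, 1 :: 'a:]"
  define X where "X = (const_ratfun a + (?\<tau> + const_ratfun (d\<^sup>2) / ?\<tau>) * const_ratfun (1 / 2),
                       const_ratfun b + (?\<tau> - const_ratfun (d\<^sup>2) / ?\<tau>) * const_ratfun (1 / (2 * i)))"
  define x where "x t = (a + (t + d\<^sup>2 / t) * (1 / 2), b + (t - d\<^sup>2 / t) * (1 / (2 * i)))" for t
  have val: "ratpair_value X t (x t)" if "t \<noteq> 0" for t
  proof -
    have "ratfun_value ?\<tau> t t" using ratfun_value_to_fract[of "[:0, 1:]" t] by simp
    with that show ?thesis
      unfolding ratpair_value_def X_def x_def fst_conv snd_conv
      by (intro conjI ratfun_value_add ratfun_value_diff ratfun_value_mult ratfun_value_divide ratfun_value_const)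
  qed
  have on: "x t \<in> ?S" if "t \<noteq> 0" for t
  proof -
    have "((t + d\<^sup>2 / t) * (1 / 2))\<^sup>2 + ((t - d\<^sup>2 / t) * (1 / (2 * i)))\<^sup>2 = ((t + d\<^sup>2 / t)\<^sup>2 - (t - d\<^sup>2 / t)\<^sup>2) / 4"
      by (simp add: power_mult_distrib power_divide i field_simps)
    also have "\<dots> = d\<^sup>2" using that by (simp add: power2_eq_square field_simps)
    finally show ?thesis by (simp add: x_def)
  qed
  have off: "\<exists>t. t \<noteq> 0 \<and> Q = x t" if "Q \<in> ?S" for Q
  proof -
    obtain y1 y2 where Q1: "Q = (y1, y2)" by (cases Q)
    with that have "(y1 - a)\<^sup>2 + (y2 - b)\<^sup>2 = d\<^sup>2" by simp
    note Q = Q1 this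
    define t where "t = (y1 - a) + i * (y2 - b)"
    define t' where "t' = (y1 - a) - i * (y2 - b)"
    have "t * t' = (y1 - a)\<^sup>2 - i\<^sup>2 * (y2 - b)\<^sup>2" by (simp add: t_def t'_def power2_eq_square algebra_simps)
    then have tt': "t * t' = d\<^sup>2" using Q i by simp
    then have "t \<noteq> 0" using assms by auto
    then have t': "d\<^sup>2 / t = t'" using tt' by (simp add: field_simps)
    have "t + t' = 2 * (y1 - a)" "t - t' = 2 * i * (y2 - b)"
      by (simp_all add: t_def t'_def)
    then have "Q = x t" unfolding x_def t' Q(1) using i0 by (simp add: field_simps)
    with \<open>t \<noteq> 0\<close> show ?thesis by blast
  qed
  have fl: "?S = zero_locus (normsq_poly (a, b) - [:[:d\<^sup>2:]:])"
    by (auto simp: zero_locus_def bieval.hom_minus normsq_def)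
  have "nonconstant X"
  proof (rule nonconstantI)
    fix Q
    have "x d \<noteq> x (- d)" using assms by (auto simp: x_def power2_eq_square)
    moreover have "ratpair_value X d (x d)" "ratpair_value X (- d) (x (- d))" using val assms by auto
    ultimately show "\<exists>t. \<not> ratpair_value X t Q" using ratpair_value_unique by metis
  qed
  have "param_closure X = ?S"
  proof
    have "\<forall>\<^sub>\<infinity>t. poly [:0, 1 :: 'a:] t \<noteq> 0" by (rule cofinite_poly_nonzero) simp
    then have ev: "\<forall>\<^sub>\<infinity>t. \<exists>Q. ratpair_value X t Q \<and> Q \<in> ?S"
    proof eventually_elim
      case (elim t)
      then have "t \<noteq> 0" by simp
      from val[OF this] on[OF this] show ?case by (intro exI[of _ "x t"] conjI)
    qed
    have "zariski_closed ?S" unfolding fl by (rule zariski_closed_zero_locus)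
    then show "param_closure X \<subseteq> ?S" using ev by (rule param_closure_subset)
    show "?S \<subseteq> param_closure X"
    proof
      fix Q assume "Q \<in> ?S"
      then obtain t where "t \<noteq> 0" "Q = x t" using off by blast
      with val ratpair_value_in_param_closure show "Q \<in> param_closure X" by metis
    qed
  qed
  with irreducible_curve_param_closure[OF \<open>nonconstant X\<close>] show ?thesis by simp
qed

section \<open>The conchoid\<close>

locale conchoid_base =
  fixes C :: "('a::{alg_closed_field, field_char_0} \<times> 'a) set" and A :: "'a \<times> 'a" and d :: 'a
  assumes d_nonzero: "d \<noteq> 0"
    and irreducible: "irreducible_curve C"
    and not_circle: "C \<noteq> {(y1, y2). (y1 - fst A)\<^sup>2 + (y2 - snd A)\<^sup>2 = d\<^sup>2}"
    and not_line: "\<And>u v. (u, v) \<noteq> (0, 0) \<Longrightarrow> C \<noteq> {(y1, y2). u * (y1 - fst A) + v * (y2 - snd A) = 0}"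
begin

lemma infinite_C: "infinite C"
  using irreducible infinite_zero_locus unfolding irreducible_curve_def by blast

lemma finite_line:
  assumes "(u, v) \<noteq> (0, 0)"
  shows "finite (C \<inter> {(y1, y2). u * (y1 - fst A) + v * (y2 - snd A) = 0})"
  using irreducible_curve_infinite_Int_eq[OF irreducible irreducible_curve_line[OF assms]] not_line[OF assms] by blast

text \<open>
  The squared norm splits into two linear factors, and \<open>C\<close> is neither of the two lines.
\<close>

lemma finite_isotropic: "finite {y \<in> C. normsq (y - A) = 0}"
proof -
  obtain i :: 'a where i: "i\<^sup>2 = - 1" by (rule obtain_imaginary_unit)
  have "{y \<in> C. normsq (y - A) = 0} \<subseteq>
      (C \<inter> {(y1, y2). 1 * (y1 - fst A) + i * (y2 - snd A) = 0}) \<union>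
      (C \<inter> {(y1, y2). 1 * (y1 - fst A) + (- i) * (y2 - snd A) = 0})"
  proof
    fix y assume y: "y \<in> {y \<in> C. normsq (y - A) = 0}"
    define p q where "p = fst y - fst A" and "q = snd y - snd A"
    have "(p + i * q) * (p + (- i) * q) = p\<^sup>2 - i\<^sup>2 * q\<^sup>2" by (simp add: power2_eq_square algebra_simps)
    also have "\<dots> = normsq (y - A)" by (simp add: i normsq_def p_def q_def)
    also have "\<dots> = 0" using y by simp
    finally have "1 * p + i * q = 0 \<or> 1 * p + (- i) * q = 0" by simp
    then show "y \<in> (C \<inter> {(y1, y2). 1 * (y1 - fst A) + i * (y2 - snd A) = 0}) \<union>
      (C \<inter> {(y1, y2). 1 * (y1 - fst A) + (- i) * (y2 - snd A) = 0})"
      using y unfolding p_def q_def by (auto simp: case_prod_unfold)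
  qed
  then show ?thesis
    by (rule finite_subset) (intro finite_UnI finite_line, simp_all)
qed

lemma incidence_iff:
  "(Q, y, l) \<in> conchoid_incidence C A d \<longleftrightarrow> y \<in> C \<and> (l - 1)\<^sup>2 * normsq (y - A) = d\<^sup>2 \<and> Q = dilate A l y"
proof -
  have "normsq (dilate A l y - y) = (l - 1)\<^sup>2 * normsq (y - A)"
  proof -
    have "dilate A l y - y = scale_pair (l - 1) (y - A)"
      by (simp add: prod_eq_iff scale_pair_def algebra_simps)
    then show ?thesis by (simp add: normsq_def scale_pair_def power_mult_distrib distrib_left)
  qed
  then show ?thesis unfolding conchoid_incidence_def dilate_def by auto
qed

lemma incidence_normsq:
  assumes "(Q, y, l) \<in> conchoid_incidence C A d"
  shows "y \<in> C" "normsq (y - A) \<noteq> 0" "l \<noteq> 1" "normsq (Q - A) = l\<^sup>2 * normsq (y - A)" "Q = dilate A l y"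
  using assms d_nonzero by (auto simp: incidence_iff normsq_dilate)

lemma incidenceI:
  assumes "y \<in> C" "m\<^sup>2 = normsq (y - A)" "m \<noteq> 0"
  shows "(dilate A (1 + d / m) y, y, 1 + d / m) \<in> conchoid_incidence C A d"
  using assms by (simp add: incidence_iff assms(2)[symmetric] power_divide)

lemma incidence_in_conchoid: "(Q, y, l) \<in> conchoid_incidence C A d \<Longrightarrow> Q \<in> conchoid C A d"
  unfolding conchoid_def by (rule subsetD[OF subset_zariski_closure]) force

lemma incidence_back:
  assumes inc: "(Q, y, l) \<in> conchoid_incidence C A d" and Q: "normsq (Q - A) \<noteq> 0"
  obtains n where "n\<^sup>2 = normsq (Q - A)" "n \<noteq> 0" "y = dilate A (1 + d / n) Q"
proof -
  note * = incidence_normsq[OF inc]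
  have l: "l \<noteq> 0" "l \<noteq> 1" using * Q by auto
  define n where "n = d * l / (1 - l)"
  have "n\<^sup>2 * (l - 1)\<^sup>2 = d\<^sup>2 * l\<^sup>2"
    using l by (simp add: n_def power_divide power_mult_distrib power2_commute[of 1 l])
  also have "\<dots> = normsq (Q - A) * (l - 1)\<^sup>2" using inc *(4) by (simp add: incidence_iff algebra_simps)
  finally have "n\<^sup>2 = normsq (Q - A)" using l by simp
  moreover have "n \<noteq> 0" using l d_nonzero by (simp add: n_def)
  moreover have "y = dilate A (1 + d / n) Q"
  proof -
    have "(1 + d / n) * l = 1" using l d_nonzero by (simp add: n_def field_simps)
    then show ?thesis by (simp add: *(5) dilate_dilate)
  qed
  ultimately show thesis by (rule that)
qed

lemma incidence_forward:
  assumes "n\<^sup>2 = normsq (Q - A)" "n \<noteq> 0" "n\<^sup>2 \<noteq> d\<^sup>2" "dilate A (1 + d / n) Q \<in> C"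
  shows "\<exists>l. (Q, dilate A (1 + d / n) Q, l) \<in> conchoid_incidence C A d"
proof -
  have nd: "n + d \<noteq> 0" using assms(3) by (auto simp: add_eq_0_iff)
  have "n / (n + d) - 1 = - d / (n + d)" "(1 + d / n) * n = n + d"
    using nd assms(2) by (simp_all add: field_simps)
  then have "(n / (n + d) - 1) * (1 + d / n) * n = - d" using nd by (simp add: mult.assoc)
  then have "((n / (n + d) - 1) * (1 + d / n) * n)\<^sup>2 = d\<^sup>2" by simp
  then have "(n / (n + d) - 1)\<^sup>2 * normsq (dilate A (1 + d / n) Q - A) = d\<^sup>2"
    unfolding normsq_dilate assms(1)[symmetric] by (simp only: power_mult_distrib mult.assoc)
  moreover have "Q = dilate A (n / (n + d)) (dilate A (1 + d / n) Q)"
  proof -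
    have "n / (n + d) * (1 + d / n) = 1" using nd assms(2) by (simp add: one_plus_divide)
    then show ?thesis by (simp add: dilate_dilate)
  qed
  ultimately show ?thesis using assms(4) unfolding incidence_iff by blast
qed

text \<open>
  The polynomials \<open>\<alpha>\<close> and \<open>\<beta>\<close> decide whether the point at signed distance \<open>d\<close> from \<open>Q\<close>, in the
  direction given by \<open>n\<close>, lies on \<open>C\<close>. Two kinds of points are excluded by making both
  polynomials vanish there: if \<open>N(Q) = 0\<close> there is no direction, and if \<open>N(Q) = d\<^sup>2\<close> the choice
  \<open>n = -d\<close> leads to \<open>A\<close>, which may be on \<open>C\<close> but is not incident with any point.
\<close>

definition shift_test :: "'a bipoly \<Rightarrow> 'a bipoly \<Rightarrow> bool" where
  "shift_test \<alpha> \<beta> \<longleftrightarrow>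
     (\<forall>Q n. n\<^sup>2 = normsq (Q - A) \<longrightarrow> n \<noteq> 0 \<longrightarrow> n\<^sup>2 \<noteq> d\<^sup>2 \<longrightarrow>
        (bieval \<alpha> Q + bieval \<beta> Q * n = 0 \<longleftrightarrow> dilate A (1 + d / n) Q \<in> C)) \<and>
     (\<forall>Q. normsq (Q - A) = 0 \<or> normsq (Q - A) = d\<^sup>2 \<longrightarrow> bieval \<alpha> Q = 0 \<and> bieval \<beta> Q = 0)"

lemma shift_test_exists: "\<exists>\<alpha> \<beta>. shift_test \<alpha> \<beta>"
proof -
  obtain f where f: "C = zero_locus f" using irreducible unfolding irreducible_curve_def by blast
  obtain k \<alpha> \<beta> where *: "\<And>Q n. n\<^sup>2 = normsq (Q - A) \<Longrightarrow> n \<noteq> 0 \<Longrightarrow>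
     n ^ (2 * k) * bieval f (dilate A (1 + d / n) Q) = bieval \<alpha> Q + bieval \<beta> Q * n"
    using conj_form_dilate[of A f d] unfolding conj_form_def by blast
  define \<gamma> where "\<gamma> = normsq_poly A * (normsq_poly A - [:[:d\<^sup>2:]:])"
  have \<gamma>: "bieval \<gamma> Q = normsq (Q - A) * (normsq (Q - A) - d\<^sup>2)" for Q
    by (simp add: \<gamma>_def bieval.hom_mult bieval.hom_minus)
  have "bieval (\<gamma> * \<alpha>) Q + bieval (\<gamma> * \<beta>) Q * n = 0 \<longleftrightarrow> dilate A (1 + d / n) Q \<in> C"
    if n: "n\<^sup>2 = normsq (Q - A)" "n \<noteq> 0" "n\<^sup>2 \<noteq> d\<^sup>2" for Q n
  proof -
    have "bieval (\<gamma> * \<alpha>) Q + bieval (\<gamma> * \<beta>) Q * n =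
        bieval \<gamma> Q * (n ^ (2 * k) * bieval f (dilate A (1 + d / n) Q))"
      unfolding *[OF n(1,2)] by (simp add: bieval.hom_mult algebra_simps)
    moreover have "bieval \<gamma> Q \<noteq> 0" using n unfolding \<gamma> n(1)[symmetric] by simp
    ultimately show ?thesis using n(2) by (simp add: f zero_locus_def)
  qed
  moreover have "bieval (\<gamma> * \<alpha>) Q = 0 \<and> bieval (\<gamma> * \<beta>) Q = 0"
    if "normsq (Q - A) = 0 \<or> normsq (Q - A) = d\<^sup>2" for Q
    using that by (auto simp: bieval.hom_mult \<gamma>)
  ultimately have "shift_test (\<gamma> * \<alpha>) (\<gamma> * \<beta>)" unfolding shift_test_def by blast
  then show ?thesis by blast
qed

lemma shift_testD:
  assumes "shift_test \<alpha> \<beta>"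
  shows "n\<^sup>2 = normsq (Q - A) \<Longrightarrow> n \<noteq> 0 \<Longrightarrow> n\<^sup>2 \<noteq> d\<^sup>2 \<Longrightarrow>
      bieval \<alpha> Q + bieval \<beta> Q * n = 0 \<longleftrightarrow> dilate A (1 + d / n) Q \<in> C"
    "normsq (Q - A) = 0 \<or> normsq (Q - A) = d\<^sup>2 \<Longrightarrow> bieval \<alpha> Q = 0"
    "normsq (Q - A) = 0 \<or> normsq (Q - A) = d\<^sup>2 \<Longrightarrow> bieval \<beta> Q = 0"
  using assms unfolding shift_test_def by blast+

text \<open>
  The left hand side minus the right hand side is the product of \<open>\<alpha>(Q) + \<beta>(Q) n\<close> over the two square
  roots \<open>n\<close> of \<open>N(Q)\<close>; one of the factors is zero if \<open>Q\<close> is incident with a point of \<open>C\<close>.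
\<close>

lemma conchoid_norm_equation:
  assumes "shift_test \<alpha> \<beta>" "Q \<in> conchoid C A d"
  shows "(bieval \<alpha> Q)\<^sup>2 = normsq (Q - A) * (bieval \<beta> Q)\<^sup>2"
proof -
  let ?F = "\<alpha>\<^sup>2 - normsq_poly A * \<beta>\<^sup>2"
  have "(\<lambda>(x, y, l). x) ` conchoid_incidence C A d \<subseteq> zero_locus ?F"
  proof (clarify)
    fix a b y1 y2 l assume inc: "((a, b), (y1, y2), l) \<in> conchoid_incidence C A d"
    define Q where "Q = (a, b)"
    have "(bieval \<alpha> Q)\<^sup>2 = normsq (Q - A) * (bieval \<beta> Q)\<^sup>2"
    proof (cases "normsq (Q - A) = 0 \<or> normsq (Q - A) = d\<^sup>2")
      case True
      then show ?thesis using shift_testD(2,3)[OF assms(1), of Q] by auto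
    next
      case False
      then obtain n where n: "n\<^sup>2 = normsq (Q - A)" "n \<noteq> 0" "(y1, y2) = dilate A (1 + d / n) Q"
        using incidence_back[OF inc[folded Q_def]] by blast
      then have "bieval \<alpha> Q + bieval \<beta> Q * n = 0"
        using shift_testD(1)[OF assms(1) n(1,2)] incidence_normsq(1)[OF inc] False by metis
      then have "bieval \<alpha> Q = - (bieval \<beta> Q * n)" by (simp add: add_eq_0_iff2)
      then show ?thesis by (simp add: power_mult_distrib n(1)[symmetric])
    qed
    then show "(a, b) \<in> zero_locus ?F"
      by (simp add: zero_locus_def Q_def bieval.hom_minus bieval.hom_mult bieval.hom_power)
  qed
  then have "conchoid C A d \<subseteq> zero_locus ?F"
    unfolding conchoid_def by (rule zariski_closure_minimal) (rule zariski_closed_zero_locus)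
  with assms(2) show ?thesis
    by (auto simp: zero_locus_def bieval.hom_minus bieval.hom_mult bieval.hom_power)
qed

text \<open>
  If \<open>\<alpha>\<close> and \<open>\<beta>\<close> vanish on the whole conchoid, start from \<open>y \<in> C\<close> with \<open>m\<^sup>2 = N(y)\<close> and go to the
  point \<open>A + (1 + d/m) (y - A)\<close> of the conchoid. Both points at distance \<open>d\<close> from it are on \<open>C\<close>, one
  of them being \<open>y\<close> and the other one \<open>A + (1 + 2d/m) (y - A)\<close>. Repeating this yields infinitely
  many points of \<open>C\<close> on the line through \<open>A\<close> and \<open>y\<close>.
\<close>

lemma exists_component_not_degenerate:
  assumes test: "shift_test \<alpha> \<beta>"
  obtains M where "M \<in> irreducible_components (conchoid C A d)" "\<not> (M \<subseteq> zero_locus \<alpha> \<and> M \<subseteq> zero_locus \<beta>)"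
proof (rule ccontr)
  assume "\<not> thesis"
  with that have all: "M \<subseteq> zero_locus \<alpha> \<and> M \<subseteq> zero_locus \<beta>" if "M \<in> irreducible_components (conchoid C A d)" for M
    using \<open>M \<in> _\<close> by blast
  have vanish: "bieval \<alpha> Q = 0 \<and> bieval \<beta> Q = 0" if "Q \<in> conchoid C A d" for Q
  proof -
    have "zariski_closed (conchoid C A d)" by (simp add: conchoid_def)
    from in_irreducible_component[OF this that] obtain M where
      "M \<in> irreducible_components (conchoid C A d)" "Q \<in> M" by blast
    with all show ?thesis by (auto simp: zero_locus_def)
  qed
  have step: "dilate A (1 + 2 * d / m) y \<in> C"
    if y: "y \<in> C" "m\<^sup>2 = normsq (y - A)" "m \<noteq> 0" and m: "m + d \<noteq> 0" "m + 2 * d \<noteq> 0" for y m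
  proof -
    define Q where "Q = dilate A (1 + d / m) y"
    have "Q \<in> conchoid C A d" unfolding Q_def by (rule incidence_in_conchoid[OF incidenceI[OF y]])
    with vanish have v: "bieval \<alpha> Q + bieval \<beta> Q * (m + d) = 0" by simp
    have "((1 + d / m) * m)\<^sup>2 = normsq (Q - A)"
      unfolding Q_def normsq_dilate y(2)[symmetric] by (simp add: power_mult_distrib)
    moreover have "(1 + d / m) * m = m + d" using y(3) by (simp add: field_simps)
    ultimately have n: "(m + d)\<^sup>2 = normsq (Q - A)" by simp
    have "(m + d)\<^sup>2 - d\<^sup>2 = m * (m + 2 * d)" by (simp add: power2_eq_square algebra_simps)
    then have "(m + d)\<^sup>2 \<noteq> d\<^sup>2" using y(3) m(2) by auto
    with v shift_testD(1)[OF test n m(1)] have "dilate A (1 + d / (m + d)) Q \<in> C" by simp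
    moreover have "(1 + d / (m + d)) * (1 + d / m) = 1 + 2 * d / m"
      using y(3) m(1) by (simp add: one_plus_divide add.assoc)
    ultimately show ?thesis by (simp add: Q_def dilate_dilate)
  qed
  have "infinite (C - {y \<in> C. normsq (y - A) = 0})"
    using infinite_C finite_isotropic by (rule Diff_infinite_finite[rotated])
  then have "C - {y \<in> C. normsq (y - A) = 0} \<noteq> {}" by (rule infinite_imp_nonempty)
  then obtain y where y: "y \<in> C" "normsq (y - A) \<noteq> 0" by auto
  obtain m0 where m0: "m0\<^sup>2 = normsq (y - A)" using nth_root_exists[of 2 "normsq (y - A)"] by auto
  have m0_ne: "m0 \<noteq> 0" using m0 y(2) by auto
  \<comment> \<open>The walk breaks down if it meets \<open>A\<close> or a point of the conchoid at squared norm \<open>0\<close> or \<open>d\<^sup>2\<close>, that is,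
    if \<open>m\<close> is \<open>-j d\<close> for a natural number \<open>j\<close>. This cannot happen for both square roots \<open>m\<close> and \<open>-m\<close>.\<close>
  obtain m where m: "m\<^sup>2 = normsq (y - A)" "m \<noteq> 0" "\<And>j :: nat. m + of_nat j * d \<noteq> 0"
  proof (cases "\<exists>j :: nat. m0 + of_nat j * d = 0")
    case False
    then show thesis using that[of m0] m0 m0_ne by blast
  next
    case True
    then obtain j :: nat where j: "m0 = - (of_nat j * d)" by (auto simp: add_eq_0_iff2)
    have "- m0 + of_nat j' * d \<noteq> 0" for j' :: nat
    proof
      assume "- m0 + of_nat j' * d = 0"
      with j have "of_nat (j + j') * d = 0" by (simp add: algebra_simps)
      with d_nonzero have "j + j' = 0" by (metis mult_eq_0_iff of_nat_eq_0_iff)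
      with j m0_ne show False by simp
    qed
    then show thesis using that[of "- m0"] m0 m0_ne by simp
  qed
  have iter: "dilate A (1 + 2 * of_nat k * d / m) y \<in> C" for k :: nat
  proof (induction k)
    case 0
    show ?case using y by simp
  next
    case (Suc k)
    define m' where "m' = m + of_nat (2 * k) * d"
    define y' where "y' = dilate A (1 + 2 * of_nat k * d / m) y"
    have e: "(1 + 2 * of_nat k * d / m) * m = m'" using m(2) by (simp add: m'_def field_simps)
    have "m'\<^sup>2 = normsq (y' - A)"
      unfolding y'_def normsq_dilate m(1)[symmetric] e[symmetric] by (simp add: power_mult_distrib)
    moreover have "m' \<noteq> 0" unfolding m'_def by (rule m(3))
    moreover have "m' + d \<noteq> 0" using m(3)[of "2 * k + 1"] by (simp add: m'_def algebra_simps)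
    moreover have "m' + 2 * d \<noteq> 0" using m(3)[of "2 * k + 2"] by (simp add: m'_def algebra_simps)
    moreover have "y' \<in> C" using Suc.IH by (simp add: y'_def)
    ultimately have "dilate A (1 + 2 * d / m') y' \<in> C" using step by blast
    moreover have "(1 + 2 * d / m') * (1 + 2 * of_nat k * d / m) = 1 + 2 * of_nat (Suc k) * d / m"
    proof -
      have "1 + 2 * of_nat k * d / m = m' / m" by (simp add: one_plus_divide[OF m(2)] m'_def)
      then have "(1 + 2 * d / m') * (1 + 2 * of_nat k * d / m) = (m' + 2 * d) / m"
        using \<open>m' \<noteq> 0\<close> m(2) by (simp add: one_plus_divide)
      also have "\<dots> = 1 + 2 * of_nat (Suc k) * d / m" using m(2) by (simp add: m'_def field_simps)
      finally show ?thesis .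
    qed
    ultimately show ?case unfolding y'_def dilate_dilate by simp
  qed
  have "y \<noteq> A" using y(2) by auto
  define p q where "p = snd y - snd A" and "q = - (fst y - fst A)"
  have pq: "(p, q) \<noteq> (0, 0)" using \<open>y \<noteq> A\<close> by (auto simp: p_def q_def prod_eq_iff)
  have on_line: "p * (fst (dilate A c y) - fst A) + q * (snd (dilate A c y) - snd A) = 0" for c
    by (simp add: p_def q_def algebra_simps)
  have "range (\<lambda>k :: nat. dilate A (1 + 2 * of_nat k * d / m) y) \<subseteq>
      C \<inter> {(y1, y2). p * (y1 - fst A) + q * (y2 - snd A) = 0}"
    using iter on_line by (auto simp only: case_prod_unfold Int_iff mem_Collect_eq)
  then have "finite (range (\<lambda>k :: nat. dilate A (1 + 2 * of_nat k * d / m) y))"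
    using finite_line[OF pq] by (rule finite_subset)
  moreover have "inj (\<lambda>k :: nat. dilate A (1 + 2 * of_nat k * d / m) y)"
    using \<open>y \<noteq> A\<close> d_nonzero m(2) by (auto simp: inj_on_def dilate_eq_iff)
  ultimately show False using finite_imageD infinite_UNIV_nat by blast
qed

text \<open>
  Where \<open>\<alpha>\<close> and \<open>\<beta>\<close> are not both zero, the norm equation singles out one square root \<open>n\<close> with
  \<open>\<alpha>(Q) + \<beta>(Q) n = 0\<close>, so exactly one point of \<open>C\<close> is incident with \<open>Q\<close>. Such \<open>Q\<close> are dense.
\<close>

lemma simple_component_not_degenerate:
  assumes test: "shift_test \<alpha> \<beta>" and M: "M \<in> irreducible_components (conchoid C A d)"
    and nd: "\<not> (M \<subseteq> zero_locus \<alpha> \<and> M \<subseteq> zero_locus \<beta>)"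
  shows "simple_component C A d M"
proof -
  from M have M': "zariski_closed M" "zariski_irreducible M" "M \<subseteq> conchoid C A d"
    unfolding irreducible_components_def by auto
  obtain F where F: "F = \<alpha> \<or> F = \<beta>" "\<not> M \<subseteq> zero_locus F" using nd by blast
  define \<Omega> where "\<Omega> = {Q \<in> M. bieval F Q \<noteq> 0}"
  have dense: "zariski_closure \<Omega> = M" unfolding \<Omega>_def by (rule zariski_dense_nonvanishing[OF M'(1,2) F(2)])
  have nonempty: "\<Omega> \<noteq> {}" using F(2) by (auto simp: \<Omega>_def zero_locus_def)
  have unique: "\<exists>!y. \<exists>l. (Q, y, l) \<in> conchoid_incidence C A d" if "Q \<in> \<Omega>" for Q
  proof -
    have Q: "Q \<in> M" and ne: "\<not> (bieval \<alpha> Q = 0 \<and> bieval \<beta> Q = 0)" using that F(1) by (auto simp: \<Omega>_def)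
    have N: "normsq (Q - A) \<noteq> 0" "normsq (Q - A) \<noteq> d\<^sup>2"
      using ne shift_testD(2,3)[OF test, of Q] by auto
    obtain n0 where n0: "n0\<^sup>2 = normsq (Q - A)" using nth_root_exists[of 2 "normsq (Q - A)"] by auto
    have "(bieval \<alpha> Q)\<^sup>2 = n0\<^sup>2 * (bieval \<beta> Q)\<^sup>2"
      using conchoid_norm_equation[OF test subsetD[OF M'(3) Q]] n0 by simp
    then have "(bieval \<alpha> Q + bieval \<beta> Q * n0) * (bieval \<alpha> Q + bieval \<beta> Q * (- n0)) = 0"
      by (simp add: power2_eq_square algebra_simps)
    then obtain n where n: "n\<^sup>2 = normsq (Q - A)" "bieval \<alpha> Q + bieval \<beta> Q * n = 0"
      using n0 by (metis mult_eq_0_iff power2_minus)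
    have n_ne: "n \<noteq> 0" "n\<^sup>2 \<noteq> d\<^sup>2" using n(1) N by auto
    have other: "bieval \<alpha> Q + bieval \<beta> Q * (- n) \<noteq> 0"
    proof
      assume *: "bieval \<alpha> Q + bieval \<beta> Q * (- n) = 0"
      with n(2) have "2 * bieval \<alpha> Q = 0" by (simp add: algebra_simps)
      then have "bieval \<alpha> Q = 0" by simp
      with n(2) n_ne(1) ne show False by simp
    qed
    have "dilate A (1 + d / n) Q \<in> C" using shift_testD(1)[OF test n(1) n_ne] n(2) by simp
    then have ex: "\<exists>l. (Q, dilate A (1 + d / n) Q, l) \<in> conchoid_incidence C A d"
      by (rule incidence_forward[OF n(1) n_ne])
    moreover have "y = dilate A (1 + d / n) Q" if inc: "(Q, y, l) \<in> conchoid_incidence C A d" for y l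
    proof -
      obtain n' where n': "n'\<^sup>2 = normsq (Q - A)" "n' \<noteq> 0" "y = dilate A (1 + d / n') Q"
        using incidence_back[OF inc N(1)] by blast
      have "bieval \<alpha> Q + bieval \<beta> Q * n' = 0"
        using shift_testD(1)[OF test n'(1,2)] n' N incidence_normsq(1)[OF inc] by metis
      moreover have "n' = n \<or> n' = - n" using n(1) n'(1) by (metis power2_eq_iff)
      ultimately show ?thesis using n'(3) other by auto
    qed
    ultimately show ?thesis by blast
  qed
  have "\<Omega> \<subseteq> M" by (auto simp: \<Omega>_def)
  then show ?thesis
    unfolding simple_component_def by (intro conjI M exI[of _ \<Omega>] nonempty dense ballI unique)
qed

lemma exists_simple_component: "\<exists>M. simple_component C A d M"
proof -
  obtain \<alpha> \<beta> where "shift_test \<alpha> \<beta>" using shift_test_exists by blast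
  from exists_component_not_degenerate[OF this] obtain M where
    "M \<in> irreducible_components (conchoid C A d)" "\<not> (M \<subseteq> zero_locus \<alpha> \<and> M \<subseteq> zero_locus \<beta>)" .
  from simple_component_not_degenerate[OF \<open>shift_test \<alpha> \<beta>\<close> this] show ?thesis ..
qed

text \<open>
  Moving a point by \<open>d\<close> towards or away from \<open>A\<close> is finite-to-one: the image \<open>Q\<close> determines \<open>m + d\<close>
  up to sign, as its square is \<open>N(Q)\<close>, and then the original point \<open>A + m/(m + d) (Q - A)\<close>.
\<close>

lemma shift_not_constant:
  fixes Q :: "'a \<times> 'a" and X :: "'a ratpair"
  assumes X: "nonconstant X"
    and ev: "\<forall>\<^sub>\<infinity>t. \<exists>y m. ratpair_value X t y \<and> m\<^sup>2 = normsq (y - A) \<and> m \<noteq> 0 \<and> m + d \<noteq> 0 \<and> dilate A (1 + d / m) y = Q"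
  shows False
proof -
  obtain c where c: "c\<^sup>2 = normsq (Q - A)" using nth_root_exists[of 2 "normsq (Q - A)"] by auto
  define S where "S = (\<lambda>m. dilate A (m / (m + d)) Q) ` {c - d, - c - d}"
  have "finite S" by (simp add: S_def)
  from cofinite_ex[OF eventually_conj[OF ev cofinite_ratpair_avoids[OF X this]]]
  obtain t y y' m where *: "ratpair_value X t y" "m\<^sup>2 = normsq (y - A)" "m \<noteq> 0" "m + d \<noteq> 0"
    "dilate A (1 + d / m) y = Q" "ratpair_value X t y'" "y' \<notin> S" by blast
  have "((1 + d / m) * m)\<^sup>2 = normsq (Q - A)"
    unfolding *(5)[symmetric] normsq_dilate *(2)[symmetric] by (simp add: power_mult_distrib)
  moreover have "(1 + d / m) * m = m + d" using *(3) by (simp add: field_simps)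
  ultimately have "(m + d)\<^sup>2 = c\<^sup>2" using c by simp
  then have "m + d = c \<or> m + d = - c" by (simp add: power2_eq_iff)
  then have "m \<in> {c - d, - c - d}" by (auto simp: algebra_simps)
  moreover have "y = dilate A (m / (m + d)) Q"
  proof -
    have "m / (m + d) * (1 + d / m) = 1" using *(3,4) by (simp add: one_plus_divide)
    then show ?thesis by (simp add: *(5)[symmetric] dilate_dilate)
  qed
  ultimately have "y \<in> S" unfolding S_def by blast
  moreover have "y = y'" using *(1,6) by (rule ratpair_value_unique)
  ultimately show False using *(7) by simp
qed

text \<open>
  Substituting \<open>X\<close> into the norm equation shows that \<open>N(X)\<close> is the square of \<open>\<eta> = -\<alpha>(X)/\<beta>(X)\<close>.
  With this square root the shifted pair lies on \<open>C\<close>, and its squared norm is \<open>(\<eta> + d)\<^sup>2\<close>.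
\<close>

lemma rdf_of_not_degenerate:
  assumes test: "shift_test \<alpha> \<beta>" and M: "M \<subseteq> conchoid C A d" "parametrization X M"
    and nd: "\<not> (M \<subseteq> zero_locus \<alpha> \<and> M \<subseteq> zero_locus \<beta>)"
  shows "\<exists>P. rdf_parametrization A P C"
proof -
  have X: "nonconstant X" "param_closure X = M" using M(2) by (simp_all add: parametrization_iff)
  have sub: "M \<subseteq> zero_locus F \<longleftrightarrow> bieval_ratpair F X = 0" for F
    using param_closure_subset_zero_locus[of X F] X(2) by simp
  define \<nu> where "\<nu> = ratnormsq A X"
  define a b where "a = bieval_ratpair \<alpha> X" and "b = bieval_ratpair \<beta> X"
  have "M \<subseteq> zero_locus (\<alpha>\<^sup>2 - normsq_poly A * \<beta>\<^sup>2)"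
  proof
    fix Q assume "Q \<in> M"
    with M(1) conchoid_norm_equation[OF test, of Q] show "Q \<in> zero_locus (\<alpha>\<^sup>2 - normsq_poly A * \<beta>\<^sup>2)"
      by (auto simp: zero_locus_def bieval.hom_minus bieval.hom_mult bieval.hom_power)
  qed
  then have ab: "a\<^sup>2 = \<nu> * b\<^sup>2"
    unfolding sub a_def b_def \<nu>_def
    by (simp add: bieval_ratpair.hom_minus bieval_ratpair.hom_mult bieval_ratpair.hom_power bieval_ratpair_normsq_poly)
  have "\<not> (a = 0 \<and> b = 0)" using nd unfolding sub a_def b_def .
  with ab have b: "b \<noteq> 0" by auto
  have degenerate: "M \<subseteq> zero_locus \<alpha> \<and> M \<subseteq> zero_locus \<beta>"
    if "\<And>Q. Q \<in> M \<Longrightarrow> normsq (Q - A) = 0 \<or> normsq (Q - A) = d\<^sup>2"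
    using that shift_testD(2,3)[OF test] unfolding zero_locus_def by blast
  have \<nu>0: "\<nu> \<noteq> 0"
  proof
    assume "\<nu> = 0"
    then have "M \<subseteq> zero_locus (normsq_poly A)" unfolding sub by (simp add: \<nu>_def bieval_ratpair_normsq_poly)
    with degenerate nd show False by (auto simp: zero_locus_def)
  qed
  have \<nu>d: "\<nu> - const_ratfun (d\<^sup>2) \<noteq> 0"
  proof
    assume "\<nu> - const_ratfun (d\<^sup>2) = 0"
    then have "M \<subseteq> zero_locus (normsq_poly A - [:[:d\<^sup>2:]:])"
      unfolding sub by (simp add: \<nu>_def bieval_ratpair.hom_minus bieval_ratpair_normsq_poly)
    with degenerate nd show False by (auto simp: zero_locus_def bieval.hom_minus)
  qed
  define \<eta> where "\<eta> = - a / b"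
  have \<eta>2: "\<eta>\<^sup>2 = \<nu>" using ab b by (simp add: \<eta>_def power_divide)
  then have \<eta>0: "\<eta> \<noteq> 0" using \<nu>0 by auto
  define Y where "Y = ratdilate A (1 + const_ratfun d / \<eta>) X"
  have vals: "\<forall>\<^sub>\<infinity>t. \<exists>Q n. ratpair_value X t Q \<and> ratpair_value Y t (dilate A (1 + d / n) Q) \<and>
      n\<^sup>2 = normsq (Q - A) \<and> n \<noteq> 0 \<and> n\<^sup>2 \<noteq> d\<^sup>2 \<and> dilate A (1 + d / n) Q \<in> C"
    using cofinite_ratpair_value[of X] cofinite_ratfun_nonzero[OF \<eta>0] cofinite_ratfun_nonzero[OF \<nu>d]
  proof eventually_elim
    case (elim t)
    then obtain Q n e where Q: "ratpair_value X t Q" and n: "ratfun_value \<eta> t n" "n \<noteq> 0"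
      and e: "ratfun_value (\<nu> - const_ratfun (d\<^sup>2)) t e" "e \<noteq> 0" by blast
    have \<nu>Q: "ratfun_value \<nu> t (normsq (Q - A))" unfolding \<nu>_def by (rule ratfun_value_ratnormsq[OF Q])
    have n2: "n\<^sup>2 = normsq (Q - A)"
      using ratfun_value_power[OF n(1), of 2] \<nu>Q unfolding \<eta>2 by (rule ratfun_value_unique)
    have "e = n\<^sup>2 - d\<^sup>2"
      using e(1) ratfun_value_diff[OF \<nu>Q ratfun_value_const[of "d\<^sup>2" t]] unfolding n2 by (rule ratfun_value_unique)
    with e(2) have nd: "n\<^sup>2 \<noteq> d\<^sup>2" by auto
    have "ratfun_value (a + b * \<eta>) t (bieval \<alpha> Q + bieval \<beta> Q * n)"
      unfolding a_def b_def by (intro ratfun_value_add ratfun_value_mult ratfun_value_bieval_ratpair Q n)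
    moreover have "a + b * \<eta> = 0" using b by (simp add: \<eta>_def)
    ultimately have "bieval \<alpha> Q + bieval \<beta> Q * n = 0" by (simp add: ratfun_value_0)
    then have "dilate A (1 + d / n) Q \<in> C" using shift_testD(1)[OF test n2 n(2) nd] by simp
    moreover have "ratpair_value Y t (dilate A (1 + d / n) Q)"
      unfolding Y_def
      using ratfun_value_add[OF ratfun_value_const[of 1 t] ratfun_value_divide[OF ratfun_value_const[of d t] n]]
      by (intro ratpair_value_ratdilate Q) (simp add: const_ratfun_simps)
    ultimately show ?case using Q n2 n(2) nd by blast
  qed
  have "nonconstant Y"
  proof (rule nonconstantI)
    fix Q0
    show "\<exists>t. \<not> ratpair_value Y t Q0"
    proof (rule ccontr)
      assume "\<not> ?thesis"
      then have Y: "ratpair_value Y t Q0" for t by blast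
      show False
      proof (rule shift_not_constant[OF X(1)])
        show "\<forall>\<^sub>\<infinity>t. \<exists>y m. ratpair_value X t y \<and> m\<^sup>2 = normsq (y - A) \<and> m \<noteq> 0 \<and> m + d \<noteq> 0 \<and>
            dilate A (1 + d / m) y = Q0"
          using vals
        proof eventually_elim
          case (elim t)
          then obtain Q n where *: "ratpair_value X t Q" "ratpair_value Y t (dilate A (1 + d / n) Q)"
            "n\<^sup>2 = normsq (Q - A)" "n \<noteq> 0" "n\<^sup>2 \<noteq> d\<^sup>2" by blast
          have "n + d \<noteq> 0" using *(5) by (auto simp: add_eq_0_iff2)
          moreover have "dilate A (1 + d / n) Q = Q0" using *(2) Y by (rule ratpair_value_unique)
          ultimately show ?case using * by blast
        qed
      qed
    qed
  qed
  moreover have "\<forall>\<^sub>\<infinity>t. \<exists>Q. ratpair_value Y t Q \<and> Q \<in> C"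
    using vals by eventually_elim blast
  ultimately have "parametrization Y C" by (rule parametrizationI[OF irreducible])
  moreover have "ratnormsq A Y = (\<eta> + const_ratfun d)\<^sup>2"
  proof -
    have "ratnormsq A Y = ((1 + const_ratfun d / \<eta>) * \<eta>)\<^sup>2"
      unfolding Y_def ratnormsq_ratdilate \<nu>_def[symmetric] \<eta>2[symmetric] by (simp add: power_mult_distrib)
    also have "(1 + const_ratfun d / \<eta>) * \<eta> = \<eta> + const_ratfun d" using \<eta>0 by (simp add: field_simps)
    finally show ?thesis .
  qed
  ultimately show ?thesis unfolding rdf_parametrization_def ratnormsq_def by blast
qed

text \<open>
  Only a degenerate \<open>M\<close> is left to consider. At a point with \<open>N(Q) \<noteq> 0, d\<^sup>2\<close> both shifted points would
  be on \<open>C\<close> and incident with \<open>Q\<close>, against uniqueness, and \<open>A\<close> is the only incident point with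
  \<open>N(Q) = 0\<close>. Hence \<open>M\<close> is contained in the circle of
  radius \<open>d\<close> about \<open>A\<close>, where the point incident with \<open>Q\<close> is \<open>A + 2 (Q - A)\<close>, of constant squared
  norm \<open>4 d\<^sup>2\<close>.
\<close>

lemma rdf_of_rational_simple_component:
  assumes simple: "simple_component C A d M" and rat: "rational_curve M"
  shows "\<exists>P. rdf_parametrization A P C"
proof -
  obtain \<alpha> \<beta> where test: "shift_test \<alpha> \<beta>" using shift_test_exists by blast
  from simple have M: "M \<in> irreducible_components (conchoid C A d)" unfolding simple_component_def by blast
  then have M': "zariski_closed M" "zariski_irreducible M" "M \<subseteq> conchoid C A d"
    unfolding irreducible_components_def by auto
  from rat obtain X where "parametrization X M" unfolding rational_curve_def by blast
  then have X: "nonconstant X" "param_closure X = M" by (simp_all add: parametrization_iff)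
  show ?thesis
  proof (cases "M \<subseteq> zero_locus \<alpha> \<and> M \<subseteq> zero_locus \<beta>")
    case False
    with rdf_of_not_degenerate[OF test M'(3) \<open>parametrization X M\<close>] show ?thesis by blast
  next
    case True
    from simple obtain \<Omega> where \<Omega>12: "\<Omega> \<subseteq> M" "zariski_closure \<Omega> = M"
      and "\<forall>Q\<in>\<Omega>. \<exists>!y. \<exists>l. (Q, y, l) \<in> conchoid_incidence C A d"
      unfolding simple_component_def by auto
    then have \<Omega>3: "\<exists>!y. \<exists>l. (Q, y, l) \<in> conchoid_incidence C A d" if "Q \<in> \<Omega>" for Q
      using that by simp
    note \<Omega> = \<Omega>12 \<Omega>3
    have \<Omega>_cases: "Q = A \<or> normsq (Q - A) = d\<^sup>2" if Q: "Q \<in> \<Omega>" for Q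
    proof (rule ccontr)
      assume "\<not> ?thesis"
      then have QA: "Q \<noteq> A" and N: "normsq (Q - A) \<noteq> d\<^sup>2" by auto
      from \<Omega>(3)[OF Q] obtain y l where inc: "(Q, y, l) \<in> conchoid_incidence C A d" by blast
      note * = incidence_normsq[OF inc]
      have "l \<noteq> 0" using QA *(5) by auto
      with * have N0: "normsq (Q - A) \<noteq> 0" by simp
      obtain n where n: "n\<^sup>2 = normsq (Q - A)" using nth_root_exists[of 2 "normsq (Q - A)"] by auto
      have v: "bieval \<alpha> Q = 0" "bieval \<beta> Q = 0" using True Q \<Omega>(1) by (auto simp: zero_locus_def)
      have both: "\<exists>l. (Q, dilate A (1 + d / n') Q, l) \<in> conchoid_incidence C A d" if "n' = n \<or> n' = - n" for n'
      proof -
        have n': "n'\<^sup>2 = normsq (Q - A)" "n' \<noteq> 0" "n'\<^sup>2 \<noteq> d\<^sup>2" using that n N N0 by auto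
        have "dilate A (1 + d / n') Q \<in> C" using shift_testD(1)[OF test n'] v by simp
        then show ?thesis by (rule incidence_forward[OF n'])
      qed
      from both[of n] both[of "- n"] \<Omega>(3)[OF Q] have "dilate A (1 + d / n) Q = dilate A (1 + d / - n) Q" by blast
      with QA have "1 + d / n = 1 + d / - n" by (simp add: dilate_eq_iff del: divide_minus_right)
      then have "2 * (d / n) = 0" by simp
      moreover have "n \<noteq> 0" using n N0 by auto
      ultimately show False using d_nonzero by simp
    qed
    have closedA: "zariski_closed {A}"
      unfolding zariski_closed_def
      by (rule exI[of _ "{[:[:- fst A, 1:]:], [:[:- snd A:], 1:]}"]) (auto simp: prod_eq_iff)
    define circ where "circ = normsq_poly A - [:[:d\<^sup>2:]:]"
    have circ: "Q \<in> zero_locus circ \<longleftrightarrow> normsq (Q - A) = d\<^sup>2" for Q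
      by (simp add: zero_locus_def circ_def bieval.hom_minus)
    have "\<Omega> \<subseteq> {A} \<union> zero_locus circ" using \<Omega>_cases circ by blast
    then have "M \<subseteq> {A} \<union> zero_locus circ"
      unfolding \<Omega>(2)[symmetric] by (rule zariski_closure_minimal) (intro zariski_closed_Un closedA zariski_closed_zero_locus)
    then have "M \<subseteq> {A} \<or> M \<subseteq> zero_locus circ"
      using M'(2) closedA zariski_closed_zero_locus[of circ] unfolding zariski_irreducible_def by blast
    moreover have "\<not> M \<subseteq> {A}"
    proof
      assume "M \<subseteq> {A}"
      from cofinite_ex[OF cofinite_ratpair_avoids[OF X(1), of "{A}"]]
      obtain t Q where "ratpair_value X t Q" "Q \<noteq> A" by auto
      with ratpair_value_in_param_closure X(2) \<open>M \<subseteq> {A}\<close> show False by blast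
    qed
    ultimately have M_circ: "M \<subseteq> zero_locus circ" by blast
    have double: "dilate A 2 Q \<in> C" if Q: "Q \<in> \<Omega>" for Q
    proof -
      have N: "normsq (Q - A) = d\<^sup>2" using Q \<Omega>(1) M_circ circ by blast
      from \<Omega>(3)[OF Q] obtain y l where inc: "(Q, y, l) \<in> conchoid_incidence C A d" by blast
      obtain n where n: "n\<^sup>2 = normsq (Q - A)" "n \<noteq> 0" "y = dilate A (1 + d / n) Q"
        by (rule incidence_back[OF inc]) (use N d_nonzero in auto)
      have "n \<noteq> - d"
      proof
        assume "n = - d"
        then have "y = A" using n(3) d_nonzero by simp
        with incidence_normsq(2)[OF inc] show False by simp
      qed
      moreover have "n = d \<or> n = - d" using n(1) N by (simp add: power2_eq_iff)
      ultimately have "n = d" by blast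
      with n(3) d_nonzero have "y = dilate A 2 Q" by simp
      with incidence_normsq(1)[OF inc] show ?thesis by simp
    qed
    obtain f where f: "C = zero_locus f" using irreducible unfolding irreducible_curve_def by blast
    obtain k \<alpha>' \<beta>' where *: "\<And>Q n. n\<^sup>2 = normsq (Q - A) \<Longrightarrow> n \<noteq> 0 \<Longrightarrow>
       n ^ (2 * k) * bieval f (dilate A (1 + d / n) Q) = bieval \<alpha>' Q + bieval \<beta>' Q * n"
      using conj_form_dilate[of A f d] unfolding conj_form_def by blast
    \<comment> \<open>On the circle the value \<open>n = d\<close> is available at every point, so membership of \<open>A + 2 (Q - A)\<close> in \<open>C\<close>
      is a polynomial condition on \<open>Q\<close> and extends from \<open>\<Omega>\<close> to its closure \<open>M\<close>.\<close>
    define G where "G = \<alpha>' + \<beta>' * [:[:d:]:]"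
    have G: "bieval G Q = d ^ (2 * k) * bieval f (dilate A 2 Q)" if "Q \<in> M" for Q
    proof -
      have "d\<^sup>2 = normsq (Q - A)" using subsetD[OF M_circ that] circ by simp
      from *[OF this d_nonzero] d_nonzero show ?thesis
        by (simp add: G_def bieval.hom_add bieval.hom_mult mult.commute)
    qed
    have "\<Omega> \<subseteq> zero_locus G"
      using double G \<Omega>(1) f by (auto simp: zero_locus_def)
    then have "M \<subseteq> zero_locus G"
      unfolding \<Omega>(2)[symmetric] by (rule zariski_closure_minimal) (rule zariski_closed_zero_locus)
    then have doubleM: "dilate A 2 Q \<in> C" if "Q \<in> M" for Q
      using that G[OF that] d_nonzero f by (auto simp: zero_locus_def)
    define Y where "Y = ratdilate A (const_ratfun 2) X"
    have Yval: "ratpair_value Y t (dilate A 2 Q)" if "ratpair_value X t Q" for t Q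
      unfolding Y_def by (intro ratpair_value_ratdilate ratfun_value_const that)
    have "nonconstant Y"
    proof (rule nonconstantI)
      fix Q0
      from cofinite_ex[OF cofinite_ratpair_avoids[OF X(1), of "{dilate A (1 / 2) Q0}"]]
      obtain t Q where Q: "ratpair_value X t Q" "Q \<noteq> dilate A (1 / 2) Q0" by auto
      have "dilate A 2 Q \<noteq> Q0" using Q(2) by (auto simp: dilate_dilate)
      with Yval[OF Q(1)] show "\<exists>t. \<not> ratpair_value Y t Q0" using ratpair_value_unique by metis
    qed
    moreover have "\<forall>\<^sub>\<infinity>t. \<exists>Q. ratpair_value Y t Q \<and> Q \<in> C"
      using cofinite_ratpair_value[of X]
    proof eventually_elim
      case (elim t)
      then obtain Q where "ratpair_value X t Q" by blast
      with Yval doubleM ratpair_value_in_param_closure X(2) show ?case by blast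
    qed
    ultimately have "parametrization Y C" by (rule parametrizationI[OF irreducible])
    moreover have "ratnormsq A Y = (const_ratfun (2 * d))\<^sup>2"
    proof -
      have "bieval_ratpair circ X = 0" using M_circ param_closure_subset_zero_locus[of X circ] X(2) by simp
      then have "ratnormsq A X = const_ratfun (d\<^sup>2)"
        by (simp add: circ_def bieval_ratpair.hom_minus bieval_ratpair_normsq_poly)
      then show ?thesis
        unfolding Y_def ratnormsq_ratdilate
        by (simp only: power_mult_distrib power2_eq_square const_ratfun_simps ac_simps)
    qed
    ultimately show ?thesis unfolding rdf_parametrization_def ratnormsq_def by blast
  qed
qed

text \<open>
  The conchoid is the union of the closures of the two shifted pairs. If \<open>G\<close> vanishes on both of them
  and \<open>\<alpha> + \<beta> n\<close> is its pullback under the shift, then \<open>\<alpha> \<plusminus> \<beta> \<mu>\<close> is zero along \<open>P\<close> for both signs,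
  so \<open>\<alpha>\<close> and \<open>\<beta>\<close> vanish on \<open>C\<close> and \<open>G\<close> at every point incident with \<open>C\<close>. A shifted pair is
  constant only if \<open>\<mu> = \<plusminus>d\<close>, that is, for the circle of radius \<open>d\<close> about \<open>A\<close>.
\<close>

lemma rational_components_of_rdf:
  assumes rdf: "rdf_parametrization A P C" and M: "M \<in> irreducible_components (conchoid C A d)"
  shows "rational_curve M"
proof -
  from rdf obtain \<mu> where par: "parametrization P C" and \<mu>2: "ratnormsq A P = \<mu>\<^sup>2"
    unfolding rdf_parametrization_def ratnormsq_def by blast
  then have P: "nonconstant P" "param_closure P = C" by (simp_all add: parametrization_iff)
  have "\<mu> \<noteq> 0"
  proof
    assume "\<mu> = 0"
    then have "bieval_ratpair (normsq_poly A) P = 0" using \<mu>2 by (simp add: bieval_ratpair_normsq_poly)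
    then have "C \<subseteq> zero_locus (normsq_poly A)" using param_closure_subset_zero_locus[of P] P(2) by simp
    then have "{y \<in> C. normsq (y - A) = 0} = C" by (auto simp: zero_locus_def)
    with finite_isotropic infinite_C show False by simp
  qed
  define X where "X \<eta> = ratdilate A (1 + const_ratfun d / \<eta>) P" for \<eta>
  have vals: "\<forall>\<^sub>\<infinity>t. \<exists>y m. ratpair_value P t y \<and> ratfun_value \<eta> t m \<and> m\<^sup>2 = normsq (y - A) \<and> m \<noteq> 0 \<and> y \<in> C \<and>
      ratpair_value (X \<eta>) t (dilate A (1 + d / m) y)" if \<eta>: "\<eta> \<noteq> 0" "\<eta>\<^sup>2 = ratnormsq A P" for \<eta>
    using cofinite_ratpair_value[of P] cofinite_ratfun_nonzero[OF \<eta>(1)]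
  proof eventually_elim
    case (elim t)
    then obtain y m where y: "ratpair_value P t y" and m: "ratfun_value \<eta> t m" "m \<noteq> 0" by blast
    have "m\<^sup>2 = normsq (y - A)"
      using ratfun_value_power[OF m(1), of 2] ratfun_value_ratnormsq[OF y, of A] unfolding \<eta>(2)
      by (rule ratfun_value_unique)
    moreover have "y \<in> C" using ratpair_value_in_param_closure[OF y] P(2) by simp
    moreover have "ratpair_value (X \<eta>) t (dilate A (1 + d / m) y)"
      unfolding X_def
      using ratfun_value_add[OF ratfun_value_const[of 1 t] ratfun_value_divide[OF ratfun_value_const[of d t] m]]
      by (intro ratpair_value_ratdilate y) (simp add: const_ratfun_simps)
    ultimately show ?case using y m by blast
  qed
  have nonconst: "nonconstant (X \<eta>)" if \<eta>: "\<eta> \<noteq> 0" "\<eta>\<^sup>2 = ratnormsq A P" for \<eta>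
  proof (rule nonconstantI)
    fix Q0
    show "\<exists>t. \<not> ratpair_value (X \<eta>) t Q0"
    proof (rule ccontr)
      assume "\<not> ?thesis"
      then have X: "ratpair_value (X \<eta>) t Q0" for t by blast
      have "\<eta> + const_ratfun d \<noteq> 0"
      proof
        assume "\<eta> + const_ratfun d = 0"
        then have "\<eta> = - const_ratfun d" by (simp add: add_eq_0_iff2)
        then have "ratnormsq A P = const_ratfun (d\<^sup>2)"
          unfolding \<eta>(2)[symmetric] by (simp only: power2_eq_square const_ratfun_simps minus_mult_minus)
        then have "bieval_ratpair (normsq_poly A - [:[:d\<^sup>2:]:]) P = 0"
          by (simp add: bieval_ratpair.hom_minus bieval_ratpair_normsq_poly)
        then have "C \<subseteq> zero_locus (normsq_poly A - [:[:d\<^sup>2:]:])"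
          using param_closure_subset_zero_locus[of P] P(2) by simp
        also have "\<dots> = {(y1, y2). (y1 - fst A)\<^sup>2 + (y2 - snd A)\<^sup>2 = d\<^sup>2}"
          by (auto simp: zero_locus_def bieval.hom_minus normsq_def)
        finally show False
          using irreducible_curve_subset_eq[OF irreducible irreducible_curve_circle[OF d_nonzero]] not_circle by blast
      qed
      show False
      proof (rule shift_not_constant[OF P(1)])
        show "\<forall>\<^sub>\<infinity>t. \<exists>y m. ratpair_value P t y \<and> m\<^sup>2 = normsq (y - A) \<and> m \<noteq> 0 \<and> m + d \<noteq> 0 \<and>
            dilate A (1 + d / m) y = Q0"
          using vals[OF \<eta>] cofinite_ratfun_nonzero[OF \<open>\<eta> + const_ratfun d \<noteq> 0\<close>]
        proof eventually_elim
          case (elim t)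
          then obtain y m e where *: "ratpair_value P t y" "ratfun_value \<eta> t m" "m\<^sup>2 = normsq (y - A)" "m \<noteq> 0"
            "ratpair_value (X \<eta>) t (dilate A (1 + d / m) y)"
            "ratfun_value (\<eta> + const_ratfun d) t e" "e \<noteq> 0" by blast
          have "e = m + d" using *(6) ratfun_value_add[OF *(2) ratfun_value_const[of d t]]
            by (rule ratfun_value_unique)
          moreover have "dilate A (1 + d / m) y = Q0" using *(5) X by (rule ratpair_value_unique)
          ultimately show ?case using * by blast
        qed
      qed
    qed
  qed
  have \<mu>: "\<mu> \<noteq> 0" "\<mu>\<^sup>2 = ratnormsq A P" "- \<mu> \<noteq> 0" "(- \<mu>)\<^sup>2 = ratnormsq A P"
    using \<open>\<mu> \<noteq> 0\<close> \<mu>2 by auto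
  have closed: "zariski_closed (conchoid C A d)" by (simp add: conchoid_def)
  have sub: "param_closure (X \<eta>) \<subseteq> conchoid C A d" if \<eta>: "\<eta> \<noteq> 0" "\<eta>\<^sup>2 = ratnormsq A P" for \<eta>
  proof (rule param_closure_subset[OF closed])
    show "\<forall>\<^sub>\<infinity>t. \<exists>Q. ratpair_value (X \<eta>) t Q \<and> Q \<in> conchoid C A d"
      using vals[OF \<eta>] by eventually_elim (use incidence_in_conchoid[OF incidenceI] in blast)
  qed
  define U where "U = param_closure (X \<mu>) \<union> param_closure (X (- \<mu>))"
  have closedU: "zariski_closed U" unfolding U_def
    by (intro zariski_closed_Un) (simp_all add: param_closure_def)
  have "Q \<in> U" if inc: "(Q, y, l) \<in> conchoid_incidence C A d" for Q y l
  proof (rule ccontr)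
    assume "Q \<notin> U"
    then obtain G where G: "U \<subseteq> zero_locus G" "bieval G Q \<noteq> 0"
      using zariski_closed_separate[OF closedU] by blast
    obtain k \<alpha> \<beta> where *: "\<And>Q n. n\<^sup>2 = normsq (Q - A) \<Longrightarrow> n \<noteq> 0 \<Longrightarrow>
       n ^ (2 * k) * bieval G (dilate A (1 + d / n) Q) = bieval \<alpha> Q + bieval \<beta> Q * n"
      using conj_form_dilate[of A G d] unfolding conj_form_def by blast
    have both: "\<forall>\<^sub>\<infinity>t. \<exists>Q. ratpair_value P t Q \<and> bieval \<alpha> Q = 0 \<and> bieval \<beta> Q = 0"
      using vals[OF \<mu>(1,2)] vals[OF \<mu>(3,4)]
    proof eventually_elim
      case (elim t)
      then obtain y m y' m' where y: "ratpair_value P t y" "ratfun_value \<mu> t m" "m\<^sup>2 = normsq (y - A)" "m \<noteq> 0"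
        "ratpair_value (X \<mu>) t (dilate A (1 + d / m) y)"
        and y': "ratpair_value P t y'" "ratfun_value (- \<mu>) t m'" "m'\<^sup>2 = normsq (y' - A)" "m' \<noteq> 0"
        "ratpair_value (X (- \<mu>)) t (dilate A (1 + d / m') y')" by blast
      have yy: "y' = y" using y'(1) y(1) by (rule ratpair_value_unique)
      have "ratfun_value (- \<mu>) t (- m)"
        using ratfun_value_diff[OF ratfun_value_const[of 0 t] y(2)] by (simp add: const_ratfun_simps)
      with y'(2) have mm: "m' = - m" by (rule ratfun_value_unique)
      have "dilate A (1 + d / m) y \<in> U" "dilate A (1 + d / m') y' \<in> U"
        using ratpair_value_in_param_closure[OF y(5)] ratpair_value_in_param_closure[OF y'(5)]
        unfolding U_def by blast+
      then have "bieval G (dilate A (1 + d / m) y) = 0" "bieval G (dilate A (1 + d / m') y') = 0"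
        using G(1) unfolding zero_locus_def by blast+
      with *[OF y(3,4)] *[OF y'(3,4)] have "bieval \<alpha> y + bieval \<beta> y * m = 0" "bieval \<alpha> y - bieval \<beta> y * m = 0"
        unfolding yy mm by simp_all
      then have "2 * bieval \<alpha> y = 0" by (simp add: algebra_simps)
      then have "bieval \<alpha> y = 0" by simp
      with \<open>bieval \<alpha> y + bieval \<beta> y * m = 0\<close> y(4) have "bieval \<beta> y = 0" by simp
      with \<open>bieval \<alpha> y = 0\<close> y(1) show ?case by blast
    qed
    have "C \<subseteq> zero_locus \<alpha>" "C \<subseteq> zero_locus \<beta>"
      unfolding P(2)[symmetric] param_closure_subset_zero_locus
      by (rule bieval_ratpair_eq_0I, use both in eventually_elim, blast)+
    then have v: "bieval \<alpha> y = 0" "bieval \<beta> y = 0"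
      using incidence_normsq(1)[OF inc] by (auto simp: zero_locus_def)
    define n where "n = d / (l - 1)"
    have l: "l - 1 \<noteq> 0" using incidence_normsq(3)[OF inc] by simp
    have "n \<noteq> 0" using l d_nonzero by (simp add: n_def)
    moreover have "n\<^sup>2 = normsq (y - A)"
      using inc l by (simp add: incidence_iff n_def power_divide field_simps)
    ultimately have "bieval G (dilate A (1 + d / n) y) = 0" using *[of n y] v by simp
    moreover have "1 + d / n = l" using l d_nonzero by (simp add: n_def)
    ultimately show False using G(2) incidence_normsq(5)[OF inc] by simp
  qed
  then have "(\<lambda>(x, y, l). x) ` conchoid_incidence C A d \<subseteq> U" by auto
  then have "conchoid C A d \<subseteq> U" unfolding conchoid_def using closedU by (rule zariski_closure_minimal)
  with M have "M \<subseteq> U" and irr: "zariski_irreducible M"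
    and max: "\<And>N. zariski_closed N \<Longrightarrow> zariski_irreducible N \<Longrightarrow> M \<subseteq> N \<Longrightarrow> N \<subseteq> conchoid C A d \<Longrightarrow> N = M"
    unfolding irreducible_components_def by auto
  have pc: "zariski_closed (param_closure (X \<eta>))" for \<eta> by (simp add: param_closure_def)
  have "M \<subseteq> param_closure (X \<mu>) \<or> M \<subseteq> param_closure (X (- \<mu>))"
    using irr \<open>M \<subseteq> U\<close> pc unfolding zariski_irreducible_def U_def by blast
  then obtain \<eta> where \<eta>: "\<eta> \<noteq> 0" "\<eta>\<^sup>2 = ratnormsq A P" "M \<subseteq> param_closure (X \<eta>)" using \<mu> by blast
  have "param_closure (X \<eta>) = M"
    by (rule max[OF pc zariski_irreducible_param_closure \<eta>(3) sub[OF \<eta>(1,2)]])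
  with rational_curve_param_closure[OF nonconst[OF \<eta>(1,2)]] show ?thesis by simp
qed

end


section \<open>The reparametrizing curve\<close>

lemma reparam_expr_eq:
  "reparam_expr A P = [: - (snd P - const_ratfun (snd A)), - 2 * (fst P - const_ratfun (fst A)),
     snd P - const_ratfun (snd A) :]"
proof -
  have "([:0, 1:] :: 'a poly fract poly)\<^sup>2 - 1 = [:- 1, 0, 1:]"
    by (rule poly_eqI) (simp add: power2_eq_square coeff_pCons split: nat.split)
  then show ?thesis
    unfolding reparam_expr_def Let_def by (simp add: numeral_poly)
qed

text \<open>
  A denominator \<open>q\<close> of least degree has no factor in common with all the coefficients.
\<close>

lemma numerator_exists: "\<exists>H. is_numerator E (H :: 'a::field bipoly)"
proof -
  define R where "R q \<longleftrightarrow> q \<noteq> 0 \<and> (\<exists>H. map_poly to_fract H = smult (to_fract q) E)" for q :: "'a poly"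
  obtain e g where eg: "e \<noteq> 0" "\<And>i. i < Suc (degree E) \<Longrightarrow> coeff E i * to_fract e = to_fract (g i)"
    using common_denominator[of "Suc (degree E)" "coeff E"] by blast
  define H0 where "H0 = (\<Sum>i<Suc (degree E). monom (g i) i)"
  have cH0: "coeff H0 i = (if i < Suc (degree E) then g i else 0)" for i
    unfolding H0_def coeff_sum by simp
  have "map_poly to_fract H0 = smult (to_fract e) E"
  proof (rule poly_eqI)
    fix i
    show "coeff (map_poly to_fract H0) i = coeff (smult (to_fract e) E) i"
    proof (cases "i < Suc (degree E)")
      case True
      then show ?thesis using eg(2)[OF True] by (simp add: coeff_map_poly cH0 mult.commute)
    next
      case False
      then show ?thesis by (simp add: coeff_map_poly cH0 coeff_eq_0)
    qed
  qed
  with eg(1) have "R e" unfolding R_def by blast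
  then obtain q where q: "R q" "\<And>q'. R q' \<Longrightarrow> degree q \<le> degree q'"
    using ex_has_least_nat[of R e degree] by blast
  then obtain H where H: "q \<noteq> 0" "map_poly to_fract H = smult (to_fract q) E" unfolding R_def by blast
  have "is_unit c" if c: "c dvd q" "\<And>i. c dvd coeff H i" for c
  proof -
    obtain q' where q': "q = c * q'" using c(1) ..
    have "[:c:] dvd H" using c(2) by (simp add: const_poly_dvd_iff)
    then obtain H' where "H = [:c:] * H'" ..
    then have H': "H = smult c H'" by simp
    have ne: "c \<noteq> 0" "q' \<noteq> 0" using H(1) q' by auto
    have "map_poly to_fract H' = smult (to_fract q') E"
    proof (rule poly_eqI)
      fix i
      have "to_fract c * to_fract (coeff H' i) = to_fract c * (to_fract q' * coeff E i)"
        using arg_cong[OF H(2), of "\<lambda>p. coeff p i"] by (simp add: coeff_map_poly H' q' mult.assoc)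
      with ne show "coeff (map_poly to_fract H') i = coeff (smult (to_fract q') E) i"
        by (simp add: coeff_map_poly)
    qed
    with ne have "R q'" unfolding R_def by blast
    then have "degree q \<le> degree q'" by (rule q(2))
    moreover have "degree q = degree c + degree q'" unfolding q' using ne by (rule degree_mult_eq)
    ultimately have "degree c = 0" by simp
    with ne show ?thesis by (simp add: is_unit_iff_degree)
  qed
  with H show ?thesis unfolding is_numerator_def by blast
qed

lemma primitive_part_exists:
  fixes H :: "'a::field bipoly"
  assumes "H \<noteq> 0"
  shows "\<exists>G. is_primitive_part H G"
proof -
  define R where "R G \<longleftrightarrow> (\<exists>c. H = smult c G)" for G
  have "R H" unfolding R_def by (rule exI[of _ 1]) simp
  then obtain G where G: "R G" "\<And>G'. R G' \<Longrightarrow> degree (lead_coeff G) \<le> degree (lead_coeff G')"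
    using ex_has_least_nat[of R H "\<lambda>G. degree (lead_coeff G)"] by blast
  from G(1) obtain c where c: "H = smult c G" unfolding R_def by blast
  with assms have "G \<noteq> 0" by auto
  have "is_unit e" if e: "\<And>i. e dvd coeff G i" for e
  proof -
    have "[:e:] dvd G" using e by (simp add: const_poly_dvd_iff)
    then obtain G' where "G = [:e:] * G'" ..
    then have G': "G = smult e G'" by simp
    with \<open>G \<noteq> 0\<close> have ne: "e \<noteq> 0" "G' \<noteq> 0" by auto
    have "R G'" unfolding R_def c G' by (rule exI[of _ "c * e"]) simp
    then have "degree (lead_coeff G) \<le> degree (lead_coeff G')" by (rule G(2))
    moreover have "degree (lead_coeff G) = degree e + degree (lead_coeff G')"
    proof -
      have "lead_coeff G = e * lead_coeff G'" unfolding G' by (rule lead_coeff_smult)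
      then show ?thesis using ne by (simp add: degree_mult_eq)
    qed
    ultimately have "degree e = 0" by simp
    with ne show ?thesis by (simp add: is_unit_iff_degree)
  qed
  then have "is_primitive_part H G" unfolding is_primitive_part_def primitive_bipoly_def using c by blast
  then show ?thesis ..
qed

lemma const_ratfun_minus_2: "const_ratfun (- 2) = (- 2 :: 'a::field poly fract)"
proof -
  have "const_ratfun (- 2) = - (const_ratfun 1 + const_ratfun 1 :: 'a poly fract)"
    unfolding const_ratfun_simps(3)[symmetric] const_ratfun_simps(6)[symmetric] by simp
  then show ?thesis by (simp add: const_ratfun_simps)
qed

text \<open>
  The equation of the reparametrizing curve at a point \<open>Q\<close> of \<open>C\<close>. It vanishes exactly when the vector
  \<open>Q - A\<close> is proportional to \<open>(y\<^sup>2 - 1, 2 y)\<close> or zero, the usual parametrization of directions by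
  the half angle; this is why a rational solution makes the squared norm the square of a rational
  function.
\<close>

definition half_angle :: "'a::field \<times> 'a \<Rightarrow> 'a \<times> 'a \<Rightarrow> 'a \<Rightarrow> 'a" where
  "half_angle A Q y = - 2 * y * (fst Q - fst A) + (y\<^sup>2 - 1) * (snd Q - snd A)"

lemma numerator_values:
  fixes H :: "'a::field_char_0 bipoly"
  assumes "is_numerator (reparam_expr A P) H"
  shows "\<forall>\<^sub>\<infinity>v. \<exists>k. k \<noteq> 0 \<and> (\<forall>Q y. ratpair_value P v Q \<longrightarrow> bieval H (v, y) = k * half_angle A Q y)"
proof -
  from assms obtain q where q: "q \<noteq> 0" "map_poly to_fract H = smult (to_fract q) (reparam_expr A P)"
    unfolding is_numerator_def by blast
  have coeff: "to_fract (coeff H i) = to_fract q * coeff (reparam_expr A P) i" for i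
    using arg_cong[OF q(2), of "\<lambda>p. coeff p i"] by (simp add: coeff_map_poly)
  define h0 h1 h2 where "h0 = coeff H 0" and "h1 = coeff H 1" and "h2 = coeff H 2"
  have h: "to_fract h0 = to_fract q * (const_ratfun (- 1) * (snd P - const_ratfun (snd A)))"
    "to_fract h1 = to_fract q * (const_ratfun (- 2) * (fst P - const_ratfun (fst A)))"
    "to_fract h2 = to_fract q * (snd P - const_ratfun (snd A))"
  proof -
    show "to_fract h0 = to_fract q * (const_ratfun (- 1) * (snd P - const_ratfun (snd A)))"
      "to_fract h1 = to_fract q * (const_ratfun (- 2) * (fst P - const_ratfun (fst A)))"
      "to_fract h2 = to_fract q * (snd P - const_ratfun (snd A))"
      unfolding h0_def h1_def h2_def coeff const_ratfun_minus_2 reparam_expr_eq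
      by (simp_all add: const_ratfun_simps numeral_2_eq_2)
  qed
  have "coeff H i = 0" if "i > 2" for i
  proof -
    have "coeff (reparam_expr A P) i = 0"
      unfolding reparam_expr_eq using that by (intro coeff_eq_0) auto
    with coeff[of i] show ?thesis by simp
  qed
  then have H: "H = [:h0, h1, h2:]"
    by (intro poly_eqI) (auto simp: h0_def h1_def h2_def coeff_pCons numeral_2_eq_2 split: nat.split)
  show ?thesis
    using cofinite_poly_nonzero[OF q(1)]
  proof eventually_elim
    case (elim v)
    have "bieval H (v, y) = poly q v * half_angle A Q y" if Q: "ratpair_value P v Q" for Q y
    proof -
      have f: "ratfun_value (fst P) v (fst Q)" "ratfun_value (snd P) v (snd Q)"
        using Q by (auto simp: ratpair_value_def)
      have "ratfun_value (to_fract h0) v (poly q v * ((- 1) * (snd Q - snd A)))"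
        "ratfun_value (to_fract h1) v (poly q v * ((- 2) * (fst Q - fst A)))"
        "ratfun_value (to_fract h2) v (poly q v * (snd Q - snd A))"
        unfolding h
        by (intro ratfun_value_mult ratfun_value_diff ratfun_value_to_fract ratfun_value_const f)+
      then have hv: "poly h0 v = poly q v * ((- 1) * (snd Q - snd A))"
        "poly h1 v = poly q v * ((- 2) * (fst Q - fst A))"
        "poly h2 v = poly q v * (snd Q - snd A)"
        using ratfun_value_unique[OF ratfun_value_to_fract] by blast+
      have "bieval H (v, y) = poly h0 v + y * (poly h1 v + y * poly h2 v)" by (simp add: H)
      also have "\<dots> = poly q v * half_angle A Q y"
        unfolding hv half_angle_def by (simp add: power2_eq_square algebra_simps)
      finally show ?thesis .
    qed
    with elim show ?case by blast
  qed
qed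

lemma half_angle_ratfun_value:
  assumes "ratpair_value Y t Q" "ratfun_value w t y"
  shows "ratfun_value (const_ratfun (- 2) * w * (fst Y - const_ratfun (fst A)) +
    (w\<^sup>2 - const_ratfun 1) * (snd Y - const_ratfun (snd A))) t (half_angle A Q y)"
  using assms unfolding ratpair_value_def half_angle_def
  by (intro ratfun_value_add ratfun_value_mult ratfun_value_diff ratfun_value_power ratfun_value_const) auto

text \<open>
  For \<open>w \<noteq> 0\<close> the vector \<open>(x, y)\<close> is \<open>y/(2 w)\<close> times \<open>(w\<^sup>2 - 1, 2 w)\<close>, whose squared norm is
  \<open>(w\<^sup>2 + 1)\<^sup>2\<close>.
\<close>

lemma half_angle_square:
  fixes x y w :: "'a::field_char_0 poly fract"
  assumes "- 2 * w * x + (w\<^sup>2 - 1) * y = 0"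
  shows "\<exists>m. x\<^sup>2 + y\<^sup>2 = m\<^sup>2"
proof (cases "w = 0")
  case True
  with assms have "y = 0" by simp
  then show ?thesis by auto
next
  case False
  have two: "(2 :: 'a poly fract) \<noteq> 0"
  proof
    assume "(2 :: 'a poly fract) = 0"
    then have "const_ratfun (- 2 :: 'a) = 0" unfolding const_ratfun_minus_2 by simp
    then show False by simp
  qed
  have x: "2 * w * x = (w\<^sup>2 - 1) * y" using assms by (simp add: algebra_simps)
  have D: "(2 * w)\<^sup>2 \<noteq> 0" using False two by (simp only: power_eq_0_iff mult_eq_0_iff) simp
  have "(2 * w)\<^sup>2 * (x\<^sup>2 + y\<^sup>2) = (2 * w * x)\<^sup>2 + (2 * w * y)\<^sup>2"
    by (simp add: power_mult_distrib algebra_simps)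
  also have "\<dots> = ((w\<^sup>2 + 1) * y)\<^sup>2"
    unfolding x by (simp add: power2_eq_square algebra_simps)
  finally have eq: "(2 * w)\<^sup>2 * (x\<^sup>2 + y\<^sup>2) = ((w\<^sup>2 + 1) * y)\<^sup>2" .
  have "x\<^sup>2 + y\<^sup>2 = (2 * w)\<^sup>2 * (x\<^sup>2 + y\<^sup>2) / (2 * w)\<^sup>2"
    by (rule nonzero_mult_div_cancel_left[OF D, symmetric])
  also have "\<dots> = ((w\<^sup>2 + 1) * y / (2 * w))\<^sup>2" unfolding eq power_divide ..
  finally have "x\<^sup>2 + y\<^sup>2 = ((w\<^sup>2 + 1) * y / (2 * w))\<^sup>2" .
  then show ?thesis by blast
qed

text \<open>
  A parametrization \<open>(r, w)\<close> of the component gives \<open>Y = P(r)\<close>. Here \<open>r\<close> is not constant, because a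
  vertical line cannot be a component of the zero locus of a primitive polynomial.
\<close>

lemma rdf_of_reparam_component:
  fixes C :: "('a::{alg_closed_field, field_char_0} \<times> 'a) set"
  assumes C: "irreducible_curve C" "parametrization P C"
    and M: "M \<in> reparam_components A P" "rational_curve M"
  shows "\<exists>Y. rdf_parametrization A Y C"
proof -
  from M(1) obtain H G g where H: "is_numerator (reparam_expr A P) H" and G: "is_primitive_part H G"
    and g: "irreducible g" "g dvd G" "M = zero_locus g"
    unfolding reparam_components_def curve_components_def by blast
  from G obtain c where c: "H = smult c G" and prim: "primitive_bipoly G"
    unfolding is_primitive_part_def by blast
  from M(2) obtain W where "parametrization W M" unfolding rational_curve_def by blast
  then have W: "nonconstant W" "param_closure W = M" by (simp_all add: parametrization_iff)
  define r w where "r = fst W" and "w = snd W"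
  have gW: "bieval g Q = 0" if "ratpair_value W t Q" for t Q
    using ratpair_value_in_param_closure[OF that] W(2) g(3) by (simp add: zero_locus_def)
  have r: "r \<notin> range const_ratfun"
  proof
    assume "r \<in> range const_ratfun"
    then obtain r0 where r0: "r = const_ratfun r0" by blast
    with W(1) have w: "w \<notin> range const_ratfun" by (auto simp: nonconstant_def r_def w_def)
    have "slice r0 g = 0"
    proof (rule ccontr)
      assume "slice r0 g \<noteq> 0"
      from cofinite_ex[OF cofinite_compose[OF cofinite_poly_nonzero[OF this] w]] obtain t y
        where y: "ratfun_value w t y" "poly (slice r0 g) y \<noteq> 0" by blast
      have "ratpair_value W t (r0, y)"
        using y(1) ratfun_value_const[of r0 t] r0 by (simp add: ratpair_value_def r_def w_def)
      from gW[OF this] y(2) show False by (simp add: bieval_slice)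
    qed
    then have "[:[:- r0, 1:]:] dvd G" using g(2) unfolding slice_eq_0_iff by (rule dvd_trans)
    then have "is_unit [:- r0, 1:]"
      using prim unfolding primitive_bipoly_def const_poly_dvd_iff by blast
    then show False by (auto simp: is_unit_iff_degree)
  qed
  obtain Y where Y: "parametrization Y C"
    and Yval: "\<And>t v Q. ratfun_value r t v \<Longrightarrow> ratpair_value P v Q \<Longrightarrow> ratpair_value Y t Q"
    using parametrization_compose[OF C r] by blast
  define e where "e = const_ratfun (- 2) * w * (fst Y - const_ratfun (fst A)) +
    (w\<^sup>2 - const_ratfun 1) * (snd Y - const_ratfun (snd A))"
  have "e = 0"
  proof (rule ratfun_eqI)
    show "\<forall>\<^sub>\<infinity>t. \<exists>v. ratfun_value e t v \<and> ratfun_value 0 t v"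
      using cofinite_compose[OF eventually_conj[OF numerator_values[OF H] cofinite_ratpair_value[of P]] r]
        cofinite_ratpair_value[of W]
    proof eventually_elim
      case (elim t)
      then obtain v k Q V where v: "ratfun_value r t v" and k: "k \<noteq> 0"
        and HQ: "\<And>Q y. ratpair_value P v Q \<Longrightarrow> bieval H (v, y) = k * half_angle A Q y"
        and Q: "ratpair_value P v Q" and V: "ratpair_value W t V" by blast
      have "fst V = v" using V v ratfun_value_unique by (fastforce simp: ratpair_value_def r_def)
      then have "bieval g (v, snd V) = 0" using gW[OF V] by (metis prod.collapse)
      then have "bieval H (v, snd V) = 0"
        using g(2) unfolding c by (auto simp: bieval.hom_mult elim!: dvdE)
      with HQ[OF Q] k have "half_angle A Q (snd V) = 0" by simp
      moreover have "ratfun_value e t (half_angle A Q (snd V))"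
        unfolding e_def using half_angle_ratfun_value[OF Yval[OF v Q]] V by (simp add: ratpair_value_def w_def)
      ultimately show ?case by (auto simp: ratfun_value_0)
    qed
  qed
  then have "- 2 * w * (fst Y - const_ratfun (fst A)) + (w\<^sup>2 - 1) * (snd Y - const_ratfun (snd A)) = 0"
    by (simp only: e_def const_ratfun_minus_2 const_ratfun_simps(2))
  from half_angle_square[OF this] Y show ?thesis unfolding rdf_parametrization_def by blast
qed

context conchoid_base
begin

lemma snd_parametrization:
  assumes "parametrization P C"
  shows "snd P - const_ratfun (snd A) \<noteq> 0"
proof
  assume 0: "snd P - const_ratfun (snd A) = 0"
  let ?F = "[:[:- snd A:], 1:]"
  have "bieval_ratpair ?F P = 0" using 0 by (simp add: const_ratfun_simps)
  then have "C \<subseteq> zero_locus ?F"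
    using param_closure_subset_zero_locus[of P ?F] assms by (simp add: parametrization_iff)
  then have "C \<inter> {(y1, y2). 0 * (y1 - fst A) + 1 * (y2 - snd A) = 0} = C"
    by (auto simp: zero_locus_def)
  with finite_line[of 0 1] infinite_C show False by simp
qed

text \<open>
  Write \<open>Y = P(r)\<close>, using that \<open>P\<close> is proper. If \<open>(x, y)\<close> is \<open>Y - A\<close> and \<open>x\<^sup>2 + y\<^sup>2 = \<mu>\<^sup>2\<close>, then
  \<open>w = (x + \<mu>)/y\<close> solves the quadratic equation, and the closure of the points \<open>(r, w)\<close> is a component
  of the reparametrizing curve.
\<close>

lemma reparam_component_of_rdf:
  assumes rdf: "rdf_parametrization A Y C" and P: "proper_parametrization P C"
  shows "\<exists>M\<in>reparam_components A P. rational_curve M"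
proof -
  from rdf obtain \<mu> where Y: "parametrization Y C"
    and \<mu>: "(fst Y - const_ratfun (fst A))\<^sup>2 + (snd Y - const_ratfun (snd A))\<^sup>2 = \<mu>\<^sup>2"
    unfolding rdf_parametrization_def by blast
  have parP: "parametrization P C" using P unfolding proper_parametrization_def by blast
  obtain r where r: "r \<notin> range const_ratfun"
    and lift: "\<forall>\<^sub>\<infinity>t. \<exists>v Q. ratfun_value r t v \<and> ratpair_value Y t Q \<and> ratpair_value P v Q"
    by (rule proper_parametrization_lift[OF P Y])
  define x y where "x = fst Y - const_ratfun (fst A)" and "y = snd Y - const_ratfun (snd A)"
  have y0: "y \<noteq> 0" unfolding y_def by (rule snd_parametrization[OF Y])
  define w where "w = (x + \<mu>) / y"
  have "y * (- 2 * w * x + (w\<^sup>2 - 1) * y) = - 2 * (y * w) * x + (y * w)\<^sup>2 - y\<^sup>2"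
    by (simp add: power2_eq_square algebra_simps)
  also have "y * w = x + \<mu>" using y0 by (simp add: w_def)
  also have "- 2 * (x + \<mu>) * x + (x + \<mu>)\<^sup>2 - y\<^sup>2 = \<mu>\<^sup>2 - (x\<^sup>2 + y\<^sup>2)"
    by (simp add: power2_eq_square algebra_simps)
  also have "\<dots> = 0" using \<mu> by (simp add: x_def y_def)
  finally have w: "- 2 * w * x + (w\<^sup>2 - 1) * y = 0" using y0 by simp
  define W where "W = (r, w)"
  have "nonconstant W" using r by (simp add: nonconstant_def W_def)
  obtain H where H: "is_numerator (reparam_expr A P) H" using numerator_exists by blast
  have "H \<noteq> 0"
  proof
    assume "H = 0"
    with H obtain q where "q \<noteq> 0" "smult (to_fract q) (reparam_expr A P) = 0"
      unfolding is_numerator_def by auto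
    then have "reparam_expr A P = 0" by simp
    with snd_parametrization[OF parP] show False by (simp add: reparam_expr_eq)
  qed
  then obtain G where G: "is_primitive_part H G" using primitive_part_exists by blast
  then obtain c where c: "H = smult c G" unfolding is_primitive_part_def by blast
  with \<open>H \<noteq> 0\<close> have "c \<noteq> 0" "G \<noteq> 0" by auto
  have "bieval_ratpair H W = 0"
  proof (rule bieval_ratpair_eq_0I)
    show "\<forall>\<^sub>\<infinity>t. \<exists>V. ratpair_value W t V \<and> bieval H V = 0"
      using lift cofinite_compose[OF numerator_values[OF H] r] cofinite_ratfun_value[of w]
    proof eventually_elim
      case (elim t)
      then obtain v Q v' k z where v: "ratfun_value r t v" and Q: "ratpair_value Y t Q" "ratpair_value P v Q"
        and v': "ratfun_value r t v'"
        and HQ: "\<And>Q y. ratpair_value P v' Q \<Longrightarrow> bieval H (v', y) = k * half_angle A Q y"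
        and z: "ratfun_value w t z" by blast
      have "v' = v" using v' v by (rule ratfun_value_unique)
      have "ratfun_value (- 2 * w * x + (w\<^sup>2 - 1) * y) t (half_angle A Q z)"
        using half_angle_ratfun_value[OF Q(1) z, of A]
        by (simp only: const_ratfun_minus_2 const_ratfun_simps(2) x_def y_def)
      then have "half_angle A Q z = 0" unfolding w by (simp add: ratfun_value_0)
      then have "bieval H (v, z) = 0" using HQ[of Q z] Q(2) \<open>v' = v\<close> by simp
      moreover have "ratpair_value W t (v, z)" using v z by (simp add: ratpair_value_def W_def)
      ultimately show ?case by blast
    qed
  qed
  then have "ratcomp c r * bieval_ratpair G W = 0" unfolding c by (simp add: W_def)
  with ratcomp_nonzero[OF r \<open>c \<noteq> 0\<close>] have "bieval_ratpair G W = 0" by simp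
  with \<open>G \<noteq> 0\<close> obtain g where g: "irreducible g" "g dvd G" "bieval_ratpair g W = 0"
    using irreducible_factor_vanishing by blast
  have "zero_locus g \<in> reparam_components A P"
    unfolding reparam_components_def curve_components_def using H G g by blast
  moreover have "rational_curve (zero_locus g)"
    using rational_curve_param_closure[OF \<open>nonconstant W\<close>]
      param_closure_zero_locus[OF \<open>nonconstant W\<close> g(1,3)] by simp
  ultimately show ?thesis by blast
qed

end

section \<open>The equivalences\<close>

theorem theorem3p5:
  fixes a b d :: "'a::{alg_closed_field, field_char_0}"
    and C :: "('a \<times> 'a) set"
  assumes "d \<noteq> 0"
    and "irreducible_curve C"
    and "\<And>i. i\<^sup>2 = - 1 \<Longrightarrow> C \<noteq> {(y1, y2). y1 + i * y2 = 0}"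
    and "C \<noteq> {(y1, y2). (y1 - a)\<^sup>2 + (y2 - b)\<^sup>2 = d\<^sup>2}"
    and "\<And>u v. (u, v) \<noteq> (0, 0) \<Longrightarrow> C \<noteq> {(y1, y2). u * (y1 - a) + v * (y2 - b) = 0}"
  shows
    "((rational_curve C \<and> (\<exists>P. rdf_parametrization (a, b) P C)) \<longleftrightarrow>
        (\<exists>M. simple_component C (a, b) d M \<and> rational_curve M)) \<and>
     ((rational_curve C \<and> (\<exists>P. rdf_parametrization (a, b) P C)) \<longleftrightarrow>
        (\<exists>P. proper_parametrization P C \<and>
             (\<exists>M\<in>reparam_components (a, b) P. rational_curve M))) \<and>
     ((rational_curve C \<and> (\<exists>P. rdf_parametrization (a, b) P C)) \<longleftrightarrow>
        rational_curve C \<and>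
        (\<forall>P. proper_parametrization P C \<longrightarrow>
             (\<exists>M\<in>reparam_components (a, b) P. rational_curve M))) \<and>
     ((rational_curve C \<and> (\<exists>P. rdf_parametrization (a, b) P C)) \<longleftrightarrow>
        (\<forall>M\<in>irreducible_components (conchoid C (a, b) d). rational_curve M))"
proof -
  interpret conchoid_base C "(a, b)" d
    using assms(1,2,4,5) by unfold_locales simp_all
  define rdf where "rdf \<longleftrightarrow> (\<exists>P. rdf_parametrization (a, b) P C)"
  have one: "rational_curve C \<and> (\<exists>P. rdf_parametrization (a, b) P C) \<longleftrightarrow> rdf"
    using assms(2) unfolding rdf_def rational_curve_def rdf_parametrization_def by blast
  have five_two: "\<exists>M. simple_component C (a, b) d M \<and> rational_curve M"
    if "\<forall>M\<in>irreducible_components (conchoid C (a, b) d). rational_curve M"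
    using exists_simple_component that unfolding simple_component_def by blast
  have one_five: "\<forall>M\<in>irreducible_components (conchoid C (a, b) d). rational_curve M" if rdf
    using that rational_components_of_rdf unfolding rdf_def by blast
  have two_one: rdf if "simple_component C (a, b) d M" "rational_curve M" for M
    using rdf_of_rational_simple_component[OF that] unfolding rdf_def .
  have one_four: "\<exists>M\<in>reparam_components (a, b) P. rational_curve M" if rdf "proper_parametrization P C" for P
    using that reparam_component_of_rdf unfolding rdf_def by blast
  have three_one: rdf if "proper_parametrization P C" "M \<in> reparam_components (a, b) P" "rational_curve M" for P M
  proof -
    have "parametrization P C" using that(1) unfolding proper_parametrization_def by blast
    from rdf_of_reparam_component[OF assms(2) this that(2,3)] show ?thesis unfolding rdf_def .
  qed
  have proper: "\<exists>P. proper_parametrization P C" if "rational_curve C"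
    using rational_curve_proper_parametrization[OF that] by blast
  have rat: "rational_curve C" if rdf using that one by blast
  show ?thesis
    unfolding one
    using five_two one_five two_one one_four three_one proper rat by blast
qed

end
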